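(* Let $d\in\{3,4,5\}$ and let $R_1^D(z)=\sum_j(z-\lambda_j)_+$ be the first Riesz-mean of the eigenvalues $\lambda_j$ (counted with multiplicity) of the Dirichlet Laplacian on the hemisphere $\mathbb{S}^d_+$. For all $z\geq0$, $$ R_1^D(z)\leq L^{class}_{1,d}|\mathbb{S}^d_+|z^{1+\frac d2}. $$
   Context: $\mathbb{S}^d$ is the round unit sphere in $\mathbb{R}^{d+1}$ and $\mathbb{S}^d_+=\mathbb{S}^d\cap\{x_{d+1}>0\}$. The distinct eigenvalues (energy levels) of the Dirichlet Laplacian on $\mathbb{S}^d_+$ are $\lambda_{(l)}=l(l+d-1)$, $l=1,2,3,\dots$, with multiplicity $\binom{d+l-2}{d-1}$; $a_+=\max(a,0)$. The semiclassical constant is $L_{\gamma,d}^{class}=(4\pi)^{-d/2}\frac{\Gamma(\gamma+1)}{\Gamma(\gamma+1+d/2)}$, so $L_{1,d}^{class}|\mathbb{S}_+^d|=\frac{2}{(d+2)\,d!}$. *)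

theory Defs
  imports "HOL-Analysis.Analysis" "HOL-Library.Function_Algebras"
begin

definition partial_deriv :: "'a::euclidean_space \<Rightarrow> ('a \<Rightarrow> real) \<Rightarrow> 'a \<Rightarrow> real" where
  "partial_deriv b f x = frechet_derivative f (at x) b"

text \<open>Meant for open \<open>S\<close>; there it is the usual notion of a twice continuously
  differentiable function.\<close>

definition C2_on :: "'a::euclidean_space set \<Rightarrow> ('a \<Rightarrow> real) \<Rightarrow> bool" where
  "C2_on S f \<longleftrightarrow>
     (\<forall>x\<in>S. f differentiable (at x)) \<and>
     (\<forall>a\<in>Basis. \<forall>x\<in>S. partial_deriv a f differentiable (at x)) \<and>
     (\<forall>a\<in>Basis. \<forall>b\<in>Basis. continuous_on S (partial_deriv b (partial_deriv a f)))"

definition laplacian :: "('a::euclidean_space \<Rightarrow> real) \<Rightarrow> 'a \<Rightarrow> real" where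
  "laplacian f x = (\<Sum>b\<in>Basis. partial_deriv b (partial_deriv b f) x)"

text \<open>
  A function \<open>u\<close> on a subset of the unit sphere is handled through its extension
  \<open>\<lambda>y. u (sgn y)\<close> that is homogeneous of degree 0 (here \<open>sgn y = y /\<^sub>R norm y\<close>).  Since the
  Euclidean Laplacian in polar coordinates is
  \<open>\<partial>\<^sub>r\<^sup>2 + (d / r) \<partial>\<^sub>r + (1 / r\<^sup>2) \<Delta>\<close>, where \<open>\<Delta>\<close> is the Laplace-Beltrami operator of the
  unit sphere of dimension \<open>d\<close>, applying it to that extension at a point of the sphere
  gives \<open>\<Delta> u\<close>.
\<close>

definition cone_over :: "'a::euclidean_space set \<Rightarrow> 'a set" where
  "cone_over \<Omega> = {x. x \<noteq> 0 \<and> sgn x \<in> \<Omega>}"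

definition C2_on_sphere :: "'a::euclidean_space set \<Rightarrow> ('a \<Rightarrow> real) \<Rightarrow> bool" where
  "C2_on_sphere \<Omega> u \<longleftrightarrow> C2_on (cone_over \<Omega>) (\<lambda>y. u (sgn y))"

definition laplace_beltrami :: "('a::euclidean_space \<Rightarrow> real) \<Rightarrow> 'a \<Rightarrow> real" where
  "laplace_beltrami u x = laplacian (\<lambda>y. u (sgn y)) x"

text \<open>
  Classical solutions of \<open>- \<Delta> u = \<mu> u\<close> in \<open>\<Omega>\<close>, \<open>u = 0\<close> on the boundary, for a relatively
  open subset \<open>\<Omega>\<close> of the unit sphere with smooth boundary \<open>closure \<Omega> - \<Omega>\<close>.  The condition
  that \<open>u\<close> vanishes off \<open>\<Omega>\<close> is the boundary condition on \<open>closure \<Omega> - \<Omega>\<close>; off \<open>closure \<Omega>\<close>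
  it only selects one representative, so that the dimension below is that of a space of
  functions on \<open>closure \<Omega>\<close>.
\<close>

definition dirichlet_eigenspace ::
    "'a::euclidean_space set \<Rightarrow> real \<Rightarrow> ('a \<Rightarrow> real) set" where
  "dirichlet_eigenspace \<Omega> \<mu> =
     {u. continuous_on (closure \<Omega>) u \<and>
         C2_on_sphere \<Omega> u \<and>
         (\<forall>x\<in>\<Omega>. - laplace_beltrami u x = \<mu> * u x) \<and>
         (\<forall>x. x \<notin> \<Omega> \<longrightarrow> u x = 0)}"

definition dirichlet_eigenvalues :: "'a::euclidean_space set \<Rightarrow> real set" where
  "dirichlet_eigenvalues \<Omega> = {\<mu>. \<exists>u\<in>dirichlet_eigenspace \<Omega> \<mu>. u \<noteq> (\<lambda>_. 0)}"

abbreviation (input) fun_scale :: "real \<Rightarrow> ('a \<Rightarrow> real) \<Rightarrow> 'a \<Rightarrow> real" where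
  "fun_scale \<equiv> \<lambda>c f x. c * f x"

global_interpretation fun_vs: vector_space fun_scale
  by unfold_locales (auto simp: fun_eq_iff algebra_simps)

text \<open>The library's \<open>dim\<close> is 0 on spaces of infinite dimension, hence the case distinction.\<close>

definition eigenvalue_multiplicity :: "'a::euclidean_space set \<Rightarrow> real \<Rightarrow> ennreal" where
  "eigenvalue_multiplicity \<Omega> \<mu> =
     (if \<exists>B. finite B \<and> dirichlet_eigenspace \<Omega> \<mu> \<subseteq> fun_vs.span B
      then of_nat (fun_vs.dim (dirichlet_eigenspace \<Omega> \<mu>)) else \<infinity>)"

text \<open>Valued in \<^typ>\<open>ennreal\<close>, so that a divergent sum is \<open>\<infinity>\<close> and not a default value.\<close>

definition riesz_mean_1 :: "'a::euclidean_space set \<Rightarrow> real \<Rightarrow> ennreal" where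
  "riesz_mean_1 \<Omega> z =
     (\<Sum>\<^sub>\<infinity>\<mu>\<in>dirichlet_eigenvalues \<Omega>. eigenvalue_multiplicity \<Omega> \<mu> * ennreal (max (z - \<mu>) 0))"

text \<open>The surface measure of the unit sphere: the volume of the cone with vertex 0 over \<open>\<Omega>\<close>
  of height 1, times the dimension of the ambient space.\<close>

definition sphere_measure :: "'a::euclidean_space set \<Rightarrow> real" where
  "sphere_measure \<Omega> = DIM('a) * measure lebesgue {x \<in> cone_over \<Omega>. norm x \<le> 1}"

definition L_class :: "real \<Rightarrow> nat \<Rightarrow> real" where
  "L_class \<gamma> d = (4 * pi) powr (- (d / 2)) * (Gamma (\<gamma> + 1) / Gamma (\<gamma> + 1 + d / 2))"

text \<open>With the ambient space written as the product of \<^typ>\<open>real ^ 'n\<close> and \<^typ>\<open>real\<close>, whose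
  norm is the Euclidean one, the last coordinate is \<^const>\<open>snd\<close>.\<close>

definition hemisphere :: "((real ^ 'n) \<times> real) set" where
  "hemisphere = {x \<in> sphere 0 1. 0 < snd x}"

end

theory Submission
  imports Defs
begin

text \<open>
  Only an upper bound for the spectrum is needed: every Dirichlet eigenvalue of the hemisphere is
  one of the numbers \<open>l (l + d - 1)\<close> with \<open>l \<ge> 1\<close>, and its multiplicity is at most
  \<open>(d + l - 2) choose (d - 1)\<close>.  Both facts follow from one expansion, and the rest is an
  inequality between polynomials.

  Let \<open>u\<close> be an eigenfunction with eigenvalue \<open>\<mu> > 0\<close> and choose \<open>\<alpha> > 0\<close> with
  \<open>\<mu> = \<alpha> (\<alpha> + d - 1)\<close>.  The extension \<open>v x = |x|\<^sup>\<alpha> u (x / |x|)\<close> is harmonic in the half space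
  \<open>x \<bullet> \<nu> > 0\<close>, continuous up to the boundary, zero there, and grows like \<open>|x|\<^sup>\<alpha>\<close>
  (\<open>cone_ext_half_harmonic\<close>).  By the maximum principle, applied with an explicit quadratic barrier
  to \<open>v\<close> minus its mirror image (\<open>barrier_comparison\<close>), a difference of \<open>v\<close> in a direction
  tangential to the boundary grows one order more slowly; it is again harmonic and zero on the
  boundary.  Hence tangential differences of order \<open>k > \<alpha>\<close> are bounded on half balls of radius
  \<open>R\<close> by a negative power of \<open>R\<close> and vanish identically (\<open>iterated_tangential_difference_zero\<close>).  By Frechet's theorem on
  finite differences (\<open>finite_difference_zero_imp_poly\<close>) \<open>v\<close> is then a polynomial in the tangential
  coordinates.  No integration, mean value property or regularity theory enters.

  Homogeneity turns this into a finite sum of terms \<open>c\<^sub>\<beta> (x \<bullet> \<nu>)\<^bsup>\<alpha> - |\<beta>|\<^esup> x\<^sup>\<beta>\<close>, where only \<open>|\<beta>| < \<alpha>\<close>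
  occurs since \<open>v\<close> vanishes on the boundary (\<open>homogeneous_expansion\<close>,
  \<open>slice_coeff_high_degree_zero\<close>).  The Laplace equation is a recursion that expresses
  \<open>(\<alpha> - |\<beta>|) (\<alpha> - |\<beta>| - 1) c\<^sub>\<beta>\<close> through coefficients of degree \<open>|\<beta>| + 2\<close>.  At a nonzero
  coefficient of maximal degree the factor must vanish, so \<open>\<alpha> = |\<beta>| + 1\<close> is an integer \<open>l\<close>
  (\<open>harmonic_coeffs_leading\<close>); and the coefficients of degree \<open>l - 1\<close> determine all others, which
  bounds the multiplicity by the number of monomials of degree \<open>l - 1\<close> in \<open>d\<close> variables.
  Eigenvalues \<open>\<mu> \<le> 0\<close> are excluded by the same barrier with the exponent \<open>1/2\<close>.

  It remains to see that \<open>N z - S \<le> 2 z\<^bsup>1 + d/2\<^esup> / ((d + 2) d!)\<close>, where \<open>N\<close> is the number of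
  eigenvalues of the first \<open>k\<close> levels and \<open>S\<close> is their sum (\<open>riesz_sum_le\<close>).  With
  \<open>P = k (k + 1) \<dots> (k + d - 1)\<close> one has \<open>N = P / d!\<close>, and \<open>S\<close> is \<open>P\<close> times an explicit
  quadratic polynomial in \<open>k\<close>; minimizing over \<open>z\<close> reduces the claim to
  \<open>P\<^sup>2 \<le> ((k + d) (k + 1 / (d + 1)))\<^sup>d\<close>, which holds for \<open>d = 3, 4, 5\<close>.
\<close>

section \<open>Second-order jets along coordinate lines\<close>

text \<open>The pair \<open>(p, q)\<close> consists of the first and second derivative of \<open>\<phi>\<close> at \<open>0\<close>.  All
  differentiation below takes place on coordinate lines, so that one-variable calculus suffices.\<close>

definition jet2 :: "(real \<Rightarrow> real) \<Rightarrow> real \<Rightarrow> real \<Rightarrow> bool" where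
  "jet2 \<phi> p q \<longleftrightarrow> (\<exists>g. (\<forall>\<^sub>F t in nhds 0. (\<phi> has_real_derivative g t) (at t)) \<and> g 0 = p
     \<and> (g has_real_derivative q) (at 0))"

lemma jet2I:
  assumes "\<forall>\<^sub>F t in nhds 0. (\<phi> has_real_derivative g t) (at t)"
    "g 0 = p" "(g has_real_derivative q) (at 0)"
  shows "jet2 \<phi> p q"
  using assms unfolding jet2_def by blast

lemma jet2_first: "jet2 \<phi> p q \<Longrightarrow> (\<phi> has_real_derivative p) (at 0)"
  unfolding jet2_def by (auto dest: eventually_nhds_x_imp_x)

lemma jet2_unique:
  assumes "jet2 \<phi> p q" "jet2 \<phi> p' q'"
  shows "p = p'" "q = q'"
proof -
  obtain g where g: "\<forall>\<^sub>F t in nhds 0. (\<phi> has_real_derivative g t) (at t)"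
    "(g has_real_derivative q) (at 0)" using assms(1) unfolding jet2_def by blast
  obtain g' where g': "\<forall>\<^sub>F t in nhds 0. (\<phi> has_real_derivative g' t) (at t)"
    "(g' has_real_derivative q') (at 0)" using assms(2) unfolding jet2_def by blast
  show "p = p'" using assms by (blast dest: jet2_first DERIV_unique)
  have "\<forall>\<^sub>F t in nhds 0. g t = g' t" using g(1) g'(1) by eventually_elim (rule DERIV_unique)
  then have "(g' has_real_derivative q) (at 0)"
    using g(2) DERIV_cong_ev[OF refl _ refl] by blast
  then show "q = q'" using g'(2) DERIV_unique by blast
qed

lemma jet2_cong_ev:
  assumes "jet2 \<phi> p q" "\<forall>\<^sub>F t in nhds 0. \<phi> t = \<psi> t"
  shows "jet2 \<psi> p q"
proof -
  obtain g where g: "\<forall>\<^sub>F t in nhds 0. (\<phi> has_real_derivative g t) (at t)" "g 0 = p"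
    "(g has_real_derivative q) (at 0)" using assms(1) unfolding jet2_def by blast
  have "\<forall>\<^sub>F t in nhds 0. \<forall>\<^sub>F s in nhds t. \<phi> s = \<psi> s"
    using assms(2) by (simp add: eventually_eventually)
  with g(1) have "\<forall>\<^sub>F t in nhds 0. (\<psi> has_real_derivative g t) (at t)"
    by eventually_elim (use DERIV_cong_ev[OF refl _ refl] in blast)
  then show ?thesis using g by (intro jet2I)
qed

lemma jet2_mult:
  assumes "jet2 \<phi> p q" "jet2 \<psi> p' q'"
  shows "jet2 (\<lambda>t. \<phi> t * \<psi> t) (p * \<psi> 0 + \<phi> 0 * p') (q * \<psi> 0 + 2 * p * p' + \<phi> 0 * q')"
proof -
  obtain g where g: "\<forall>\<^sub>F t in nhds 0. (\<phi> has_real_derivative g t) (at t)" "g 0 = p"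
    "(g has_real_derivative q) (at 0)" using assms(1) unfolding jet2_def by blast
  obtain g' where g': "\<forall>\<^sub>F t in nhds 0. (\<psi> has_real_derivative g' t) (at t)" "g' 0 = p'"
    "(g' has_real_derivative q') (at 0)" using assms(2) unfolding jet2_def by blast
  show ?thesis
  proof (rule jet2I[where g = "\<lambda>t. g t * \<psi> t + \<phi> t * g' t"])
    show "\<forall>\<^sub>F t in nhds 0. ((\<lambda>t. \<phi> t * \<psi> t) has_real_derivative (g t * \<psi> t + \<phi> t * g' t)) (at t)"
      using g(1) g'(1) by eventually_elim (auto intro!: derivative_eq_intros)
    show "((\<lambda>t. g t * \<psi> t + \<phi> t * g' t) has_real_derivative
        (q * \<psi> 0 + 2 * p * p' + \<phi> 0 * q')) (at 0)"
      using jet2_first[OF assms(1)] jet2_first[OF assms(2)] g g'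
      by (auto intro!: derivative_eq_intros)
  qed (simp add: g g')
qed

lemma jet2_const: "jet2 (\<lambda>t. c) 0 0"
  by (rule jet2I[where g = "\<lambda>_. 0"]) (auto intro!: derivative_eq_intros)

lemma jet2_cmult: "jet2 \<phi> p q \<Longrightarrow> jet2 (\<lambda>t. c * \<phi> t) (c * p) (c * q)"
  using jet2_mult[OF jet2_const[of c], of \<phi> p q] by simp

lemma jet2_add:
  assumes "jet2 \<phi> p q" "jet2 \<psi> p' q'"
  shows "jet2 (\<lambda>t. \<phi> t + \<psi> t) (p + p') (q + q')"
proof -
  obtain g where g: "\<forall>\<^sub>F t in nhds 0. (\<phi> has_real_derivative g t) (at t)" "g 0 = p"
    "(g has_real_derivative q) (at 0)" using assms(1) unfolding jet2_def by blast
  obtain g' where g': "\<forall>\<^sub>F t in nhds 0. (\<psi> has_real_derivative g' t) (at t)" "g' 0 = p'"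
    "(g' has_real_derivative q') (at 0)" using assms(2) unfolding jet2_def by blast
  show ?thesis
  proof (rule jet2I[where g = "\<lambda>t. g t + g' t"])
    show "\<forall>\<^sub>F t in nhds 0. ((\<lambda>t. \<phi> t + \<psi> t) has_real_derivative (g t + g' t)) (at t)"
      using g(1) g'(1) by eventually_elim (auto intro!: derivative_eq_intros)
  qed (use g g' in \<open>auto intro!: derivative_eq_intros\<close>)
qed

lemma jet2_uminus: "jet2 \<phi> p q \<Longrightarrow> jet2 (\<lambda>t. - \<phi> t) (- p) (- q)"
  using jet2_cmult[of \<phi> p q "-1"] by simp

lemma jet2_diff:
  "jet2 \<phi> p q \<Longrightarrow> jet2 \<psi> p' q' \<Longrightarrow> jet2 (\<lambda>t. \<phi> t - \<psi> t) (p - p') (q - q')"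
  using jet2_add[OF _ jet2_uminus, of \<phi> p q \<psi> p' q'] by simp

lemma jet2_sum:
  assumes "finite A" "\<And>i. i \<in> A \<Longrightarrow> jet2 (\<phi> i) (p i) (q i)"
  shows "jet2 (\<lambda>t. \<Sum>i\<in>A. \<phi> i t) (\<Sum>i\<in>A. p i) (\<Sum>i\<in>A. q i)"
  using assms by (induction A rule: finite_induct) (auto intro: jet2_const jet2_add)

lemma jet2_rescale:
  assumes "jet2 \<phi> p q" "c \<noteq> 0"
  shows "jet2 (\<lambda>t. \<phi> (c * t)) (c * p) (c\<^sup>2 * q)"
proof -
  obtain g where g: "\<forall>\<^sub>F t in nhds 0. (\<phi> has_real_derivative g t) (at t)" "g 0 = p"
    "(g has_real_derivative q) (at 0)" using assms(1) unfolding jet2_def by blast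
  have lim: "filterlim (\<lambda>t. c * t) (nhds 0) (nhds 0)"
    by (auto intro!: tendsto_eq_intros filterlim_ident)
  have d: "((\<lambda>t. c * t) has_real_derivative c) (at s)" for s by (rule DERIV_cmult_Id)
  show ?thesis
  proof (rule jet2I[where g = "\<lambda>t. g (c * t) * c"])
    have "\<forall>\<^sub>F t in nhds 0. (\<phi> has_real_derivative g (c * t)) (at (c * t))"
      using g(1) lim by (rule eventually_compose_filterlim)
    then show "\<forall>\<^sub>F t in nhds 0. ((\<lambda>t. \<phi> (c * t)) has_real_derivative (g (c * t) * c)) (at t)"
      by eventually_elim (rule DERIV_chain2[OF _ d])
    have "(g has_real_derivative q) (at (c * 0))" using g(3) by simp
    then have "((\<lambda>t. g (c * t)) has_real_derivative (q * c)) (at 0)"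
      by (rule DERIV_chain2[OF _ d])
    then have "((\<lambda>t. g (c * t) * c) has_real_derivative (q * c * c)) (at 0)"
      by (rule DERIV_cmult_right)
    then show "((\<lambda>t. g (c * t) * c) has_real_derivative c\<^sup>2 * q) (at 0)"
      by (simp add: power2_eq_square mult_ac)
  qed (simp add: g)
qed

text \<open>If \<open>q\<close> were positive, then the derivative, which is zero at the maximum, would be positive just
  to the right of \<open>0\<close>, and \<open>\<phi>\<close> would increase there.\<close>

lemma jet2_local_max:
  assumes "jet2 \<phi> p q" "\<forall>\<^sub>F t in nhds 0. \<phi> t \<le> \<phi> 0"
  shows "q \<le> 0"
proof (rule ccontr)
  assume "\<not> q \<le> 0"
  obtain g where g: "\<forall>\<^sub>F t in nhds 0. (\<phi> has_real_derivative g t) (at t)" "g 0 = p"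
    "(g has_real_derivative q) (at 0)" using assms(1) unfolding jet2_def by blast
  obtain e where e: "e > 0" "\<And>t. \<bar>t\<bar> < e \<Longrightarrow> (\<phi> has_real_derivative g t) (at t) \<and> \<phi> t \<le> \<phi> 0"
    using eventually_conj[OF g(1) assms(2)] unfolding eventually_nhds_metric
    by (auto simp: dist_real_def)
  have p: "p = 0"
    using DERIV_local_max[OF jet2_first[OF assms(1)] e(1)] e(2) by simp
  obtain d where d: "d > 0" "\<And>h. 0 < h \<Longrightarrow> h < d \<Longrightarrow> g 0 < g (0 + h)"
    using has_real_derivative_pos_inc_right[of g q 0 UNIV] g(3) \<open>\<not> q \<le> 0\<close> by auto
  define s where "s = min e d / 2"
  have s: "0 < s" "s < e" "s < d" using e(1) d(1) by (auto simp: s_def min_def)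
  have "\<exists>l z. 0 < z \<and> z < s \<and> DERIV \<phi> z :> l \<and> \<phi> s - \<phi> 0 = (s - 0) * l"
  proof (rule MVT)
    show "continuous_on {0..s} \<phi>"
    proof (intro continuous_at_imp_continuous_on ballI)
      fix x assume "x \<in> {0..s}"
      then show "isCont \<phi> x" using e(2)[of x] s by (auto intro: DERIV_isCont)
    qed
  next
    fix x assume "0 < x" "x < s"
    then show "\<phi> differentiable (at x)"
      using e(2)[of x] s by (auto simp: real_differentiable_def)
  qed (rule s)
  then obtain l z where z: "0 < z" "z < s" "DERIV \<phi> z :> l" "\<phi> s - \<phi> 0 = s * l" by auto
  have "l = g z" using e(2)[of z] z s by (auto dest: DERIV_unique)
  then have "l > 0" using d(2)[of z] z s p g(2) by simp
  then have "\<phi> s > \<phi> 0" using z(4) mult_pos_pos[OF s(1), of l] by linarith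
  moreover have "\<phi> s \<le> \<phi> 0" using e(2)[of s] s by simp
  ultimately show False by simp
qed

text \<open>The Laplacian in the weak pointwise sense that only the pure second derivatives along the
  coordinate lines have to exist.  The maximum principle needs no more, and this notion passes to
  translates and mirror images without any chain rule in several variables.\<close>

definition has_lap :: "('a::euclidean_space \<Rightarrow> real) \<Rightarrow> 'a \<Rightarrow> real \<Rightarrow> bool" where
  "has_lap w x L \<longleftrightarrow> (\<exists>p q. (\<forall>b\<in>Basis. jet2 (\<lambda>t. w (x + t *\<^sub>R b)) (p b) (q b)) \<and> (\<Sum>b\<in>Basis. q b) = L)"

lemma has_lapI:
  "(\<And>b. b \<in> Basis \<Longrightarrow> jet2 (\<lambda>t. w (x + t *\<^sub>R b)) (p b) (q b)) \<Longrightarrow> (\<Sum>b\<in>Basis. q b) = L \<Longrightarrow> has_lap w x L"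
  unfolding has_lap_def by blast

lemma has_lap_uminus: "has_lap w x L \<Longrightarrow> has_lap (\<lambda>x. - w x) x (- L)"
proof -
  assume "has_lap w x L"
  then obtain p q where 1: "\<And>b. b \<in> Basis \<Longrightarrow> jet2 (\<lambda>t. w (x + t *\<^sub>R b)) (p b) (q b)" "(\<Sum>b\<in>Basis. q b) = L"
    unfolding has_lap_def by blast
  show ?thesis
    by (rule has_lapI[where p = "\<lambda>b. - p b" and q = "\<lambda>b. - q b"])
       (use 1 in \<open>auto intro: jet2_uminus simp: sum_negf\<close>)
qed

lemma has_lap_diff:
  assumes "has_lap w x L" "has_lap w' x L'"
  shows "has_lap (\<lambda>x. w x - w' x) x (L - L')"
proof -
  obtain p q where 1: "\<And>b. b \<in> Basis \<Longrightarrow> jet2 (\<lambda>t. w (x + t *\<^sub>R b)) (p b) (q b)" "(\<Sum>b\<in>Basis. q b) = L"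
    using assms(1) unfolding has_lap_def by blast
  obtain p' q' where 2: "\<And>b. b \<in> Basis \<Longrightarrow> jet2 (\<lambda>t. w' (x + t *\<^sub>R b)) (p' b) (q' b)" "(\<Sum>b\<in>Basis. q' b) = L'"
    using assms(2) unfolding has_lap_def by blast
  show ?thesis
    by (rule has_lapI[where p = "\<lambda>b. p b - p' b" and q = "\<lambda>b. q b - q' b"])
       (use 1 2 in \<open>auto intro: jet2_diff simp: sum_subtractf\<close>)
qed

lemma has_lap_shift: "has_lap w (x + h) L \<Longrightarrow> has_lap (\<lambda>x. w (x + h)) x L"
  unfolding has_lap_def by (simp add: add_ac)

definition mirror :: "'a::euclidean_space \<Rightarrow> 'a \<Rightarrow> 'a \<Rightarrow> 'a" where
  "mirror e a x = x - (2 * ((x - a) \<bullet> e)) *\<^sub>R e"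

lemma mirror_add: "mirror e a (x + t *\<^sub>R b) = mirror e a x + t *\<^sub>R (b - (2 * (b \<bullet> e)) *\<^sub>R e)"
proof -
  have "2 * ((x + t *\<^sub>R b - a) \<bullet> e) = 2 * ((x - a) \<bullet> e) + t * (2 * (b \<bullet> e))"
    by (simp add: inner_diff_left inner_add_left)
  then show ?thesis by (simp add: mirror_def scaleR_diff_right scaleR_add_left)
qed

lemma has_lap_mirror:
  assumes e: "e \<in> Basis" and "has_lap w (mirror e a x) L"
  shows "has_lap (\<lambda>x. w (mirror e a x)) x L"
proof -
  obtain p q where 1: "\<And>b. b \<in> Basis \<Longrightarrow> jet2 (\<lambda>t. w (mirror e a x + t *\<^sub>R b)) (p b) (q b)" "(\<Sum>b\<in>Basis. q b) = L"
    using assms(2) unfolding has_lap_def by blast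
  show ?thesis
  proof (rule has_lapI[where p = "\<lambda>b. if b = e then - p b else p b" and q = q])
    fix b :: 'a assume b: "b \<in> Basis"
    show "jet2 (\<lambda>t. w (mirror e a (x + t *\<^sub>R b))) (if b = e then - p b else p b) (q b)"
    proof (cases "b = e")
      case True
      have "mirror e a (x + t *\<^sub>R e) = mirror e a x + (- 1 * t) *\<^sub>R e" for t
        using mirror_add[of e a x t e] e by (simp add: scaleR_2)
      then show ?thesis using jet2_rescale[OF 1(1)[OF e], of "-1"] True by simp
    next
      case False
      have "mirror e a (x + t *\<^sub>R b) = mirror e a x + t *\<^sub>R b" for t
        using mirror_add[of e a x t b] e b False by (simp add: inner_Basis)
      then show ?thesis using 1(1)[OF b] False by simp
    qed
  qed (rule 1(2))
qed

section \<open>A barrier in a half box\<close>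

lemma norm_le_sup_coord:
  fixes x :: "'a::euclidean_space"
  assumes "\<And>b. b \<in> Basis \<Longrightarrow> \<bar>x \<bullet> b\<bar> \<le> L"
  shows "norm x \<le> real DIM('a) * L"
  using norm_le_l1[of x] sum_bounded_above[of Basis "\<lambda>b. \<bar>x \<bullet> b\<bar>" L] assms by force

text \<open>The comparison function for the box with centre \<open>a\<close> and half-width \<open>L\<close>, cut at the hyperplane
  through \<open>a\<close> orthogonal to \<open>e\<close>.  Its coefficients are such that it is nonnegative on the half
  box, at least \<open>M\<close> on those faces where some coordinate has modulus \<open>L\<close>, has negative
  Laplacian, and is only of size \<open>M s / L\<close> at distance \<open>s\<close> from \<open>a\<close> on the axis in direction
  \<open>e\<close>.\<close>

definition barrier :: "'a::euclidean_space \<Rightarrow> 'a \<Rightarrow> real \<Rightarrow> real \<Rightarrow> 'a \<Rightarrow> real" where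
  "barrier e a M L x = M / L\<^sup>2 * ((\<Sum>b\<in>Basis - {e}. ((x - a) \<bullet> b)\<^sup>2)
     + real DIM('a) * (L * ((x - a) \<bullet> e) - ((x - a) \<bullet> e)\<^sup>2) + L * ((x - a) \<bullet> e))"

lemma jet2_quadratic: "jet2 (\<lambda>t. A + B * t + C * t\<^sup>2) B (2 * C)"
  by (rule jet2I[where g = "\<lambda>t. B + 2 * C * t"]) (auto intro!: derivative_eq_intros always_eventually)

text \<open>Each of the \<open>DIM('a) - 1\<close> squares contributes \<open>2 M / L\<^sup>2\<close>, and the term in direction \<open>e\<close>
  contributes \<open>- 2 DIM('a) M / L\<^sup>2\<close>.\<close>

lemma barrier_lap:
  fixes e a :: "'a::euclidean_space"
  assumes e: "e \<in> Basis"
  shows "has_lap (barrier e a M L) x (- (2 * M / L\<^sup>2))"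
proof -
  define s where "s = (\<lambda>b. (x - a) \<bullet> b)"
  define N where "N = real DIM('a)"
  define K where "K = M / L\<^sup>2"
  define A where "A = (\<Sum>b\<in>Basis - {e}. (s b)\<^sup>2)"
  have coord: "(x + t *\<^sub>R b - a) \<bullet> c = s c + (if b = c then t else 0)" if "b \<in> Basis" "c \<in> Basis" for b c t
    using that by (simp add: s_def inner_diff_left inner_add_left inner_Basis)
  have sb: "jet2 (\<lambda>t. barrier e a M L (x + t *\<^sub>R b)) (2 * K * s b) (2 * K)" if b: "b \<in> Basis - {e}" for b
  proof -
    have "(\<Sum>c\<in>Basis - {e}. ((x + t *\<^sub>R b - a) \<bullet> c)\<^sup>2) = A + 2 * s b * t + t\<^sup>2" for t
    proof -
      have "(\<Sum>c\<in>Basis - {e}. ((x + t *\<^sub>R b - a) \<bullet> c)\<^sup>2)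
         = (\<Sum>c\<in>Basis - {e}. (s c)\<^sup>2 + (if b = c then 2 * s b * t + t\<^sup>2 else 0))"
        using b by (intro sum.cong refl) (auto simp: coord power2_sum)
      also have "\<dots> = A + (2 * s b * t + t\<^sup>2)" using b by (simp add: sum.distrib A_def)
      finally show ?thesis by simp
    qed
    then have eq: "barrier e a M L (x + t *\<^sub>R b)
      = K * (A + N * (L * s e - (s e)\<^sup>2) + L * s e) + 2 * K * s b * t + K * t\<^sup>2" for t
      using b e by (simp add: barrier_def coord K_def N_def distrib_left)
    show ?thesis unfolding eq by (rule jet2_quadratic)
  qed
  have se: "jet2 (\<lambda>t. barrier e a M L (x + t *\<^sub>R e)) (K * (N * (L - 2 * s e) + L)) (2 * (- K * N))"
  proof -
    have "(\<Sum>c\<in>Basis - {e}. ((x + t *\<^sub>R e - a) \<bullet> c)\<^sup>2) = A" for t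
      unfolding A_def using e by (intro sum.cong refl) (auto simp: coord)
    then have "barrier e a M L (x + t *\<^sub>R e) = K * (A + N * (L * (s e + t) - (s e + t)\<^sup>2) + L * (s e + t))" for t
      using e by (simp add: barrier_def coord K_def N_def)
    then have eq: "barrier e a M L (x + t *\<^sub>R e) = K * (A + N * (L * s e - (s e)\<^sup>2) + L * s e)
      + K * (N * (L - 2 * s e) + L) * t + - K * N * t\<^sup>2" for t
      by (simp add: distrib_left distrib_right right_diff_distrib left_diff_distrib power2_sum mult_ac)
    show ?thesis unfolding eq by (rule jet2_quadratic)
  qed
  show ?thesis
  proof (rule has_lapI)
    fix b :: 'a assume "b \<in> Basis"
    then show "jet2 (\<lambda>t. barrier e a M L (x + t *\<^sub>R b))
      (if b = e then K * (N * (L - 2 * s e) + L) else 2 * K * s b) (if b = e then 2 * (- K * N) else 2 * K)"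
      using sb[of b] se by auto
  next
    have "(\<Sum>b\<in>Basis. if b = e then 2 * (- K * N) else 2 * K)
        = 2 * (- K * N) + (\<Sum>b\<in>Basis - {e}. if b = e then 2 * (- K * N) else 2 * K)"
      using e by (subst sum.remove[of _ e]) auto
    also have "(\<Sum>b\<in>Basis - {e}. if b = e then 2 * (- K * N) else 2 * K) = (\<Sum>b\<in>Basis - {e}. 2 * K)"
      by (intro sum.cong) auto
    also have "\<dots> = (N - 1) * (2 * K)" using e by (simp add: N_def card_Diff_singleton)
    also have "2 * (- K * N) + (N - 1) * (2 * K) = - (2 * M / L\<^sup>2)"
    proof -
      have "2 * (- K * N) + (N - 1) * (2 * K) = - (2 * K)" by (simp add: left_diff_distrib)
      then show ?thesis by (simp add: K_def)
    qed
    finally show "(\<Sum>b\<in>Basis. if b = e then 2 * (- K * N) else 2 * K) = - (2 * M / L\<^sup>2)" .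
  qed
qed

definition half_box :: "'a::euclidean_space \<Rightarrow> 'a \<Rightarrow> 'a \<Rightarrow> real \<Rightarrow> 'a set" where
  "half_box \<nu> e a L = {x. 0 \<le> x \<bullet> \<nu> \<and> 0 \<le> (x - a) \<bullet> e \<and> (\<forall>b\<in>Basis. \<bar>(x - a) \<bullet> b\<bar> \<le> L)}"

lemma compact_half_box: "compact (half_box \<nu> e a L)"
proof -
  have "half_box \<nu> e a L \<subseteq> cball a (real DIM('a) * L)"
  proof
    fix x assume "x \<in> half_box \<nu> e a L"
    then have "norm (x - a) \<le> real DIM('a) * L" by (intro norm_le_sup_coord) (simp add: half_box_def)
    then show "x \<in> cball a (real DIM('a) * L)" by (simp add: dist_norm norm_minus_commute)
  qed
  then have "bounded (half_box \<nu> e a L)" using bounded_cball bounded_subset by blast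
  moreover have "closed (half_box \<nu> e a L)"
    unfolding half_box_def Ball_def
    by (intro closed_Collect_conj closed_Collect_all closed_Collect_imp closed_Collect_le continuous_intros)
       (auto intro: open_Collect_const)
  ultimately show ?thesis by (simp add: compact_eq_bounded_closed)
qed

lemma barrier_nonneg:
  assumes "M \<ge> 0" "L > 0" "0 \<le> (x - a) \<bullet> e" "(x - a) \<bullet> e \<le> L"
  shows "barrier e a M L x \<ge> 0"
proof -
  have "((x - a) \<bullet> e)\<^sup>2 \<le> L * ((x - a) \<bullet> e)"
    using assms by (simp add: power2_eq_square mult_right_mono)
  then show ?thesis unfolding barrier_def using assms
    by (intro mult_nonneg_nonneg add_nonneg_nonneg sum_nonneg) auto
qed

lemma barrier_ge:
  fixes e a :: "'a::euclidean_space"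
  assumes "e \<in> Basis" "M \<ge> 0" "L > 0" "0 \<le> (x - a) \<bullet> e" "(x - a) \<bullet> e \<le> L"
    and b: "b \<in> Basis" "\<bar>(x - a) \<bullet> b\<bar> = L"
  shows "M \<le> barrier e a M L x"
proof -
  define s where "s = (x - a) \<bullet> e"
  have s: "0 \<le> s" "s \<le> L" using assms by (simp_all add: s_def)
  have 1: "0 \<le> real DIM('a) * (L * s - s\<^sup>2)" using s by (simp add: power2_eq_square mult_right_mono)
  have 2: "0 \<le> L * s" using s assms by simp
  have "L\<^sup>2 \<le> (\<Sum>b\<in>Basis - {e}. ((x - a) \<bullet> b)\<^sup>2) + real DIM('a) * (L * s - s\<^sup>2) + L * s"
  proof (cases "b = e")
    case True
    then have "s = L" using b s by (simp add: s_def)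
    then show ?thesis using 1 by (simp add: power2_eq_square sum_nonneg)
  next
    case False
    have "((x - a) \<bullet> b)\<^sup>2 \<le> (\<Sum>b\<in>Basis - {e}. ((x - a) \<bullet> b)\<^sup>2)"
      using False b by (intro member_le_sum) auto
    moreover have "((x - a) \<bullet> b)\<^sup>2 = L\<^sup>2" using b(2) power2_abs by metis
    ultimately show ?thesis using 1 2 by linarith
  qed
  then have "M / L\<^sup>2 * L\<^sup>2 \<le> barrier e a M L x"
    unfolding barrier_def s_def[symmetric] using assms by (intro mult_left_mono) auto
  then show ?thesis using assms by simp
qed

text \<open>The maximum principle for \<open>w\<close> minus the barrier.  A positive maximum cannot lie on the boundary
  of the half box; at an interior maximum \<open>w\<close> is positive, so the Laplacian of the difference is
  positive there, whereas its pure second derivatives are nonpositive.\<close>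

lemma barrier_comparison:
  fixes w :: "'a::euclidean_space \<Rightarrow> real"
  assumes e: "e \<in> Basis" and M: "M > 0" and L: "L > 0"
    and cont: "continuous_on (half_box \<nu> e a L) w"
    and le: "\<And>x. x \<in> half_box \<nu> e a L \<Longrightarrow> w x \<le> M"
    and bd: "\<And>x. x \<in> half_box \<nu> e a L \<Longrightarrow> x \<bullet> \<nu> = 0 \<or> (x - a) \<bullet> e = 0 \<Longrightarrow> w x \<le> 0"
    and sub: "\<And>x. x \<in> half_box \<nu> e a L \<Longrightarrow> x \<bullet> \<nu> > 0 \<Longrightarrow> w x > 0 \<Longrightarrow> \<exists>D\<ge>0. has_lap w x D"
    and x: "x \<in> half_box \<nu> e a L"
  shows "w x \<le> barrier e a M L x"
proof (rule ccontr)
  let ?Q = "half_box \<nu> e a L"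
  let ?f = "\<lambda>x. w x - barrier e a M L x"
  assume "\<not> ?thesis"
  then have pos: "?f x > 0" by simp
  have "continuous_on ?Q ?f" unfolding barrier_def by (intro continuous_intros cont)
  then obtain m where m: "m \<in> ?Q" "\<And>y. y \<in> ?Q \<Longrightarrow> ?f y \<le> ?f m"
    using continuous_attains_sup[OF compact_half_box, of \<nu> e a L ?f] x by blast
  have fm: "?f m > 0" using m(2)[OF x] pos by linarith
  have mQ: "0 \<le> m \<bullet> \<nu>" "0 \<le> (m - a) \<bullet> e" "\<And>b. b \<in> Basis \<Longrightarrow> \<bar>(m - a) \<bullet> b\<bar> \<le> L"
    using m(1) by (auto simp: half_box_def)
  have mL: "(m - a) \<bullet> e \<le> L" using mQ(3)[OF e] by simp
  have wm: "w m > 0" using barrier_nonneg[of M L m a e] M L mQ(2) mL fm by linarith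
  have s1: "m \<bullet> \<nu> > 0" "(m - a) \<bullet> e > 0" using bd[OF m(1)] wm mQ by force+
  have s2: "\<bar>(m - a) \<bullet> b\<bar> < L" if "b \<in> Basis" for b
    using barrier_ge[OF e _ L mQ(2) mL that, of M] le[OF m(1)] fm mQ(3)[OF that] M by force
  define I where "I = {x. 0 < x \<bullet> \<nu>} \<inter> ({x. 0 < (x - a) \<bullet> e} \<inter> (\<Inter>b\<in>Basis. {x. \<bar>(x - a) \<bullet> b\<bar> < L}))"
  have "open I" unfolding I_def
    by (intro open_Int open_INT open_Collect_less continuous_intros ballI) auto
  have "m \<in> I" using s1 s2 by (auto simp: I_def)
  have "I \<subseteq> ?Q" by (force simp: I_def half_box_def)
  obtain D where D: "D \<ge> 0" "has_lap w m D" using sub[OF m(1) s1(1) wm] by blast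
  have "has_lap ?f m (D - - (2 * M / L\<^sup>2))" by (intro has_lap_diff D barrier_lap e)
  then obtain p q where pq: "\<And>b. b \<in> Basis \<Longrightarrow> jet2 (\<lambda>t. ?f (m + t *\<^sub>R b)) (p b) (q b)"
    "(\<Sum>b\<in>Basis. q b) = D + 2 * M / L\<^sup>2" unfolding has_lap_def by auto
  have "q b \<le> 0" if b: "b \<in> Basis" for b
  proof (rule jet2_local_max[OF pq(1)[OF b]])
    have "isCont (\<lambda>t. m + t *\<^sub>R b) 0" by (intro continuous_intros)
    then have "\<forall>\<^sub>F t in nhds 0. m + t *\<^sub>R b \<in> I"
      using \<open>open I\<close> \<open>m \<in> I\<close> unfolding continuous_at_open eventually_nhds
      by (metis add.right_neutral scaleR_zero_left)
    then show "\<forall>\<^sub>F t in nhds 0. ?f (m + t *\<^sub>R b) \<le> ?f (m + 0 *\<^sub>R b)"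
      by eventually_elim (use m(2) \<open>I \<subseteq> ?Q\<close> in \<open>simp add: subset_iff\<close>)
  qed
  then have "D + 2 * M / L\<^sup>2 \<le> 0" unfolding pq(2)[symmetric] by (intro sum_nonpos) auto
  moreover have "2 * M / L\<^sup>2 > 0" using M L by simp
  ultimately show False using D(1) by linarith
qed

lemma barrier_on_axis:
  fixes e a :: "'a::euclidean_space"
  assumes e: "e \<in> Basis" and "M \<ge> 0" "L > 0"
  shows "barrier e a M L (a + s *\<^sub>R e) \<le> (real DIM('a) + 1) * M * s / L"
proof -
  have 1: "(\<Sum>b\<in>Basis - {e}. ((a + s *\<^sub>R e - a) \<bullet> b)\<^sup>2) = 0"
    using e by (intro sum.neutral) (auto simp: inner_Basis)
  have 2: "(a + s *\<^sub>R e - a) \<bullet> e = s" using e by simp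
  have "barrier e a M L (a + s *\<^sub>R e) = M / L\<^sup>2 * (real DIM('a) * (L * s - s\<^sup>2) + L * s)"
    unfolding barrier_def 1 2 by simp
  also have "\<dots> \<le> M / L\<^sup>2 * (real DIM('a) * (L * s) + L * s)"
    using assms by (intro mult_left_mono add_mono) auto
  also have "\<dots> = (real DIM('a) + 1) * M * s / L"
    using assms by (simp add: power2_eq_square distrib_right distrib_left divide_simps mult_ac)
  finally show ?thesis .
qed

section \<open>Finite differences and polynomials\<close>

definition fdiff :: "'a::ab_group_add \<Rightarrow> ('a \<Rightarrow> real) \<Rightarrow> 'a \<Rightarrow> real" where
  "fdiff h f x = f (x + h) - f x"

lemma fdiff_diff: "fdiff h (\<lambda>x. f x - g x) = (\<lambda>x. fdiff h f x - fdiff h g x)"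
  by (auto simp: fdiff_def)

lemma fdiff_pow_diff: "(fdiff h ^^ k) (\<lambda>x. f x - g x) = (\<lambda>x. (fdiff h ^^ k) f x - (fdiff h ^^ k) g x)"
  by (induction k) (simp_all add: fdiff_diff)

lemma fdiff_pow_line:
  fixes v :: "'a::real_vector \<Rightarrow> real"
  shows "(fdiff s ^^ k) (\<lambda>t. v (x + (c * t) *\<^sub>R e)) t = (fdiff ((c * s) *\<^sub>R e) ^^ k) v (x + (c * t) *\<^sub>R e)"
  by (induction k arbitrary: t) (simp_all add: fdiff_def distrib_left scaleR_add_left add.assoc)

lemma fdiff_pow_poly_zero: "degree p < k \<Longrightarrow> (fdiff h ^^ k) (poly p) = (\<lambda>_. 0)"
proof (induction k arbitrary: p)
  case (Suc k)
  \<comment> \<open>the leading terms cancel, so the degree drops\<close>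
  define q where "q = pcompose p [:h, 1:] - p"
  have q: "fdiff h (poly p) = poly q"
    by (auto simp: fdiff_def q_def poly_pcompose add.commute)
  have z: "(fdiff h ^^ k) (\<lambda>_. 0) = (\<lambda>_. 0::real)" for k by (induction k) (simp_all add: fdiff_def)
  show ?case
  proof (cases "degree p = 0")
    case True
    then obtain a where "p = [:a:]" by (auto elim: degree_eq_zeroE)
    then have "fdiff h (poly p) = (\<lambda>_. 0)" by (auto simp: fdiff_def)
    then show ?thesis by (simp only: funpow_Suc_right o_apply z)
  next
    case False
    have d: "degree (pcompose p [:h, 1:]) = degree p" by (simp add: degree_pcompose)
    have "degree q < degree p"
    proof (rule ccontr)
      assume "\<not> ?thesis"
      moreover have "degree q \<le> degree p" unfolding q_def by (rule order_trans[OF degree_diff_le_max]) (simp add: d)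
      ultimately have "degree q = degree p" by simp
      then have "lead_coeff q = coeff (pcompose p [:h, 1:]) (degree p) - lead_coeff p" by (simp add: q_def)
      also have "coeff (pcompose p [:h, 1:]) (degree p) = lead_coeff (pcompose p [:h, 1:])" by (simp add: d)
      also have "\<dots> = lead_coeff p" by (subst lead_coeff_comp) auto
      finally have "q = 0" by simp
      then show False using False \<open>degree q = degree p\<close> by simp
    qed
    then have "(fdiff h ^^ k) (poly q) = (\<lambda>_. 0)" using Suc by simp
    then show ?thesis by (simp only: funpow_Suc_right o_apply q)
  qed
qed simp

text \<open>Induction on \<open>k\<close>: the first difference has one zero less and a vanishing difference of one order
  less, so it is zero, and the sequence is constant.\<close>

lemma integer_sequence_zero:
  fixes g :: "int \<Rightarrow> real"
  assumes "\<And>n. (fdiff 1 ^^ k) g n = 0" "\<And>j. j < k \<Longrightarrow> g (int j) = 0"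
  shows "g n = 0"
  using assms
proof (induction k arbitrary: g n)
  case (Suc k)
  have D: "fdiff 1 g n = 0" for n
  proof (rule Suc.IH)
    show "(fdiff 1 ^^ k) (fdiff 1 g) n = 0" for n using Suc.prems(1)[of n] by (simp only: funpow_Suc_right o_apply)
    show "fdiff 1 g (int j) = 0" if "j < k" for j
      using Suc.prems(2)[of j] Suc.prems(2)[of "Suc j"] that by (simp add: fdiff_def add.commute)
  qed
  have step: "g (n + 1) = g n" for n using D[of n] by (simp add: fdiff_def)
  have "g n = g 0"
  proof (induction n rule: int_induct[where k = 0])
    case (step2 i)
    then show ?case using step[of "i - 1"] by simp
  qed (simp_all add: step)
  then show ?case using Suc.prems(2)[of 0] by simp
qed simp

definition lagrange_poly :: "nat \<Rightarrow> nat \<Rightarrow> real poly" where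
  "lagrange_poly k j = smult (inverse (\<Prod>i\<in>{..<k} - {j}. real j - real i)) (\<Prod>i\<in>{..<k} - {j}. [:- real i, 1:])"

lemma degree_lagrange_poly: "j < k \<Longrightarrow> degree (lagrange_poly k j) < k"
proof -
  assume "j < k"
  have "degree (lagrange_poly k j) \<le> degree (\<Prod>i\<in>{..<k} - {j}. [:- real i, 1:])"
    unfolding lagrange_poly_def by (rule degree_smult_le)
  also have "\<dots> \<le> (\<Sum>i\<in>{..<k} - {j}. degree [:- real i, 1:])"
    using degree_prod_sum_le[of "{..<k} - {j}" "\<lambda>i. [:- real i, 1:]"] by (simp add: o_def)
  also have "\<dots> = k - 1" using \<open>j < k\<close> by (simp add: card_Diff_singleton)
  finally show ?thesis using \<open>j < k\<close> by simp
qed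

lemma poly_lagrange_poly:
  assumes "i < k" "j < k"
  shows "poly (lagrange_poly k j) (real i) = (if i = j then 1 else 0)"
proof (cases "i = j")
  case True
  have "(\<Prod>i\<in>{..<k} - {j}. real j - real i) \<noteq> 0" by auto
  then show ?thesis using True by (simp add: lagrange_poly_def poly_prod)
next
  case False
  then have "(\<Prod>l\<in>{..<k} - {j}. real i - real l) = 0" using assms by (auto intro!: prod_zero)
  then show ?thesis using False by (simp add: lagrange_poly_def poly_prod)
qed

definition interp :: "nat \<Rightarrow> (real \<Rightarrow> real) \<Rightarrow> real poly" where
  "interp k f = (\<Sum>j<k. smult (f (real j)) (lagrange_poly k j))"

lemma poly_interp_node: "i < k \<Longrightarrow> poly (interp k f) (real i) = f (real i)"
  by (simp add: interp_def poly_sum poly_lagrange_poly if_distrib[of "(*) _"] cong: if_cong)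

lemma degree_interp: "k > 0 \<Longrightarrow> degree (interp k f) < k"
proof -
  assume "k > 0"
  have "degree (interp k f) \<le> k - 1"
    unfolding interp_def
  proof (rule degree_sum_le)
    fix j assume "j \<in> {..<k}"
    then have "degree (lagrange_poly k j) < k" by (intro degree_lagrange_poly) simp
    then show "degree (smult (f (real j)) (lagrange_poly k j)) \<le> k - 1"
      using degree_smult_le[of "f (real j)" "lagrange_poly k j"] by linarith
  qed simp
  then show ?thesis using \<open>k > 0\<close> by simp
qed

lemma interp_poly: "degree p < k \<Longrightarrow> interp k (poly p) = p"
  by (rule poly_eqI_degree[of "real ` {..<k}"])
     (auto simp: card_image poly_interp_node intro: degree_interp)

text \<open>Frechet's theorem.  On each grid of mesh \<open>1 / q\<close> the function agrees with a polynomial of degree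
  less than \<open>k\<close>.  All these grids contain the nodes \<open>0, \<dots>, k - 1\<close>, hence the polynomials are
  the same one, the interpolation polynomial at the nodes.  So \<open>f\<close> agrees with it on the
  rationals, and by continuity everywhere.\<close>

lemma finite_difference_zero_imp_poly:
  fixes f :: "real \<Rightarrow> real"
  assumes cont: "continuous_on UNIV f" and diff: "\<And>h x. h > 0 \<Longrightarrow> (fdiff h ^^ k) f x = 0" and k: "k > 0"
  shows "f x = poly (interp k f) x"
proof -
  have rat: "f (of_int m / real q) = poly (interp k f) (of_int m / real q)" if q: "q > 0" for m :: int and q :: nat
  proof -
    \<comment> \<open>rescaling the grid of mesh \<open>1 / q\<close> to the integers\<close>
    define F where "F = (\<lambda>t. f (0 + (1 / real q * t) *\<^sub>R 1))"
    have F: "F t = f (t / real q)" for t by (simp add: F_def)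
    define P where "P = interp k F"
    have FP: "F (of_int n) = poly P (of_int n)" for n :: int
    proof -
      define g where "g = (\<lambda>n::int. F (of_int n) - poly P (of_int n))"
      have "(fdiff 1 ^^ j) g n = (fdiff 1 ^^ j) (\<lambda>t. F t - poly P t) (of_int n)" for n j
        unfolding g_def by (induction j arbitrary: n) (simp_all add: fdiff_def)
      then have "(fdiff 1 ^^ k) g n = 0" for n
        using fdiff_pow_poly_zero[OF degree_interp[OF k], of 1 F]
          fdiff_pow_line[of k 1 f 0 "1 / real q" 1 "of_int n"] diff[of "1 / real q" "of_int n / real q"] q
        by (simp add: fdiff_pow_diff P_def F_def)
      moreover have "g (int j) = 0" if "j < k" for j
        using that by (simp add: g_def P_def poly_interp_node)
      ultimately have "g n = 0" by (rule integer_sequence_zero)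
      then show ?thesis by (simp add: g_def)
    qed
    \<comment> \<open>both have degree less than \<open>k\<close> and agree at the nodes \<open>0, \<dots>, k - 1\<close>\<close>
    have "pcompose P [:0, real q:] = interp k f"
    proof (rule poly_eqI_degree[of "real ` {..<k}"])
      fix x assume "x \<in> real ` {..<k}"
      then obtain i where i: "i < k" "x = real i" by auto
      have "poly (pcompose P [:0, real q:]) x = poly P (real i * real q)"
        by (simp add: poly_pcompose i)
      also have "\<dots> = f x" using q FP[of "int (i * q)"] by (simp add: F i)
      finally show "poly (pcompose P [:0, real q:]) x = poly (interp k f) x"
        using i by (simp add: poly_interp_node)
    next
      have "degree (pcompose P [:0, real q:]) = degree P * degree [:0, real q:]" by (rule degree_pcompose)
      then show "degree (pcompose P [:0, real q:]) < card (real ` {..<k})"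
        using degree_interp[OF k, of F] q by (simp add: card_image P_def)
    qed (use degree_interp[OF k] in \<open>simp add: card_image\<close>)
    moreover have "f (of_int m / real q) = poly P (of_int m)" using FP[of m] by (simp add: F)
    moreover have "poly (pcompose P [:0, real q:]) (of_int m / real q) = poly P (of_int m)"
      using q by (simp add: poly_pcompose)
    ultimately show ?thesis by simp
  qed
  have "closed {x. f x = poly (interp k f) x}"
    by (intro closed_Collect_eq cont continuous_intros)
  moreover have "\<rat> \<subseteq> {x. f x = poly (interp k f) x}"
  proof
    fix x :: real assume "x \<in> \<rat>"
    then obtain m n where mn: "(n::int) > 0" "x = of_int m / of_int n"
      by (auto elim!: Rats_cases')
    then have "x = of_int m / real (nat n)" "nat n > 0" by simp_all
    then show "x \<in> {x. f x = poly (interp k f) x}" using rat[of "nat n" m] by simp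
  qed
  ultimately have "closure \<rat> \<subseteq> {x. f x = poly (interp k f) x}" by (rule closure_minimal[rotated])
  then show ?thesis by (auto simp: Rats_closure_real)
qed

section \<open>Growth of harmonic functions in a half space\<close>

definition half_harmonic :: "'a::euclidean_space \<Rightarrow> ('a \<Rightarrow> real) \<Rightarrow> bool" where
  "half_harmonic \<nu> w \<longleftrightarrow> continuous_on {x. 0 \<le> x \<bullet> \<nu>} w \<and> (\<forall>x. x \<bullet> \<nu> = 0 \<longrightarrow> w x = 0)
     \<and> (\<forall>x. 0 < x \<bullet> \<nu> \<longrightarrow> has_lap w x 0)"

text \<open>The order of growth at infinity.  Bounding \<open>w\<close> on the whole half ball by a power of the radius
  \<open>R\<close>, and not by a power of \<open>|x|\<close>, keeps the notion meaningful for negative \<open>\<beta>\<close>.\<close>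

definition half_growth :: "'a::euclidean_space \<Rightarrow> real \<Rightarrow> ('a \<Rightarrow> real) \<Rightarrow> bool" where
  "half_growth \<nu> \<beta> w \<longleftrightarrow> (\<exists>C>0. \<exists>R0>0. \<forall>R\<ge>R0. \<forall>x. 0 \<le> x \<bullet> \<nu> \<longrightarrow> norm x \<le> R \<longrightarrow> \<bar>w x\<bar> \<le> C * R powr \<beta>)"

lemma half_harmonic_fdiff:
  fixes \<nu> e :: "'a::euclidean_space"
  assumes \<nu>: "\<nu> \<in> Basis" and e: "e \<in> Basis - {\<nu>}" and w: "half_harmonic \<nu> w"
  shows "half_harmonic \<nu> (fdiff (h *\<^sub>R e) w)"
proof -
  have [simp]: "(x + h *\<^sub>R e) \<bullet> \<nu> = x \<bullet> \<nu>" for x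
    using \<nu> e by (auto simp: inner_add_left inner_Basis)
  show ?thesis
    unfolding half_harmonic_def fdiff_def[abs_def]
  proof (intro conjI allI impI)
    have c: "continuous_on {x. 0 \<le> x \<bullet> \<nu>} w" using w by (simp add: half_harmonic_def)
    show "continuous_on {x. 0 \<le> x \<bullet> \<nu>} (\<lambda>x. w (x + h *\<^sub>R e) - w x)"
      by (intro continuous_intros c continuous_on_compose2[OF c]) auto
  next
    fix x assume "x \<bullet> \<nu> = 0"
    then show "w (x + h *\<^sub>R e) - w x = 0" using w by (simp add: half_harmonic_def)
  next
    fix x assume x: "0 < x \<bullet> \<nu>"
    have "has_lap w (x + h *\<^sub>R e) 0" "has_lap w x 0" using w x by (simp_all add: half_harmonic_def)
    then have "has_lap (\<lambda>x. w (x + h *\<^sub>R e) - w x) x (0 - 0)" by (intro has_lap_diff has_lap_shift)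
    then show "has_lap (\<lambda>x. w (x + h *\<^sub>R e) - w x) x 0" by simp
  qed
qed

lemma half_harmonic_uminus:
  "half_harmonic \<nu> w \<Longrightarrow> half_harmonic \<nu> (\<lambda>x. - w x)"
  unfolding half_harmonic_def using has_lap_uminus[of w _ 0] by (auto intro: continuous_intros)

text \<open>Let \<open>a\<close> be the midpoint of \<open>x\<close> and \<open>x + h e\<close>.  The function \<open>w\<close> minus its mirror image in
  the hyperplane through \<open>a\<close> orthogonal to \<open>e\<close> is zero on that hyperplane, and it is zero on the
  boundary of the half space because \<open>e\<close> is tangential.  At \<open>x + h e\<close>, at distance \<open>h / 2\<close>
  from \<open>a\<close> on the axis of the barrier, it equals \<open>w (x + h e) - w x\<close>.\<close>

lemma tangential_difference_estimate:
  fixes \<nu> e :: "'a::euclidean_space"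
  assumes \<nu>: "\<nu> \<in> Basis" and e: "e \<in> Basis - {\<nu>}" and w: "half_harmonic \<nu> w"
    and h: "0 \<le> h" "h \<le> R" and R: "R > 0" and M: "M > 0"
    and bound: "\<And>x. 0 \<le> x \<bullet> \<nu> \<Longrightarrow> norm x \<le> (real DIM('a) + 2) * R \<Longrightarrow> \<bar>w x\<bar> \<le> M"
    and x: "0 \<le> x \<bullet> \<nu>" "norm x \<le> R"
  shows "w (x + h *\<^sub>R e) - w x \<le> (real DIM('a) + 1) * M * h / R"
proof -
  define a where "a = x + (h / 2) *\<^sub>R e"
  define f where "f = (\<lambda>y. w y - w (mirror e a y))"
  have eB: "e \<in> Basis" and ne: "e \<bullet> \<nu> = 0" "\<nu> \<bullet> e = 0" and ee: "e \<bullet> e = 1"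
    using \<nu> e by (auto simp: inner_Basis)
  have m\<nu>: "mirror e a y \<bullet> \<nu> = y \<bullet> \<nu>" for y by (simp add: mirror_def inner_diff_left ne)
  have ma: "mirror e a y - a = (y - a) - (2 * ((y - a) \<bullet> e)) *\<^sub>R e" for y by (simp add: mirror_def)
  have na: "norm a \<le> 2 * R"
  proof -
    have "norm a \<le> norm x + norm ((h / 2) *\<^sub>R e)" unfolding a_def by (rule norm_triangle_ineq)
    also have "\<dots> \<le> R + R" using x(2) h eB by (intro add_mono) auto
    finally show ?thesis by simp
  qed
  have nb: "norm y \<le> (real DIM('a) + 2) * R" if "\<And>b. b \<in> Basis \<Longrightarrow> \<bar>(y - a) \<bullet> b\<bar> \<le> R" for y
  proof -
    have "norm y \<le> norm (y - a) + norm a" using norm_triangle_ineq[of "y - a" a] by simp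
    also have "\<dots> \<le> real DIM('a) * R + 2 * R" using norm_le_sup_coord[OF that] na by (intro add_mono)
    finally show ?thesis by (simp add: distrib_right)
  qed
  have mb: "\<bar>(mirror e a y - a) \<bullet> b\<bar> = \<bar>(y - a) \<bullet> b\<bar>" if "b \<in> Basis" for y b
  proof (cases "b = e")
    case True
    have "(mirror e a y - a) \<bullet> e = - ((y - a) \<bullet> e)"
      unfolding ma by (simp add: inner_diff_left[of "y - a"] ee)
    then show ?thesis using True by simp
  next
    case False
    have "(mirror e a y - a) \<bullet> b = (y - a) \<bullet> b"
      unfolding ma using False that eB by (simp add: inner_diff_left[of "y - a"] inner_Basis)
    then show ?thesis by simp
  qed
  have wM: "\<bar>w y\<bar> \<le> M" "\<bar>w (mirror e a y)\<bar> \<le> M" if "y \<in> half_box \<nu> e a R" for y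
    using that by (auto simp: half_box_def m\<nu> mb intro!: bound nb)
  have cw: "continuous_on {x. 0 \<le> x \<bullet> \<nu>} w" using w by (simp add: half_harmonic_def)
  have *: "f (a + (h / 2) *\<^sub>R e) \<le> barrier e a (2 * M) R (a + (h / 2) *\<^sub>R e)"
  proof (rule barrier_comparison[OF eB])
    show "0 < 2 * M" "0 < R" using M R by auto
    show "continuous_on (half_box \<nu> e a R) f"
      unfolding f_def
      by (intro continuous_intros continuous_on_compose2[OF cw] continuous_on_subset[OF cw])
         (auto simp: half_box_def m\<nu> mirror_def[abs_def] intro!: continuous_intros,
          simp add: mirror_def[symmetric] m\<nu>)
    show "f y \<le> 2 * M" if "y \<in> half_box \<nu> e a R" for y using wM[OF that] by (simp add: f_def)
    show "f y \<le> 0" if "y \<in> half_box \<nu> e a R" "y \<bullet> \<nu> = 0 \<or> (y - a) \<bullet> e = 0" for y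
      using that(2)
    proof
      assume "y \<bullet> \<nu> = 0"
      then show ?thesis using w by (simp add: half_harmonic_def f_def m\<nu>)
    next
      assume "(y - a) \<bullet> e = 0"
      then show ?thesis by (simp add: f_def mirror_def)
    qed
    show "\<exists>D\<ge>0. has_lap f y D" if "0 < y \<bullet> \<nu>" for y
    proof -
      have "has_lap w y 0" "has_lap w (mirror e a y) 0" using w that by (auto simp: half_harmonic_def m\<nu>)
      then have "has_lap f y (0 - 0)" unfolding f_def by (intro has_lap_diff has_lap_mirror eB)
      then show ?thesis by auto
    qed
    show "a + (h / 2) *\<^sub>R e \<in> half_box \<nu> e a R"
      using h x eB by (auto simp: half_box_def inner_add_left ne a_def ee inner_Basis)
  qed
  have "f (a + (h / 2) *\<^sub>R e) = w (x + h *\<^sub>R e) - w x"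
  proof -
    have 1: "a + (h / 2) *\<^sub>R e = x + h *\<^sub>R e" by (simp add: a_def add.assoc scaleR_add_left[symmetric])
    have "(x + h *\<^sub>R e - a) \<bullet> e = h / 2" by (simp add: a_def inner_diff_left inner_add_left ee)
    then have "mirror e a (x + h *\<^sub>R e) = x" by (simp add: mirror_def)
    then show ?thesis by (simp add: f_def 1)
  qed
  with * have "w (x + h *\<^sub>R e) - w x \<le> barrier e a (2 * M) R (a + (h / 2) *\<^sub>R e)" by simp
  also have "\<dots> \<le> (real DIM('a) + 1) * (2 * M) * (h / 2) / R"
    by (rule barrier_on_axis) (use eB M R in auto)
  finally show ?thesis by simp
qed

text \<open>A tangential difference gains one order, since the estimate above has the factor \<open>h / R\<close>.\<close>

lemma half_growth_fdiff:
  fixes \<nu> e :: "'a::euclidean_space"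
  assumes \<nu>: "\<nu> \<in> Basis" and e: "e \<in> Basis - {\<nu>}" and w: "half_harmonic \<nu> w"
    and gr: "half_growth \<nu> \<beta> w" and h: "h \<ge> 0"
  shows "half_growth \<nu> (\<beta> - 1) (fdiff (h *\<^sub>R e) w)"
proof -
  define N where "N = real DIM('a)"
  have N: "N \<ge> 1" by (simp add: N_def Suc_le_eq)
  obtain C R0 where C: "C > 0" "R0 > 0"
    "\<And>R x. R \<ge> R0 \<Longrightarrow> 0 \<le> x \<bullet> \<nu> \<Longrightarrow> norm x \<le> R \<Longrightarrow> \<bar>w x\<bar> \<le> C * R powr \<beta>"
    using gr unfolding half_growth_def by blast
  \<comment> \<open>\<open>h + 1\<close> in place of \<open>h\<close> keeps the constant positive for \<open>h = 0\<close>\<close>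
  define C' where "C' = (N + 1) * (C * (N + 2) powr \<beta>) * (h + 1)"
  have "C' > 0" using C N h by (simp add: C'_def)
  moreover have "R0 + h > 0" using C h by simp
  moreover have "\<bar>fdiff (h *\<^sub>R e) w x\<bar> \<le> C' * R powr (\<beta> - 1)"
    if R: "R \<ge> R0 + h" and x: "0 \<le> x \<bullet> \<nu>" "norm x \<le> R" for R x
  proof -
    have R0: "R > 0" "h \<le> R" "R0 \<le> R" using R C h by auto
    define M where "M = C * ((N + 2) * R) powr \<beta>"
    have M: "M > 0" using C N R0 by (simp add: M_def)
    have "R0 \<le> (N + 2) * R" using mult_right_mono[of 1 "N + 2" R] N R0 by linarith
    then have b: "\<bar>w y\<bar> \<le> M" if "0 \<le> y \<bullet> \<nu>" "norm y \<le> (real DIM('a) + 2) * R" for y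
      unfolding M_def using that by (intro C(3)) (auto simp: N_def)
    have "w (x + h *\<^sub>R e) - w x \<le> (N + 1) * M * h / R"
      unfolding N_def by (rule tangential_difference_estimate[OF \<nu> e w h R0(2,1) M b x])
    moreover have "- w (x + h *\<^sub>R e) - - w x \<le> (N + 1) * M * h / R"
      unfolding N_def
      by (rule tangential_difference_estimate[OF \<nu> e half_harmonic_uminus[OF w] h R0(2,1) M _ x]) (use b in auto)
    ultimately have "\<bar>fdiff (h *\<^sub>R e) w x\<bar> \<le> (N + 1) * M * h / R" by (simp add: fdiff_def abs_le_iff)
    also have "\<dots> \<le> (N + 1) * M * (h + 1) / R"
      using M N R0 by (intro divide_right_mono mult_left_mono) auto
    also have "\<dots> = C' * R powr (\<beta> - 1)"
      using N R0 by (simp add: C'_def M_def powr_mult powr_diff mult_ac)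
    finally show ?thesis .
  qed
  ultimately show ?thesis unfolding half_growth_def by blast
qed

lemma half_growth_neg_imp_zero:
  assumes "half_growth \<nu> \<beta> w" "\<beta> < 0" "0 \<le> x \<bullet> \<nu>"
  shows "w x = 0"
proof -
  obtain C R0 where C: "C > 0" "R0 > 0"
    "\<And>R x. R \<ge> R0 \<Longrightarrow> 0 \<le> x \<bullet> \<nu> \<Longrightarrow> norm x \<le> R \<Longrightarrow> \<bar>w x\<bar> \<le> C * R powr \<beta>"
    using assms(1) unfolding half_growth_def by blast
  have "((\<lambda>R. C * R powr \<beta>) \<longlongrightarrow> C * 0) at_top"
    by (intro tendsto_intros tendsto_neg_powr assms filterlim_ident)
  moreover have "\<forall>\<^sub>F R in at_top. \<bar>w x\<bar> \<le> C * R powr \<beta>"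
    using eventually_ge_at_top[of R0] eventually_ge_at_top[of "norm x"]
    by eventually_elim (use C(3) assms(3) in blast)
  ultimately have "\<bar>w x\<bar> \<le> C * 0"
    by (rule tendsto_lowerbound) simp
  then show ?thesis by simp
qed

text \<open>After \<open>k > \<beta>\<close> differences the order of growth \<open>\<beta> - k\<close> is negative.\<close>

lemma iterated_tangential_difference_zero:
  fixes \<nu> e :: "'a::euclidean_space"
  assumes \<nu>: "\<nu> \<in> Basis" and e: "e \<in> Basis - {\<nu>}" and w: "half_harmonic \<nu> w"
    and gr: "half_growth \<nu> \<beta> w" and h: "h \<ge> 0" and k: "\<beta> < real k" and x: "0 \<le> x \<bullet> \<nu>"
  shows "(fdiff (h *\<^sub>R e) ^^ k) w x = 0"
proof -
  have "half_harmonic \<nu> ((fdiff (h *\<^sub>R e) ^^ j) w) \<and> half_growth \<nu> (\<beta> - real j) ((fdiff (h *\<^sub>R e) ^^ j) w)" for j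
  proof (induction j)
    case (Suc j)
    have "half_growth \<nu> (\<beta> - real j - 1) (fdiff (h *\<^sub>R e) ((fdiff (h *\<^sub>R e) ^^ j) w))"
      using Suc by (intro half_growth_fdiff \<nu> e h) auto
    moreover have "\<beta> - real j - 1 = \<beta> - real (Suc j)" by simp
    ultimately show ?case using Suc half_harmonic_fdiff[OF \<nu> e] by (simp del: of_nat_Suc)
  qed (use w gr in auto)
  then show ?thesis using half_growth_neg_imp_zero[of \<nu> "\<beta> - real k"] k x by auto
qed

text \<open>The Phragmen-Lindelof principle.  With the barrier in direction \<open>\<nu>\<close> on boxes of half-width
  \<open>R\<close>, the value of \<open>w\<close> at height \<open>s\<close> is at most a constant times \<open>s R\<^sup>\<beta> / R\<close>, which
  tends to \<open>0\<close>.\<close>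

lemma sublinear_subsolution_nonpos:
  fixes \<nu> :: "'a::euclidean_space"
  assumes \<nu>: "\<nu> \<in> Basis" and c: "continuous_on {x. 0 \<le> x \<bullet> \<nu>} w"
    and bd: "\<And>x. x \<bullet> \<nu> = 0 \<Longrightarrow> w x \<le> 0"
    and sub: "\<And>x. x \<bullet> \<nu> > 0 \<Longrightarrow> w x > 0 \<Longrightarrow> \<exists>D\<ge>0. has_lap w x D"
    and gr: "half_growth \<nu> \<beta> w" and \<beta>: "\<beta> < 1" and x: "0 \<le> x \<bullet> \<nu>"
  shows "w x \<le> 0"
proof -
  define N where "N = real DIM('a)"
  have N: "N \<ge> 1" by (simp add: N_def Suc_le_eq)
  obtain C R0 where C: "C > 0" "R0 > 0"
    "\<And>R x. R \<ge> R0 \<Longrightarrow> 0 \<le> x \<bullet> \<nu> \<Longrightarrow> norm x \<le> R \<Longrightarrow> \<bar>w x\<bar> \<le> C * R powr \<beta>"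
    using gr unfolding half_growth_def by blast
  define s where "s = x \<bullet> \<nu>"
  have s0: "s \<ge> 0" using x by (simp add: s_def)
  define a where "a = x - s *\<^sub>R \<nu>"
  have \<nu>\<nu>: "\<nu> \<bullet> \<nu> = 1" using \<nu> by simp
  have a\<nu>: "a \<bullet> \<nu> = 0" by (simp add: a_def s_def inner_diff_left \<nu>\<nu>)
  define K where "K = (N + 1) * (C * (N + 1) powr \<beta>) * s"
  have ineq: "w x \<le> K * R powr (\<beta> - 1)" if R: "R \<ge> R0" "R \<ge> s" "R \<ge> norm a" for R
  proof -
    have R0: "R > 0" using R C by linarith
    define M where "M = C * ((N + 1) * R) powr \<beta>"
    have M: "M > 0" using C N R0 by (simp add: M_def)
    have "R0 \<le> (N + 1) * R" using mult_right_mono[of 1 "N + 1" R] N R R0 by linarith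
    have wM: "\<bar>w y\<bar> \<le> M" if y: "y \<in> half_box \<nu> \<nu> a R" for y
    proof -
      have "norm y \<le> norm (y - a) + norm a" using norm_triangle_ineq[of "y - a" a] by simp
      also have "\<dots> \<le> N * R + R"
        unfolding N_def using y R by (intro add_mono norm_le_sup_coord) (auto simp: half_box_def)
      finally have "norm y \<le> (N + 1) * R" by (simp add: distrib_right)
      then show ?thesis
        unfolding M_def using y \<open>R0 \<le> (N + 1) * R\<close> by (intro C(3)) (auto simp: half_box_def)
    qed
    have xa: "x = a + s *\<^sub>R \<nu>" by (simp add: a_def)
    have "w x \<le> barrier \<nu> a M R x"
    proof (rule barrier_comparison[OF \<nu> M R0])
      show "continuous_on (half_box \<nu> \<nu> a R) w"
        by (rule continuous_on_subset[OF c]) (auto simp: half_box_def)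
      show "w y \<le> M" if "y \<in> half_box \<nu> \<nu> a R" for y using wM[OF that] by simp
      show "w y \<le> 0" if "y \<in> half_box \<nu> \<nu> a R" "y \<bullet> \<nu> = 0 \<or> (y - a) \<bullet> \<nu> = 0" for y
        using that by (auto intro: bd simp: inner_diff_left a\<nu>)
      show "x \<in> half_box \<nu> \<nu> a R"
        unfolding xa using s0 R0 R \<nu> by (auto simp: half_box_def inner_add_left a\<nu> inner_Basis)
    qed (use sub in auto)
    also have "\<dots> \<le> (N + 1) * M * s / R"
      unfolding xa N_def using M R0 by (intro barrier_on_axis \<nu>) auto
    also have "\<dots> = K * R powr (\<beta> - 1)"
      using N R0 by (simp add: K_def M_def powr_mult powr_diff mult_ac)
    finally show ?thesis .
  qed
  have "((\<lambda>R. K * R powr (\<beta> - 1)) \<longlongrightarrow> K * 0) at_top"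
    by (intro tendsto_intros tendsto_neg_powr filterlim_ident) (use \<beta> in simp)
  moreover have "\<forall>\<^sub>F R in at_top. w x \<le> K * R powr (\<beta> - 1)"
    using eventually_ge_at_top[of R0] eventually_ge_at_top[of s] eventually_ge_at_top[of "norm a"]
    by eventually_elim (use ineq in blast)
  ultimately have "w x \<le> K * 0"
    by (rule tendsto_lowerbound) simp
  then show ?thesis by simp
qed

section \<open>The homogeneous extension of an eigenfunction\<close>

text \<open>The hemisphere of the theorem has the pole \<open>(0, 1)\<close>.  Of the pole the argument uses only that it
  is one of the basis vectors, so that the other basis vectors are tangential to the boundary.\<close>

definition upper_sphere :: "'a::euclidean_space \<Rightarrow> 'a set" where
  "upper_sphere \<nu> = {x \<in> sphere 0 1. 0 < x \<bullet> \<nu>}"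

lemma sgn_inner_iff: "0 < sgn x \<bullet> \<nu> \<longleftrightarrow> 0 < x \<bullet> (\<nu>::'a::euclidean_space)"
  by (cases "x = 0") (auto simp: sgn_div_norm zero_less_mult_iff)

lemma cone_over_upper_sphere: "cone_over (upper_sphere \<nu>) = {x. 0 < x \<bullet> \<nu>}"
  by (auto simp: cone_over_def upper_sphere_def sgn_inner_iff norm_sgn)

lemma open_upper_half_space: "open {x::'a::euclidean_space. 0 < x \<bullet> \<nu>}"
  by (intro open_Collect_less continuous_intros)

lemma line_derivative:
  fixes f :: "'a::euclidean_space \<Rightarrow> real"
  assumes "f differentiable (at (x + t *\<^sub>R b))"
  shows "((\<lambda>s. f (x + s *\<^sub>R b)) has_real_derivative partial_deriv b f (x + t *\<^sub>R b)) (at t)"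
proof -
  define F where "F = frechet_derivative f (at (x + t *\<^sub>R b))"
  have F: "(f has_derivative F) (at (x + t *\<^sub>R b))" unfolding F_def using assms frechet_derivative_works by blast
  have g: "((\<lambda>s. x + s *\<^sub>R b) has_derivative (\<lambda>s. s *\<^sub>R b)) (at t)"
    by (auto intro!: derivative_eq_intros)
  have "((\<lambda>s. f (x + s *\<^sub>R b)) has_derivative (\<lambda>s. F (s *\<^sub>R b))) (at t)"
    by (rule has_derivative_compose[OF g F])
  moreover have "(\<lambda>s. F (s *\<^sub>R b)) = (*) (F b)"
    using has_derivative_linear[OF F] by (auto simp: linear_scale mult.commute)
  ultimately show ?thesis by (simp add: has_field_derivative_def partial_deriv_def F_def)
qed

lemma C2_on_jet2:
  fixes f :: "'a::euclidean_space \<Rightarrow> real"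
  assumes f: "C2_on S f" and S: "open S" and x: "x \<in> S" and b: "b \<in> Basis"
  shows "jet2 (\<lambda>t. f (x + t *\<^sub>R b)) (partial_deriv b f x) (partial_deriv b (partial_deriv b f) x)"
proof (rule jet2I[where g = "\<lambda>t. partial_deriv b f (x + t *\<^sub>R b)"])
  have "((\<lambda>t. x + t *\<^sub>R b) \<longlongrightarrow> x) (nhds 0)" by (auto intro!: tendsto_eq_intros filterlim_ident)
  then have "\<forall>\<^sub>F t in nhds 0. x + t *\<^sub>R b \<in> S" using S x by (rule topological_tendstoD)
  then show "\<forall>\<^sub>F t in nhds 0. ((\<lambda>t. f (x + t *\<^sub>R b)) has_real_derivative partial_deriv b f (x + t *\<^sub>R b)) (at t)"
    by eventually_elim (use f in \<open>auto intro!: line_derivative simp: C2_on_def\<close>)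
  show "((\<lambda>t. partial_deriv b f (x + t *\<^sub>R b)) has_real_derivative partial_deriv b (partial_deriv b f) x) (at 0)"
    using line_derivative[of "partial_deriv b f" x 0 b] f x b by (auto simp: C2_on_def)
qed simp

lemma norm_line_square:
  fixes x b :: "'a::euclidean_space"
  assumes "b \<in> Basis"
  shows "(norm (x + t *\<^sub>R b))\<^sup>2 = (norm x)\<^sup>2 + 2 * (x \<bullet> b) * t + t\<^sup>2"
  unfolding power2_norm_eq_inner
  using assms by (simp add: inner_add_left inner_add_right inner_commute[of b x] power2_eq_square distrib_left)

lemma jet2_norm_powr:
  fixes x b :: "'a::euclidean_space"
  assumes x: "x \<noteq> 0" and b: "b \<in> Basis"
  shows "jet2 (\<lambda>t. norm (x + t *\<^sub>R b) powr \<alpha>) (\<alpha> * norm x powr (\<alpha> - 2) * (x \<bullet> b))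
    (\<alpha> * norm x powr (\<alpha> - 2) + \<alpha> * (\<alpha> - 2) * norm x powr (\<alpha> - 4) * (x \<bullet> b)\<^sup>2)"
proof -
  define s where "s = (\<lambda>t. (norm x)\<^sup>2 + 2 * (x \<bullet> b) * t + t\<^sup>2)"
  have s: "s t = (norm (x + t *\<^sub>R b))\<^sup>2" for t by (simp add: s_def norm_line_square[OF b])
  have np: "norm y powr c = ((norm y)\<^sup>2) powr (c / 2)" for y :: 'a and c
    by (cases "y = 0") (simp_all add: powr_powr flip: powr_numeral)
  have eq: "norm (x + t *\<^sub>R b) powr \<alpha> = s t powr (\<alpha> / 2)" for t unfolding s by (rule np)
  have ds: "(s has_real_derivative 2 * (x \<bullet> b) + 2 * t) (at t)" for t
    unfolding s_def by (auto intro!: derivative_eq_intros)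
  have dp: "((\<lambda>t. s t powr c) has_real_derivative c * s t powr (c - 1) * (2 * (x \<bullet> b) + 2 * t)) (at t)"
    if "s t > 0" for c t
    by (rule DERIV_chain2[OF has_real_derivative_powr ds]) (rule that)
  have s0: "s 0 = (norm x)\<^sup>2" by (simp add: s_def)
  have "isCont s 0" unfolding s_def by (intro continuous_intros)
  then have "(s \<longlongrightarrow> s 0) (nhds 0)" by (simp add: isCont_def tendsto_at_iff_tendsto_nhds)
  then have ev: "\<forall>\<^sub>F t in nhds 0. s t > 0" by (rule order_tendstoD) (use x in \<open>simp add: s0\<close>)
  show ?thesis unfolding eq
  proof (rule jet2I[where g = "\<lambda>t. (\<alpha> / 2) * s t powr (\<alpha> / 2 - 1) * (2 * (x \<bullet> b) + 2 * t)"])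
    show "\<forall>\<^sub>F t in nhds 0. ((\<lambda>t. s t powr (\<alpha> / 2)) has_real_derivative
        (\<alpha> / 2) * s t powr (\<alpha> / 2 - 1) * (2 * (x \<bullet> b) + 2 * t)) (at t)"
      using ev by eventually_elim (rule dp)
    have e1: "s 0 powr (\<alpha> / 2 - 1) = norm x powr (\<alpha> - 2)"
      unfolding s0 np[of x "\<alpha> - 2"] by (simp add: diff_divide_distrib)
    have e2: "s 0 powr (\<alpha> / 2 - 1 - 1) = norm x powr (\<alpha> - 4)"
      unfolding s0 np[of x "\<alpha> - 4"] by (simp add: diff_divide_distrib)
    show "(\<alpha> / 2) * s 0 powr (\<alpha> / 2 - 1) * (2 * (x \<bullet> b) + 2 * 0) = \<alpha> * norm x powr (\<alpha> - 2) * (x \<bullet> b)"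
      unfolding e1 by simp
    have d: "((\<lambda>t. s t powr (\<alpha> / 2 - 1)) has_real_derivative
        (\<alpha> / 2 - 1) * norm x powr (\<alpha> - 4) * (2 * (x \<bullet> b) + 2 * 0)) (at 0)"
      using dp[of 0 "\<alpha> / 2 - 1"] x unfolding e2 by (simp add: s0)
    show "((\<lambda>t. (\<alpha> / 2) * s t powr (\<alpha> / 2 - 1) * (2 * (x \<bullet> b) + 2 * t)) has_real_derivative
        \<alpha> * norm x powr (\<alpha> - 2) + \<alpha> * (\<alpha> - 2) * norm x powr (\<alpha> - 4) * (x \<bullet> b)\<^sup>2) (at 0)"
      by (rule derivative_eq_intros d refl)+
         (unfold e1, simp add: power2_eq_square distrib_right distrib_left left_diff_distrib right_diff_distrib)
  qed
qed

text \<open>A function that is homogeneous of degree \<open>0\<close> is constant along rays, so its derivative in the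
  radial direction is zero.\<close>

lemma euler_degree_zero:
  fixes u :: "'a::euclidean_space \<Rightarrow> real"
  assumes "(\<lambda>y. u (sgn y)) differentiable (at x)"
  shows "(\<Sum>b\<in>Basis. (x \<bullet> b) * partial_deriv b (\<lambda>y. u (sgn y)) x) = 0"
proof -
  let ?U = "\<lambda>y. u (sgn y)"
  define F where "F = frechet_derivative ?U (at x)"
  have lin: "linear F" unfolding F_def using assms by (rule linear_frechet_derivative)
  have d: "((\<lambda>s. ?U (x + s *\<^sub>R x)) has_real_derivative F x) (at 0)"
    using line_derivative[of ?U x 0 x] assms by (simp add: partial_deriv_def F_def)
  have ev: "\<forall>\<^sub>F s in nhds 0. ?U (x + s *\<^sub>R x) = ?U x"
  proof -
    have "\<forall>\<^sub>F s::real in nhds 0. - 1 < s" by (rule order_tendstoD(1)[OF filterlim_ident]) simp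
    then show ?thesis
    proof eventually_elim
      case (elim s)
      have "x + s *\<^sub>R x = (1 + s) *\<^sub>R x" by (simp add: scaleR_add_left)
      then show ?case using elim by (simp add: sgn_scaleR)
    qed
  qed
  have "((\<lambda>s. ?U x) has_real_derivative F x) (at 0)"
    by (rule iffD1[OF DERIV_cong_ev[OF refl ev refl] d])
  then have "F x = 0" using DERIV_unique DERIV_const by blast
  moreover have "F x = (\<Sum>b\<in>Basis. (x \<bullet> b) * F b)"
    by (subst euclidean_representation[symmetric, of x]) (simp only: linear_sum[OF lin] linear_scale[OF lin] real_scaleR_def)
  ultimately show ?thesis by (simp add: partial_deriv_def F_def)
qed

definition cone_ext :: "real \<Rightarrow> ('a::euclidean_space \<Rightarrow> real) \<Rightarrow> 'a \<Rightarrow> real" where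
  "cone_ext \<alpha> u x = norm x powr \<alpha> * u (sgn x)"

text \<open>In the product rule for \<open>|x|\<^sup>\<alpha> u (sgn x)\<close> the mixed term is a multiple of the radial derivative
  of \<open>u (sgn x)\<close> and vanishes; the Laplacian of \<open>|x|\<^sup>\<alpha>\<close> is
  \<open>\<alpha> (\<alpha> + DIM('a) - 2) |x|\<^bsup>\<alpha> - 2\<^esup>\<close>, and that of \<open>u (sgn x)\<close> is \<open>- \<mu> |x|\<^bsup>- 2\<^esup> u (sgn x)\<close>.\<close>

lemma cone_ext_lap:
  fixes u :: "'a::euclidean_space \<Rightarrow> real"
  assumes u: "u \<in> dirichlet_eigenspace (upper_sphere \<nu>) \<mu>" and x: "0 < x \<bullet> \<nu>"
  shows "has_lap (cone_ext \<alpha> u) x ((\<alpha> * (\<alpha> + real DIM('a) - 2) - \<mu>) * norm x powr (\<alpha> - 2) * u (sgn x))"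
proof -
  define U where "U = (\<lambda>y. u (sgn y))"
  define r where "r = norm x"
  define y where "y = sgn x"
  have x0: "x \<noteq> 0" using x by auto
  have r: "r > 0" using x0 by (simp add: r_def)
  have y: "0 < y \<bullet> \<nu>" "norm y = 1" using x x0 by (simp_all add: y_def sgn_inner_iff norm_sgn)
  have xy: "x = r *\<^sub>R y" using x0 by (simp add: r_def y_def sgn_div_norm)
  have C2: "C2_on {x. 0 < x \<bullet> \<nu>} U"
    using u by (simp add: dirichlet_eigenspace_def C2_on_sphere_def cone_over_upper_sphere U_def)
  have lap: "(\<Sum>b\<in>Basis. partial_deriv b (partial_deriv b U) y) = - \<mu> * u y"
  proof -
    have "y \<in> upper_sphere \<nu>" using y by (simp add: upper_sphere_def)
    then have "- laplace_beltrami u y = \<mu> * u y" using u by (simp add: dirichlet_eigenspace_def)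
    then show ?thesis by (simp add: laplace_beltrami_def laplacian_def U_def)
  qed
  have euler: "(\<Sum>b\<in>Basis. (y \<bullet> b) * partial_deriv b U y) = 0"
    unfolding U_def by (rule euler_degree_zero) (use C2 y in \<open>simp add: C2_on_def U_def\<close>)
  \<comment> \<open>the eigenvalue equation is given at \<open>y\<close> on the sphere; the jets at \<open>x = r y\<close> are rescaled ones\<close>
  define P where "P = (\<lambda>b. 1 / r * partial_deriv b U y)"
  define Q where "Q = (\<lambda>b. (1 / r)\<^sup>2 * partial_deriv b (partial_deriv b U) y)"
  have jU: "jet2 (\<lambda>t. U (x + t *\<^sub>R b)) (P b) (Q b)" if b: "b \<in> Basis" for b
  proof -
    have "U (x + t *\<^sub>R b) = U (y + (1 / r * t) *\<^sub>R b)" for t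
    proof -
      have "x + t *\<^sub>R b = r *\<^sub>R (y + (1 / r * t) *\<^sub>R b)" using r by (simp add: xy scaleR_add_right)
      then show ?thesis using r by (simp add: U_def sgn_scaleR)
    qed
    then show ?thesis
      using jet2_rescale[OF C2_on_jet2[OF C2 open_upper_half_space _ b, of y], of "1 / r"] y r
      by (simp add: P_def Q_def)
  qed
  have UP: "(\<Sum>b\<in>Basis. (x \<bullet> b) * P b) = 0"
    using euler r by (simp add: xy P_def)
  have UQ: "(\<Sum>b\<in>Basis. Q b) = - \<mu> * u y / r\<^sup>2"
    unfolding Q_def sum_distrib_left[symmetric] lap by (simp add: power_divide)
  define p1 where "p1 = (\<lambda>b. \<alpha> * r powr (\<alpha> - 2) * (x \<bullet> b))"
  define q1 where "q1 = (\<lambda>b. \<alpha> * r powr (\<alpha> - 2) + \<alpha> * (\<alpha> - 2) * r powr (\<alpha> - 4) * (x \<bullet> b)\<^sup>2)"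
  have j1: "jet2 (\<lambda>t. norm (x + t *\<^sub>R b) powr \<alpha>) (p1 b) (q1 b)" if "b \<in> Basis" for b
    unfolding p1_def q1_def r_def using x0 that by (rule jet2_norm_powr)
  show ?thesis
  proof (rule has_lapI)
    fix b :: 'a assume b: "b \<in> Basis"
    show "jet2 (\<lambda>t. cone_ext \<alpha> u (x + t *\<^sub>R b)) (p1 b * u y + r powr \<alpha> * P b)
        (q1 b * u y + 2 * p1 b * P b + r powr \<alpha> * Q b)"
      using jet2_mult[OF j1[OF b] jU[OF b]] by (simp add: cone_ext_def U_def y_def r_def)
  next
    have "(\<Sum>b\<in>Basis. (x \<bullet> b)\<^sup>2) = r\<^sup>2"
      unfolding r_def power2_norm_eq_inner by (subst euclidean_inner) (simp add: power2_eq_square)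
    then have s1: "(\<Sum>b\<in>Basis. q1 b) = real DIM('a) * (\<alpha> * r powr (\<alpha> - 2)) + \<alpha> * (\<alpha> - 2) * (r powr (\<alpha> - 4) * r\<^sup>2)"
      unfolding q1_def sum.distrib sum_distrib_left[symmetric] by simp
    have "r powr (\<alpha> - 4) * r\<^sup>2 = r powr (\<alpha> - 4 + 2)"
      using r unfolding powr_add by simp
    then have s2: "(\<Sum>b\<in>Basis. q1 b) = \<alpha> * (\<alpha> + real DIM('a) - 2) * r powr (\<alpha> - 2)"
      unfolding s1 by (simp add: distrib_left distrib_right left_diff_distrib right_diff_distrib mult_ac)
    have s3: "(\<Sum>b\<in>Basis. 2 * p1 b * P b) = 2 * \<alpha> * r powr (\<alpha> - 2) * (\<Sum>b\<in>Basis. (x \<bullet> b) * P b)"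
      unfolding sum_distrib_left p1_def by (intro sum.cong refl) (simp add: mult_ac)
    have rr: "r powr \<alpha> / r\<^sup>2 = r powr (\<alpha> - 2)" using r by (simp add: powr_diff)
    have "(\<Sum>b\<in>Basis. q1 b * u y + 2 * p1 b * P b + r powr \<alpha> * Q b)
        = (\<Sum>b\<in>Basis. q1 b) * u y + (\<Sum>b\<in>Basis. 2 * p1 b * P b) + r powr \<alpha> * (\<Sum>b\<in>Basis. Q b)"
      by (simp add: sum.distrib sum_distrib_left sum_distrib_right)
    also have "\<dots> = \<alpha> * (\<alpha> + real DIM('a) - 2) * r powr (\<alpha> - 2) * u y - \<mu> * (r powr \<alpha> / r\<^sup>2) * u y"
      unfolding s2 s3 UP UQ by simp
    also have "\<dots> = (\<alpha> * (\<alpha> + real DIM('a) - 2) - \<mu>) * r powr (\<alpha> - 2) * u y"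
      unfolding rr by (simp add: left_diff_distrib)
    finally show "(\<Sum>b\<in>Basis. q1 b * u y + 2 * p1 b * P b + r powr \<alpha> * Q b)
      = (\<alpha> * (\<alpha> + real DIM('a) - 2) - \<mu>) * norm x powr (\<alpha> - 2) * u (sgn x)"
      by (simp add: r_def y_def)
  qed
qed

text \<open>A point on the equator is the limit of its perturbations in the direction of the pole, projected
  back to the sphere.\<close>

lemma closed_upper_sphere_subset_closure:
  fixes \<nu> :: "'a::euclidean_space"
  assumes \<nu>: "\<nu> \<in> Basis" and x: "norm x = 1" "0 \<le> x \<bullet> \<nu>"
  shows "x \<in> closure (upper_sphere \<nu>)"
proof -
  define f where "f = (\<lambda>n::nat. sgn (x + inverse (real (Suc n)) *\<^sub>R \<nu>))"
  have "(x + inverse (real (Suc n)) *\<^sub>R \<nu>) \<bullet> \<nu> > 0" for n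
    using x \<nu> by (simp add: inner_add_left add_nonneg_pos)
  then have "f n \<in> upper_sphere \<nu>" for n
    unfolding f_def upper_sphere_def using norm_sgn
    by (smt (verit) inner_zero_left mem_Collect_eq mem_sphere_0 sgn_inner_iff)
  moreover have "f \<longlonglongrightarrow> sgn (x + 0 *\<^sub>R \<nu>)"
    unfolding f_def using x by (intro tendsto_intros LIMSEQ_inverse_real_of_nat) auto
  moreover have "sgn x = x" using x by (simp add: sgn_div_norm)
  ultimately show ?thesis unfolding closure_sequential by auto
qed

lemma eigenfunction_bounded:
  assumes "u \<in> dirichlet_eigenspace (upper_sphere \<nu>) \<mu>"
  obtains M where "M > 0" "\<And>x. \<bar>u x\<bar> \<le> M"
proof -
  have "bounded (upper_sphere \<nu>)" by (rule bounded_subset[of "sphere 0 1"]) (auto simp: upper_sphere_def)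
  then have "compact (closure (upper_sphere \<nu>))" by (simp add: compact_closure)
  moreover have "continuous_on (closure (upper_sphere \<nu>)) u" using assms by (simp add: dirichlet_eigenspace_def)
  ultimately have "bounded (u ` closure (upper_sphere \<nu>))" using compact_continuous_image compact_imp_bounded by blast
  then obtain B where B: "B > 0" "\<And>x. x \<in> closure (upper_sphere \<nu>) \<Longrightarrow> \<bar>u x\<bar> \<le> B"
    unfolding bounded_pos by auto
  have "\<bar>u x\<bar> \<le> B" for x
  proof (cases "x \<in> upper_sphere \<nu>")
    case True
    then show ?thesis using B(2) closure_subset by blast
  next
    case False
    then show ?thesis using assms B(1) by (simp add: dirichlet_eigenspace_def)
  qed
  then show ?thesis using B(1) that by blast
qed

lemma cone_ext_growth:
  assumes u: "u \<in> dirichlet_eigenspace (upper_sphere \<nu>) \<mu>" and \<alpha>: "\<alpha> > 0"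
  shows "half_growth \<nu> \<alpha> (cone_ext \<alpha> u)"
proof -
  obtain M where M: "M > 0" "\<And>x. \<bar>u x\<bar> \<le> M" using eigenfunction_bounded[OF u] by blast
  have "\<bar>cone_ext \<alpha> u x\<bar> \<le> M * R powr \<alpha>" if "norm x \<le> R" for x R
    unfolding cone_ext_def abs_mult mult.commute[of "\<bar>norm x powr \<alpha>\<bar>"]
    using M that \<alpha> by (intro mult_mono) (auto intro: powr_mono2)
  then show ?thesis unfolding half_growth_def using M(1) zero_less_one by blast
qed

lemma cone_ext_boundary:
  assumes u: "u \<in> dirichlet_eigenspace (upper_sphere \<nu>) \<mu>" and x: "x \<bullet> \<nu> = 0"
  shows "cone_ext \<alpha> u x = 0"
proof -
  have "sgn x \<notin> upper_sphere \<nu>" using x sgn_inner_iff[of x \<nu>] by (simp add: upper_sphere_def)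
  then show ?thesis using u by (simp add: cone_ext_def dirichlet_eigenspace_def)
qed

lemma cone_ext_continuous:
  fixes \<nu> :: "'a::euclidean_space"
  assumes \<nu>: "\<nu> \<in> Basis" and u: "u \<in> dirichlet_eigenspace (upper_sphere \<nu>) \<mu>" and \<alpha>: "\<alpha> > 0"
  shows "continuous_on {x. 0 \<le> x \<bullet> \<nu>} (cone_ext \<alpha> u)"
  unfolding continuous_on_eq_continuous_within
proof
  let ?H = "{x. 0 \<le> x \<bullet> \<nu>}"
  fix x assume x: "x \<in> ?H"
  obtain M where M: "M > 0" "\<And>x. \<bar>u x\<bar> \<le> M" using eigenfunction_bounded[OF u] by blast
  show "continuous (at x within ?H) (cone_ext \<alpha> u)"
  proof (cases "x = 0")
    case True
    have "((\<lambda>y::'a. norm y) \<longlongrightarrow> 0) (at 0 within ?H)" by (intro tendsto_norm_zero tendsto_ident_at)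
    then have "((\<lambda>y::'a. M * norm y powr \<alpha>) \<longlongrightarrow> M * (0 powr \<alpha>)) (at 0 within ?H)"
      using \<alpha> by (intro tendsto_intros tendsto_powr') auto
    then have "((\<lambda>y::'a. M * norm y powr \<alpha>) \<longlongrightarrow> 0) (at 0 within ?H)" by simp
    then have "(cone_ext \<alpha> u \<longlongrightarrow> 0) (at 0 within ?H)"
    proof (rule Lim_null_comparison[rotated])
      show "\<forall>\<^sub>F y in at 0 within ?H. norm (cone_ext \<alpha> u y) \<le> M * norm y powr \<alpha>"
        using M by (intro always_eventually allI) (auto simp: cone_ext_def abs_mult mult.commute[of M] intro: mult_left_mono)
    qed
    then show ?thesis using True by (simp add: continuous_within cone_ext_def)
  next
    case False
    let ?H' = "?H \<inter> - {0}"
    have "continuous_on ?H' (\<lambda>y. u (sgn y))"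
    proof (rule continuous_on_compose2[of "closure (upper_sphere \<nu>)"])
      show "continuous_on (closure (upper_sphere \<nu>)) u" using u by (simp add: dirichlet_eigenspace_def)
      show "continuous_on ?H' sgn" by (intro continuous_on_sgn continuous_intros) auto
      show "sgn ` ?H' \<subseteq> closure (upper_sphere \<nu>)"
        by (auto intro!: closed_upper_sphere_subset_closure \<nu> simp: norm_sgn) (simp add: sgn_div_norm)
    qed
    then have "continuous_on ?H' (cone_ext \<alpha> u)"
      unfolding cone_ext_def by (intro continuous_intros) auto
    then have "continuous (at x within ?H') (cone_ext \<alpha> u)"
      using x False by (auto simp: continuous_on_eq_continuous_within)
    moreover have "at x within ?H' = at x within ?H"
      by (rule at_within_nhd[of x "- {0}"]) (use False in auto)
    ultimately show ?thesis by simp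
  qed
qed

lemma cone_ext_half_harmonic:
  fixes \<nu> :: "'a::euclidean_space"
  assumes \<nu>: "\<nu> \<in> Basis" and u: "u \<in> dirichlet_eigenspace (upper_sphere \<nu>) \<mu>" and \<alpha>: "\<alpha> > 0"
    and \<mu>: "\<mu> = \<alpha> * (\<alpha> + real DIM('a) - 2)"
  shows "half_harmonic \<nu> (cone_ext \<alpha> u)"
  unfolding half_harmonic_def
proof (intro conjI allI impI)
  fix x assume "0 < x \<bullet> \<nu>"
  from cone_ext_lap[OF u this, of \<alpha>] show "has_lap (cone_ext \<alpha> u) x 0" by (simp add: \<mu>)
qed (use cone_ext_continuous[OF \<nu> u \<alpha>] cone_ext_boundary[OF u] in auto)

lemma cone_ext_homogeneous: "r > 0 \<Longrightarrow> cone_ext \<alpha> u (r *\<^sub>R x) = r powr \<alpha> * cone_ext \<alpha> u x"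
  by (simp add: cone_ext_def powr_mult sgn_scaleR)

lemma cone_ext_sphere: "norm x = 1 \<Longrightarrow> cone_ext \<alpha> u x = u x"
  by (simp add: cone_ext_def sgn_div_norm)

text \<open>For \<open>\<mu> \<le> 0\<close> the extension with exponent \<open>1/2\<close> satisfies \<open>\<Delta>v = c |x|\<^bsup>- 2\<^esup> v\<close> with
  \<open>c \<ge> 0\<close>.  Hence \<open>v\<close> and \<open>- v\<close> are subharmonic where they are positive, and both grow
  sublinearly.\<close>

lemma eigenspace_nonpos_trivial:
  fixes \<nu> :: "'a::euclidean_space"
  assumes \<nu>: "\<nu> \<in> Basis" and D: "2 \<le> DIM('a)" and u: "u \<in> dirichlet_eigenspace (upper_sphere \<nu>) \<mu>" and \<mu>: "\<mu> \<le> 0"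
  shows "u = (\<lambda>_. 0)"
proof
  fix x
  define c where "c = 1 / 2 * (1 / 2 + real DIM('a) - 2) - \<mu>"
  have c: "c \<ge> 0" using D \<mu> by (simp add: c_def)
  let ?v = "cone_ext (1 / 2) u"
  have g: "half_growth \<nu> (1 / 2) ?v" by (rule cone_ext_growth[OF u]) simp
  have lap: "has_lap ?v y (c * norm y powr (1 / 2 - 2) * u (sgn y))" if "0 < y \<bullet> \<nu>" for y
    unfolding c_def by (rule cone_ext_lap[OF u that])
  show "u x = 0"
  proof (cases "x \<in> upper_sphere \<nu>")
    case True
    then have x: "0 \<le> x \<bullet> \<nu>" "norm x = 1" by (auto simp: upper_sphere_def)
    have cont: "continuous_on {x. 0 \<le> x \<bullet> \<nu>} ?v" by (rule cone_ext_continuous[OF \<nu> u]) simp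
    have "?v x \<le> 0"
    proof (rule sublinear_subsolution_nonpos[OF \<nu> cont _ _ g _ x(1)])
      show "\<exists>D\<ge>0. has_lap ?v y D" if "0 < y \<bullet> \<nu>" "0 < ?v y" for y
      proof (intro exI[of _ "c * norm y powr (1 / 2 - 2) * u (sgn y)"] conjI lap that(1))
        have "0 < u (sgn y)" using that(2) by (simp add: cone_ext_def zero_less_mult_iff)
        then show "0 \<le> c * norm y powr (1 / 2 - 2) * u (sgn y)" using c by simp
      qed
    qed (use cone_ext_boundary[OF u] in auto)
    moreover have "- ?v x \<le> 0"
    proof (rule sublinear_subsolution_nonpos[OF \<nu> continuous_on_minus[OF cont] _ _ _ _ x(1)])
      show "half_growth \<nu> (1 / 2) (\<lambda>x. - ?v x)" using g by (simp add: half_growth_def)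
      show "\<exists>D\<ge>0. has_lap (\<lambda>x. - ?v x) y D" if "0 < y \<bullet> \<nu>" "0 < - ?v y" for y
      proof (intro exI[of _ "- (c * norm y powr (1 / 2 - 2) * u (sgn y))"] conjI has_lap_uminus lap that(1))
        have "0 < - u (sgn y)" using that(2) by (simp add: cone_ext_def mult_less_0_iff)
        then show "0 \<le> - (c * norm y powr (1 / 2 - 2) * u (sgn y))"
          using c by (simp add: mult_nonneg_nonpos)
      qed
    qed (use cone_ext_boundary[OF u] in auto)
    ultimately show ?thesis using cone_ext_sphere[OF x(2), of "1 / 2" u] by simp
  qed (use u in \<open>simp add: dirichlet_eigenspace_def\<close>)
qed

section \<open>Expansion in tangential monomials\<close>

abbreviation tangents :: "'a::euclidean_space \<Rightarrow> 'a set" where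
  "tangents \<nu> \<equiv> Basis - {\<nu>}"

text \<open>Multi-indices with entries below \<open>k\<close>.  They serve both as exponents of monomials and as the
  integer points of a cube at which a function is sampled.\<close>

definition exponents :: "'a::euclidean_space \<Rightarrow> nat \<Rightarrow> ('a \<Rightarrow> nat) set" where
  "exponents \<nu> k = PiE (tangents \<nu>) (\<lambda>_. {..<k})"

definition total_degree :: "'a::euclidean_space \<Rightarrow> ('a \<Rightarrow> nat) \<Rightarrow> nat" where
  "total_degree \<nu> \<beta> = (\<Sum>b\<in>tangents \<nu>. \<beta> b)"

definition tangential_monomial :: "'a::euclidean_space \<Rightarrow> ('a \<Rightarrow> nat) \<Rightarrow> 'a \<Rightarrow> real" where
  "tangential_monomial \<nu> \<beta> x = (\<Prod>b\<in>tangents \<nu>. (x \<bullet> b) ^ \<beta> b)"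

definition grid_point :: "'a::euclidean_space \<Rightarrow> ('a \<Rightarrow> nat) \<Rightarrow> 'a" where
  "grid_point \<nu> p = (\<Sum>b\<in>tangents \<nu>. real (p b) *\<^sub>R b)"

text \<open>Sampling on the integer points of a cube and interpolating in each variable recovers the
  coefficients of a polynomial of degree less than \<open>k\<close> in each variable.  Written in this way a
  coefficient is a linear functional of arbitrary functions, which yields uniqueness of the
  coefficients, their continuity in a parameter, and their linear dependence on an eigenfunction.\<close>

definition monomial_coeff :: "'a::euclidean_space \<Rightarrow> nat \<Rightarrow> ('a \<Rightarrow> nat) \<Rightarrow> ('a \<Rightarrow> real) \<Rightarrow> real" where
  "monomial_coeff \<nu> k \<beta> f = (\<Sum>p\<in>exponents \<nu> k.
     (\<Prod>b\<in>tangents \<nu>. coeff (lagrange_poly k (p b)) (\<beta> b)) * f (grid_point \<nu> p))"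

lemma finite_exponents [simp]: "finite (exponents \<nu> k)"
  unfolding exponents_def by (intro finite_PiE) auto

lemma inner_sum_Basis:
  fixes b :: "'a::euclidean_space"
  assumes "F \<subseteq> Basis" "b \<in> Basis"
  shows "(\<Sum>c\<in>F. f c *\<^sub>R c) \<bullet> b = (if b \<in> F then f b else 0)"
proof -
  have "finite F" using assms(1) finite_Basis finite_subset by blast
  have "(\<Sum>c\<in>F. f c *\<^sub>R c) \<bullet> b = (\<Sum>c\<in>F. if c = b then f c else 0)"
    unfolding inner_sum_left using assms by (intro sum.cong refl) (auto simp: inner_Basis)
  then show ?thesis using \<open>finite F\<close> by simp
qed

lemma grid_point_inner: "b \<in> tangents \<nu> \<Longrightarrow> grid_point \<nu> p \<bullet> b = real (p b)"
  unfolding grid_point_def by (subst inner_sum_Basis) auto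

lemma grid_point_normal: "\<nu> \<in> Basis \<Longrightarrow> grid_point \<nu> p \<bullet> \<nu> = 0"
  unfolding grid_point_def by (subst inner_sum_Basis) auto

lemma monomial_coeff_cong:
  "(\<And>p. f (grid_point \<nu> p) = g (grid_point \<nu> p)) \<Longrightarrow> monomial_coeff \<nu> k \<beta> f = monomial_coeff \<nu> k \<beta> g"
  by (simp add: monomial_coeff_def)

lemma monomial_coeff_add: "monomial_coeff \<nu> k \<beta> (\<lambda>x. f x + g x) = monomial_coeff \<nu> k \<beta> f + monomial_coeff \<nu> k \<beta> g"
  by (simp add: monomial_coeff_def distrib_left sum.distrib)

lemma monomial_coeff_cmult: "monomial_coeff \<nu> k \<beta> (\<lambda>x. c * f x) = c * monomial_coeff \<nu> k \<beta> f"
  unfolding monomial_coeff_def sum_distrib_left by (intro sum.cong refl) (rule mult.left_commute)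

lemma monomial_coeff_zero: "monomial_coeff \<nu> k \<beta> (\<lambda>x. 0) = 0"
  by (simp add: monomial_coeff_def)

lemma monomial_coeff_sum: "finite A \<Longrightarrow> monomial_coeff \<nu> k \<beta> (\<lambda>x. \<Sum>i\<in>A. f i x) = (\<Sum>i\<in>A. monomial_coeff \<nu> k \<beta> (f i))"
  by (induction A rule: finite_induct) (simp_all add: monomial_coeff_zero monomial_coeff_add)

text \<open>The coefficient functionals are dual to the monomials.  The sum over the cube factors into
  one-variable sums, and interpolation reproduces \<open>t\<^sup>n\<close> for \<open>n < k\<close>.\<close>

lemma monomial_coeff_monomial:
  assumes "\<beta> \<in> exponents \<nu> k" "\<gamma> \<in> exponents \<nu> k"
  shows "monomial_coeff \<nu> k \<beta> (tangential_monomial \<nu> \<gamma>) = (if \<gamma> = \<beta> then 1 else 0)"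
proof -
  have "monomial_coeff \<nu> k \<beta> (tangential_monomial \<nu> \<gamma>)
     = (\<Sum>p\<in>exponents \<nu> k. \<Prod>b\<in>tangents \<nu>. coeff (lagrange_poly k (p b)) (\<beta> b) * real (p b) ^ \<gamma> b)"
    unfolding monomial_coeff_def tangential_monomial_def prod.distrib
    by (intro sum.cong arg_cong2[where f = "(*)"] prod.cong refl) (simp add: grid_point_inner)
  also have "\<dots> = (\<Prod>b\<in>tangents \<nu>. \<Sum>j<k. coeff (lagrange_poly k j) (\<beta> b) * real j ^ \<gamma> b)"
    unfolding exponents_def by (rule prod_sum_PiE[symmetric]) auto
  also have "\<dots> = (\<Prod>b\<in>tangents \<nu>. if \<gamma> b = \<beta> b then 1 else 0)"
  proof (intro prod.cong refl)
    fix b assume "b \<in> tangents \<nu>"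
    then have "\<gamma> b < k" using assms(2) by (auto simp: exponents_def PiE_iff)
    then have "interp k (poly (monom 1 (\<gamma> b))) = monom 1 (\<gamma> b)"
      by (intro interp_poly) (simp add: degree_monom_eq)
    then have "coeff (interp k (poly (monom 1 (\<gamma> b)))) (\<beta> b) = (if \<gamma> b = \<beta> b then 1 else 0)" by simp
    then show "(\<Sum>j<k. coeff (lagrange_poly k j) (\<beta> b) * real j ^ \<gamma> b) = (if \<gamma> b = \<beta> b then 1 else 0)"
      by (simp add: interp_def coeff_sum poly_monom mult.commute)
  qed
  also have "\<dots> = (if \<gamma> = \<beta> then 1 else 0)"
  proof (cases "\<gamma> = \<beta>")
    case False
    then obtain b where "b \<in> tangents \<nu>" "\<gamma> b \<noteq> \<beta> b" using PiE_ext assms unfolding exponents_def by blast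
    then have "(\<Prod>b\<in>tangents \<nu>. if \<gamma> b = \<beta> b then 1 else 0) = (0::real)" by (intro prod_zero) auto
    then show ?thesis using False by simp
  qed simp
  finally show ?thesis .
qed

lemma sum_PiE_insert:
  assumes "a \<notin> F"
  shows "(\<Sum>g\<in>PiE (insert a F) B. h g) = (\<Sum>p\<in>PiE F B. \<Sum>j\<in>B a. h (p(a := j)))"
proof -
  have "(\<Sum>g\<in>PiE (insert a F) B. h g) = (\<Sum>z\<in>B a \<times> PiE F B. h (case z of (j, p) \<Rightarrow> p(a := j)))"
    unfolding PiE_insert_eq using inj_combinator[OF assms] by (subst sum.reindex) (auto simp: o_def)
  also have "\<dots> = (\<Sum>j\<in>B a. \<Sum>p\<in>PiE F B. h (p(a := j)))"
    by (simp add: sum.cartesian_product split_beta)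
  finally show ?thesis by (subst (asm) sum.swap)
qed

text \<open>Interpolation in one variable after the other; \<open>F\<close> is the set of variables already treated.\<close>

lemma grid_interpolation:
  fixes v :: "'a::euclidean_space \<Rightarrow> real"
  assumes \<nu>: "\<nu> \<in> Basis" and F: "finite F" "F \<subseteq> tangents \<nu>"
    and v: "\<And>x b. 0 \<le> x \<bullet> \<nu> \<Longrightarrow> b \<in> tangents \<nu> \<Longrightarrow>
      v x = (\<Sum>j<k. v (x + (real j - x \<bullet> b) *\<^sub>R b) * poly (lagrange_poly k j) (x \<bullet> b))"
    and x: "0 \<le> x \<bullet> \<nu>"
  shows "v x = (\<Sum>p\<in>PiE F (\<lambda>_. {..<k}). (\<Prod>b\<in>F. poly (lagrange_poly k (p b)) (x \<bullet> b))
    * v (x + (\<Sum>b\<in>F. (real (p b) - x \<bullet> b) *\<^sub>R b)))"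
  using F
proof (induction F rule: finite_induct)
  case (insert a F)
  have a: "a \<in> tangents \<nu>" and FB: "F \<subseteq> Basis" and \<nu>F: "\<nu> \<notin> F" using insert.prems by auto
  define y where "y = (\<lambda>p::'a \<Rightarrow> nat. x + (\<Sum>b\<in>F. (real (p b) - x \<bullet> b) *\<^sub>R b))"
  have ya: "y p \<bullet> a = x \<bullet> a" for p
    using inner_sum_Basis[OF FB, of a] a insert.hyps(2) by (simp add: y_def inner_add_left)
  have y\<nu>: "y p \<bullet> \<nu> = x \<bullet> \<nu>" for p
    using inner_sum_Basis[OF FB \<nu>] \<nu>F by (simp add: y_def inner_add_left)
  have "v x = (\<Sum>p\<in>PiE F (\<lambda>_. {..<k}). (\<Prod>b\<in>F. poly (lagrange_poly k (p b)) (x \<bullet> b)) * v (y p))"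
    unfolding y_def using insert by simp
  also have "\<dots> = (\<Sum>p\<in>PiE F (\<lambda>_. {..<k}). \<Sum>j<k. (\<Prod>b\<in>insert a F. poly (lagrange_poly k ((p(a := j)) b)) (x \<bullet> b))
      * v (x + (\<Sum>b\<in>insert a F. (real ((p(a := j)) b) - x \<bullet> b) *\<^sub>R b)))"
  proof (intro sum.cong refl)
    fix p
    have P: "(\<Prod>b\<in>insert a F. poly (lagrange_poly k ((p(a := j)) b)) (x \<bullet> b))
      = poly (lagrange_poly k j) (x \<bullet> a) * (\<Prod>b\<in>F. poly (lagrange_poly k (p b)) (x \<bullet> b))" for j
      using insert.hyps by (simp, intro disjI2 prod.cong) auto
    have S: "x + (\<Sum>b\<in>insert a F. (real ((p(a := j)) b) - x \<bullet> b) *\<^sub>R b) = y p + (real j - x \<bullet> a) *\<^sub>R a" for j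
    proof -
      have "(\<Sum>b\<in>F. (real ((p(a := j)) b) - x \<bullet> b) *\<^sub>R b) = (\<Sum>b\<in>F. (real (p b) - x \<bullet> b) *\<^sub>R b)"
        using insert.hyps by (intro sum.cong) auto
      then show ?thesis using insert.hyps by (simp add: y_def add_ac)
    qed
    have "v (y p) = (\<Sum>j<k. v (y p + (real j - x \<bullet> a) *\<^sub>R a) * poly (lagrange_poly k j) (x \<bullet> a))"
      using v[of "y p" a] a x by (simp add: ya y\<nu>)
    then show "(\<Prod>b\<in>F. poly (lagrange_poly k (p b)) (x \<bullet> b)) * v (y p) =
      (\<Sum>j<k. (\<Prod>b\<in>insert a F. poly (lagrange_poly k ((p(a := j)) b)) (x \<bullet> b))
      * v (x + (\<Sum>b\<in>insert a F. (real ((p(a := j)) b) - x \<bullet> b) *\<^sub>R b)))"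
      unfolding P S by (simp add: sum_distrib_left mult_ac)
  qed
  also have "\<dots> = (\<Sum>p\<in>PiE (insert a F) (\<lambda>_. {..<k}). (\<Prod>b\<in>insert a F. poly (lagrange_poly k (p b)) (x \<bullet> b))
      * v (x + (\<Sum>b\<in>insert a F. (real (p b) - x \<bullet> b) *\<^sub>R b)))"
    using insert.hyps by (subst sum_PiE_insert) auto
  finally show ?case .
qed simp

lemma poly_eq_sum_less:
  fixes p :: "real poly"
  assumes "degree p < k" shows "poly p x = (\<Sum>i<k. coeff p i * x ^ i)"
  unfolding poly_altdef using assms
  by (intro sum.mono_neutral_left) (auto simp: coeff_eq_0)

lemma monomial_expansion:
  fixes v :: "'a::euclidean_space \<Rightarrow> real"
  assumes \<nu>: "\<nu> \<in> Basis"
    and v: "\<And>x b. 0 \<le> x \<bullet> \<nu> \<Longrightarrow> b \<in> tangents \<nu> \<Longrightarrow>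
      v x = (\<Sum>j<k. v (x + (real j - x \<bullet> b) *\<^sub>R b) * poly (lagrange_poly k j) (x \<bullet> b))"
    and x: "0 \<le> x \<bullet> \<nu>"
  shows "v x = (\<Sum>\<beta>\<in>exponents \<nu> k. monomial_coeff \<nu> k \<beta> (\<lambda>\<xi>. v (\<xi> + (x \<bullet> \<nu>) *\<^sub>R \<nu>)) * tangential_monomial \<nu> \<beta> x)"
proof -
  let ?T = "tangents \<nu>"
  have pt: "x + (\<Sum>b\<in>?T. (real (p b) - x \<bullet> b) *\<^sub>R b) = grid_point \<nu> p + (x \<bullet> \<nu>) *\<^sub>R \<nu>" for p
  proof -
    have "x = (\<Sum>b\<in>Basis. (x \<bullet> b) *\<^sub>R b)" by (simp add: euclidean_representation)
    also have "\<dots> = (x \<bullet> \<nu>) *\<^sub>R \<nu> + (\<Sum>b\<in>?T. (x \<bullet> b) *\<^sub>R b)" using \<nu> by (simp add: sum.remove)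
    finally have "x - (\<Sum>b\<in>?T. (x \<bullet> b) *\<^sub>R b) = (x \<bullet> \<nu>) *\<^sub>R \<nu>" by (metis add_diff_cancel_right')
    then show ?thesis by (simp add: scaleR_diff_left sum_subtractf grid_point_def)
  qed
  have P: "(\<Prod>b\<in>?T. poly (lagrange_poly k (p b)) (x \<bullet> b))
     = (\<Sum>\<beta>\<in>exponents \<nu> k. (\<Prod>b\<in>?T. coeff (lagrange_poly k (p b)) (\<beta> b)) * tangential_monomial \<nu> \<beta> x)"
    if p: "p \<in> exponents \<nu> k" for p
  proof -
    have "(\<Prod>b\<in>?T. poly (lagrange_poly k (p b)) (x \<bullet> b))
       = (\<Prod>b\<in>?T. \<Sum>i<k. coeff (lagrange_poly k (p b)) i * (x \<bullet> b) ^ i)"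
    proof (intro prod.cong refl poly_eq_sum_less degree_lagrange_poly)
      fix b assume "b \<in> ?T" then show "p b < k" using p by (auto simp: exponents_def PiE_iff)
    qed
    also have "\<dots> = (\<Sum>\<beta>\<in>exponents \<nu> k. \<Prod>b\<in>?T. coeff (lagrange_poly k (p b)) (\<beta> b) * (x \<bullet> b) ^ \<beta> b)"
      unfolding exponents_def by (intro prod_sum_PiE) auto
    finally show ?thesis by (simp add: prod.distrib tangential_monomial_def)
  qed
  have "v x = (\<Sum>p\<in>exponents \<nu> k. (\<Prod>b\<in>?T. poly (lagrange_poly k (p b)) (x \<bullet> b)) * v (grid_point \<nu> p + (x \<bullet> \<nu>) *\<^sub>R \<nu>))"
    using grid_interpolation[OF \<nu> _ order_refl v x] by (simp add: pt exponents_def)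
  also have "\<dots> = (\<Sum>p\<in>exponents \<nu> k. \<Sum>\<beta>\<in>exponents \<nu> k. (\<Prod>b\<in>?T. coeff (lagrange_poly k (p b)) (\<beta> b))
      * v (grid_point \<nu> p + (x \<bullet> \<nu>) *\<^sub>R \<nu>) * tangential_monomial \<nu> \<beta> x)"
    by (intro sum.cong refl) (simp add: P sum_distrib_right sum_distrib_left mult_ac)
  also have "\<dots> = (\<Sum>\<beta>\<in>exponents \<nu> k. monomial_coeff \<nu> k \<beta> (\<lambda>\<xi>. v (\<xi> + (x \<bullet> \<nu>) *\<^sub>R \<nu>)) * tangential_monomial \<nu> \<beta> x)"
    unfolding monomial_coeff_def sum_distrib_right by (rule sum.swap)
  finally show ?thesis .
qed

lemma half_harmonic_interpolation:
  fixes \<nu> :: "'a::euclidean_space"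
  assumes \<nu>: "\<nu> \<in> Basis" and w: "half_harmonic \<nu> w" and gr: "half_growth \<nu> \<alpha> w"
    and k: "\<alpha> < real k" "k > 0" and x: "0 \<le> x \<bullet> \<nu>" and b: "b \<in> tangents \<nu>"
  shows "w x = (\<Sum>j<k. w (x + (real j - x \<bullet> b) *\<^sub>R b) * poly (lagrange_poly k j) (x \<bullet> b))"
proof -
  \<comment> \<open>the point with \<open>b\<close>-coordinate \<open>0\<close> on the line through \<open>x\<close>\<close>
  define y where "y = x - (x \<bullet> b) *\<^sub>R b"
  have b\<nu>: "b \<bullet> \<nu> = 0" using \<nu> b by (auto simp: inner_Basis)
  have y: "(y + t *\<^sub>R b) \<bullet> \<nu> = x \<bullet> \<nu>" for t by (simp add: y_def inner_diff_left inner_add_left b\<nu>)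
  define f where "f = (\<lambda>t. w (y + (1 * t) *\<^sub>R b))"
  have fx: "f t = w (x + (t - x \<bullet> b) *\<^sub>R b)" for t
    by (simp add: f_def y_def scaleR_diff_left add_diff_eq diff_add_eq)
  have "f t = poly (interp k f) t" for t
  proof (rule finite_difference_zero_imp_poly[OF _ _ k(2)])
    have "continuous_on {x. 0 \<le> x \<bullet> \<nu>} w" using w by (simp add: half_harmonic_def)
    then show "continuous_on UNIV f"
      unfolding f_def by (rule continuous_on_compose2) (use x y in \<open>auto intro!: continuous_intros\<close>)
    show "(fdiff h ^^ k) f t = 0" if "h > 0" for h t
      unfolding f_def fdiff_pow_line
      using iterated_tangential_difference_zero[OF \<nu> b w gr _ k(1)] that x y by simp
  qed
  from this[of "x \<bullet> b"] show ?thesis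
    by (simp add: fx interp_def poly_sum)
qed

lemma tangential_monomial_scale:
  "tangential_monomial \<nu> \<beta> (r *\<^sub>R x) = r ^ total_degree \<nu> \<beta> * tangential_monomial \<nu> \<beta> x"
  by (simp add: tangential_monomial_def total_degree_def power_mult_distrib prod.distrib power_sum)

text \<open>The coefficients of the restriction of \<open>w\<close> to the affine hyperplane at height \<open>1\<close>.\<close>

definition slice_coeff :: "'a::euclidean_space \<Rightarrow> nat \<Rightarrow> ('a \<Rightarrow> real) \<Rightarrow> ('a \<Rightarrow> nat) \<Rightarrow> real" where
  "slice_coeff \<nu> k w \<beta> = monomial_coeff \<nu> k \<beta> (\<lambda>\<xi>. w (\<xi> + \<nu>))"

text \<open>The expansion holds on the hyperplane at height \<open>1\<close>, and homogeneity carries it to the point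
  \<open>x\<close> at height \<open>x \<bullet> \<nu>\<close>.\<close>

lemma homogeneous_expansion:
  fixes \<nu> :: "'a::euclidean_space"
  assumes \<nu>: "\<nu> \<in> Basis" and w: "half_harmonic \<nu> w" and gr: "half_growth \<nu> \<alpha> w"
    and k: "\<alpha> < real k" "k > 0" and hom: "\<forall>r>0. \<forall>x. w (r *\<^sub>R x) = r powr \<alpha> * w x"
    and x: "0 < x \<bullet> \<nu>"
  shows "w x = (\<Sum>\<beta>\<in>exponents \<nu> k. slice_coeff \<nu> k w \<beta> * (x \<bullet> \<nu>) powr (\<alpha> - real (total_degree \<nu> \<beta>))
    * tangential_monomial \<nu> \<beta> x)"
proof -
  define s where "s = x \<bullet> \<nu>"
  have s: "s > 0" using x by (simp add: s_def)
  define y where "y = inverse s *\<^sub>R x"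
  have xy: "x = s *\<^sub>R y" using s by (simp add: y_def)
  have y\<nu>: "y \<bullet> \<nu> = 1" using s by (simp add: y_def s_def)
  have "w y = (\<Sum>\<beta>\<in>exponents \<nu> k. slice_coeff \<nu> k w \<beta> * tangential_monomial \<nu> \<beta> y)"
    using monomial_expansion[OF \<nu> half_harmonic_interpolation[OF \<nu> w gr k], of y]
    by (simp add: y\<nu> slice_coeff_def)
  then have "w x = (\<Sum>\<beta>\<in>exponents \<nu> k. s powr \<alpha> * (slice_coeff \<nu> k w \<beta> * tangential_monomial \<nu> \<beta> y))"
    unfolding xy hom[rule_format, OF s] by (simp add: sum_distrib_left)
  also have "\<dots> = (\<Sum>\<beta>\<in>exponents \<nu> k. slice_coeff \<nu> k w \<beta> * s powr (\<alpha> - real (total_degree \<nu> \<beta>))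
    * tangential_monomial \<nu> \<beta> x)"
  proof (intro sum.cong refl)
    fix \<beta>
    have "s powr (\<alpha> - real (total_degree \<nu> \<beta>)) * s ^ total_degree \<nu> \<beta> = s powr \<alpha>"
      using s by (simp add: powr_diff powr_realpow)
    then show "s powr \<alpha> * (slice_coeff \<nu> k w \<beta> * tangential_monomial \<nu> \<beta> y)
      = slice_coeff \<nu> k w \<beta> * s powr (\<alpha> - real (total_degree \<nu> \<beta>)) * tangential_monomial \<nu> \<beta> x"
      unfolding xy tangential_monomial_scale by (simp add: mult_ac)
  qed
  finally show ?thesis by (simp add: s_def)
qed

lemma tangential_monomial_normal:
  "\<nu> \<in> Basis \<Longrightarrow> tangential_monomial \<nu> \<beta> (x + s *\<^sub>R \<nu>) = tangential_monomial \<nu> \<beta> x"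
  unfolding tangential_monomial_def by (intro prod.cong refl) (auto simp: inner_add_left inner_Basis)

text \<open>The coefficient at height \<open>s\<close> is \<open>c\<^sub>\<beta> s\<^bsup>\<alpha> - |\<beta>|\<^esup>\<close>.  It tends to \<open>0\<close> as \<open>s\<close> decreases to
  \<open>0\<close>, because \<open>w\<close> vanishes on the boundary, but for a nonpositive exponent its modulus is at
  least \<open>|c\<^sub>\<beta>|\<close> as soon as \<open>s \<le> 1\<close>.\<close>

lemma slice_coeff_high_degree_zero:
  fixes \<nu> :: "'a::euclidean_space"
  assumes \<nu>: "\<nu> \<in> Basis" and w: "half_harmonic \<nu> w" and gr: "half_growth \<nu> \<alpha> w"
    and k: "\<alpha> < real k" "k > 0" and hom: "\<forall>r>0. \<forall>x. w (r *\<^sub>R x) = r powr \<alpha> * w x"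
    and \<beta>: "\<beta> \<in> exponents \<nu> k" "\<alpha> \<le> real (total_degree \<nu> \<beta>)"
  shows "slice_coeff \<nu> k w \<beta> = 0"
proof -
  define C where "C = (\<lambda>s. monomial_coeff \<nu> k \<beta> (\<lambda>\<xi>. w (\<xi> + s *\<^sub>R \<nu>)))"
  have C: "C s = slice_coeff \<nu> k w \<beta> * s powr (\<alpha> - real (total_degree \<nu> \<beta>))" if s: "s > 0" for s
  proof -
    have g: "(grid_point \<nu> p + s *\<^sub>R \<nu>) \<bullet> \<nu> = s" for p
      using \<nu> by (simp add: inner_add_left grid_point_normal)
    have "C s = monomial_coeff \<nu> k \<beta> (\<lambda>\<xi>. \<Sum>\<gamma>\<in>exponents \<nu> k. (slice_coeff \<nu> k w \<gamma> * s powr (\<alpha> - real (total_degree \<nu> \<gamma>)))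
      * tangential_monomial \<nu> \<gamma> \<xi>)"
      unfolding C_def
      by (rule monomial_coeff_cong)
         (subst homogeneous_expansion[OF \<nu> w gr k hom],
          simp_all add: g s tangential_monomial_normal[OF \<nu>])
    also have "\<dots> = (\<Sum>\<gamma>\<in>exponents \<nu> k. if \<gamma> = \<beta> then slice_coeff \<nu> k w \<gamma> * s powr (\<alpha> - real (total_degree \<nu> \<gamma>)) else 0)"
      unfolding monomial_coeff_sum[OF finite_exponents] monomial_coeff_cmult
      by (intro sum.cong refl) (simp add: monomial_coeff_monomial[OF \<beta>(1)])
    finally show ?thesis using \<beta>(1) by simp
  qed
  have "(C \<longlongrightarrow> 0) (at_right 0)"
  proof -
    have c: "continuous_on {x. 0 \<le> x \<bullet> \<nu>} w" using w by (simp add: half_harmonic_def)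
    have "((\<lambda>s. w (grid_point \<nu> p + s *\<^sub>R \<nu>)) \<longlongrightarrow> 0) (at_right 0)" for p
    proof -
      have "continuous_on {0..} (\<lambda>s. w (grid_point \<nu> p + s *\<^sub>R \<nu>))"
        by (rule continuous_on_compose2[OF c])
           (use \<nu> in \<open>auto intro!: continuous_intros simp: inner_add_left grid_point_normal\<close>)
      then have "((\<lambda>s. w (grid_point \<nu> p + s *\<^sub>R \<nu>)) \<longlongrightarrow> w (grid_point \<nu> p + 0 *\<^sub>R \<nu>)) (at 0 within {0..})"
        unfolding continuous_on_def by (rule bspec) simp
      moreover have "w (grid_point \<nu> p + 0 *\<^sub>R \<nu>) = 0"
        using w \<nu> by (simp add: half_harmonic_def grid_point_normal)
      ultimately have "((\<lambda>s. w (grid_point \<nu> p + s *\<^sub>R \<nu>)) \<longlongrightarrow> 0) (at 0 within {0..})" by (simp only:)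
      then show ?thesis by (rule tendsto_within_subset) auto
    qed
    then have "(C \<longlongrightarrow> (\<Sum>p\<in>exponents \<nu> k. (\<Prod>b\<in>tangents \<nu>. coeff (lagrange_poly k (p b)) (\<beta> b)) * 0)) (at_right 0)"
      unfolding C_def monomial_coeff_def by (intro tendsto_intros)
    then show ?thesis by simp
  qed
  then have "((\<lambda>s. \<bar>C s\<bar>) \<longlongrightarrow> \<bar>0\<bar>) (at_right 0)" by (rule tendsto_rabs)
  moreover have "\<forall>\<^sub>F s in at_right 0. \<bar>slice_coeff \<nu> k w \<beta>\<bar> \<le> \<bar>C s\<bar>"
    using eventually_at_right_real[OF zero_less_one]
  proof eventually_elim
    case (elim s)
    then have s: "0 < s" "s \<le> 1" by auto
    have "1 \<le> s powr (\<alpha> - real (total_degree \<nu> \<beta>))"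
      using s \<beta>(2) powr_mono_both'[of "\<alpha> - real (total_degree \<nu> \<beta>)" 0 s s] powr_mono'[of "\<alpha> - real (total_degree \<nu> \<beta>)" 0 s] by simp
    then show ?case using C[OF s(1)] mult_left_mono[of 1 _ "\<bar>slice_coeff \<nu> k w \<beta>\<bar>"] by (simp add: abs_mult)
  qed
  ultimately have "\<bar>slice_coeff \<nu> k w \<beta>\<bar> \<le> \<bar>0\<bar>" by (rule tendsto_lowerbound) simp
  then show ?thesis by simp
qed

lemma jet2_power: "jet2 (\<lambda>t. (s + t) ^ n) (real n * s ^ (n - 1)) (real (n * (n - 1)) * s ^ (n - 2))"
proof (rule jet2I[where g = "\<lambda>t. real n * (s + t) ^ (n - 1)"])
  have d: "((\<lambda>t. (s + t) ^ m) has_real_derivative real m * (s + t) ^ (m - 1)) (at t)" for m t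
    by (auto intro!: derivative_eq_intros)
  show "\<forall>\<^sub>F t in nhds 0. ((\<lambda>t. (s + t) ^ n) has_real_derivative real n * (s + t) ^ (n - 1)) (at t)"
    by (intro always_eventually allI d)
  have "n - 1 - 1 = n - 2" by simp
  then show "((\<lambda>t. real n * (s + t) ^ (n - 1)) has_real_derivative real (n * (n - 1)) * s ^ (n - 2)) (at 0)"
    using DERIV_cmult[OF d[of "n - 1" 0], of "real n"] by (simp add: mult.assoc)
qed simp

lemma jet2_powr_shift: "jet2 (\<lambda>t. (1 + t) powr e) e (e * (e - 1))"
proof (rule jet2I[where g = "\<lambda>t. e * (1 + t) powr (e - 1)"])
  have d: "((\<lambda>t. (1 + t) powr c) has_real_derivative c * (1 + t) powr (c - 1)) (at t)" if "-1 < t" for c t :: real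
    using that by (auto intro!: derivative_eq_intros)
  have "\<forall>\<^sub>F t::real in nhds 0. - 1 < t" by (rule order_tendstoD(1)[OF filterlim_ident]) simp
  then show "\<forall>\<^sub>F t in nhds 0. ((\<lambda>t. (1 + t) powr e) has_real_derivative e * (1 + t) powr (e - 1)) (at t)"
    by eventually_elim (rule d)
  show "((\<lambda>t. e * (1 + t) powr (e - 1)) has_real_derivative e * (e - 1)) (at 0)"
    using DERIV_cmult[OF d[of 0 "e - 1"], of e] by simp
qed simp

lemma jet2_tangential_monomial:
  assumes b: "b \<in> tangents \<nu>"
  shows "\<exists>p. jet2 (\<lambda>t. tangential_monomial \<nu> \<gamma> (x + t *\<^sub>R b)) p
    (real (\<gamma> b * (\<gamma> b - 1)) * tangential_monomial \<nu> (\<gamma>(b := \<gamma> b - 2)) x)"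
proof -
  define R where "R = (\<Prod>c\<in>tangents \<nu> - {b}. (x \<bullet> c) ^ \<gamma> c)"
  have split: "tangential_monomial \<nu> \<delta> y = (y \<bullet> b) ^ \<delta> b * (\<Prod>c\<in>tangents \<nu> - {b}. (y \<bullet> c) ^ \<delta> c)" for \<delta> y
    unfolding tangential_monomial_def using b by (intro prod.remove) auto
  have 1: "tangential_monomial \<nu> \<gamma> (x + t *\<^sub>R b) = R * (x \<bullet> b + t) ^ \<gamma> b" for t
  proof -
    have "(\<Prod>c\<in>tangents \<nu> - {b}. ((x + t *\<^sub>R b) \<bullet> c) ^ \<gamma> c) = R"
      unfolding R_def using b by (intro prod.cong refl) (auto simp: inner_add_left inner_Basis)
    then show ?thesis unfolding split using b by (simp add: inner_add_left)
  qed
  have 2: "tangential_monomial \<nu> (\<gamma>(b := \<gamma> b - 2)) x = R * (x \<bullet> b) ^ (\<gamma> b - 2)"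
  proof -
    have "(\<Prod>c\<in>tangents \<nu> - {b}. (x \<bullet> c) ^ (\<gamma>(b := \<gamma> b - 2)) c) = R"
      unfolding R_def by (intro prod.cong refl) auto
    then show ?thesis unfolding split by simp
  qed
  show ?thesis unfolding 1 2
    using jet2_cmult[OF jet2_power[of "x \<bullet> b" "\<gamma> b"], of R] by (auto simp: mult_ac)
qed

text \<open>The vanishing of the coefficients of high degree and the recursion that the Laplace equation
  imposes on the others.  In the recursion for \<open>\<beta>\<close> the derivative normal to the boundary gives
  the first term, and the second derivative in the direction \<open>b\<close> gives the sum over the exponents
  \<open>\<gamma>\<close> that are \<open>\<beta>\<close> raised by \<open>2\<close> at \<open>b\<close>; where the subtraction of natural numbers truncates,
  the factor \<open>\<gamma> b (\<gamma> b - 1)\<close> is zero.\<close>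

definition harmonic_coeffs :: "'a::euclidean_space \<Rightarrow> nat \<Rightarrow> real \<Rightarrow> (('a \<Rightarrow> nat) \<Rightarrow> real) \<Rightarrow> bool" where
  "harmonic_coeffs \<nu> k \<alpha> c \<longleftrightarrow>
     (\<forall>\<beta>\<in>exponents \<nu> k. \<alpha> \<le> real (total_degree \<nu> \<beta>) \<longrightarrow> c \<beta> = 0) \<and>
     (\<forall>\<beta>\<in>exponents \<nu> k.
        c \<beta> * ((\<alpha> - real (total_degree \<nu> \<beta>)) * (\<alpha> - real (total_degree \<nu> \<beta>) - 1))
        + (\<Sum>b\<in>tangents \<nu>. \<Sum>\<gamma>\<in>exponents \<nu> k. c \<gamma> * (if \<gamma>(b := \<gamma> b - 2) = \<beta> then real (\<gamma> b * (\<gamma> b - 1)) else 0)) = 0)"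

lemma harmonic_coeffs_slice_coeff:
  fixes \<nu> :: "'a::euclidean_space"
  assumes \<nu>: "\<nu> \<in> Basis" and w: "half_harmonic \<nu> w" and gr: "half_growth \<nu> \<alpha> w"
    and k: "\<alpha> < real k" "k > 0" and hom: "\<forall>r>0. \<forall>x. w (r *\<^sub>R x) = r powr \<alpha> * w x"
  shows "harmonic_coeffs \<nu> k \<alpha> (slice_coeff \<nu> k w)"
  unfolding harmonic_coeffs_def
proof (intro conjI ballI impI)
  fix \<beta> assume "\<beta> \<in> exponents \<nu> k" "\<alpha> \<le> real (total_degree \<nu> \<beta>)"
  then show "slice_coeff \<nu> k w \<beta> = 0" by (rule slice_coeff_high_degree_zero[OF \<nu> w gr k hom])
next
  fix \<beta> assume \<beta>: "\<beta> \<in> exponents \<nu> k"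
  let ?E = "exponents \<nu> k" and ?T = "tangents \<nu>"
  let ?m = "tangential_monomial \<nu>"
  define c where "c = slice_coeff \<nu> k w"
  define e where "e = (\<lambda>\<gamma>. \<alpha> - real (total_degree \<nu> \<gamma>))"
  have exp: "w x = (\<Sum>\<gamma>\<in>?E. c \<gamma> * (x \<bullet> \<nu>) powr e \<gamma> * ?m \<gamma> x)" if "0 < x \<bullet> \<nu>" for x
    unfolding c_def e_def by (rule homogeneous_expansion[OF \<nu> w gr k hom that])
  have \<nu>\<nu>: "\<nu> \<bullet> \<nu> = 1" using \<nu> by simp
  have lap: "(\<Sum>\<gamma>\<in>?E. (c \<gamma> * (e \<gamma> * (e \<gamma> - 1))) * ?m \<gamma> x)
      + (\<Sum>b\<in>?T. \<Sum>\<gamma>\<in>?E. (c \<gamma> * real (\<gamma> b * (\<gamma> b - 1))) * ?m (\<gamma>(b := \<gamma> b - 2)) x) = 0"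
    if x: "x \<bullet> \<nu> = 0" for x
  proof -
    define y where "y = x + \<nu>"
    have y\<nu>: "y \<bullet> \<nu> = 1" by (simp add: y_def inner_add_left x \<nu>\<nu>)
    have m: "?m \<gamma> (x + \<nu>) = ?m \<gamma> x" for \<gamma> using tangential_monomial_normal[OF \<nu>, of \<gamma> x 1] by simp
    have "has_lap w y 0" using w y\<nu> by (simp add: half_harmonic_def)
    then obtain p q where pq: "\<And>b. b \<in> Basis \<Longrightarrow> jet2 (\<lambda>t. w (y + t *\<^sub>R b)) (p b) (q b)" "(\<Sum>b\<in>Basis. q b) = 0"
      unfolding has_lap_def by blast
    have "q \<nu> = (\<Sum>\<gamma>\<in>?E. (c \<gamma> * (e \<gamma> * (e \<gamma> - 1))) * ?m \<gamma> x)"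
    proof -
      have j: "jet2 (\<lambda>t. \<Sum>\<gamma>\<in>?E. (c \<gamma> * ?m \<gamma> x) * (1 + t) powr e \<gamma>)
        (\<Sum>\<gamma>\<in>?E. (c \<gamma> * ?m \<gamma> x) * e \<gamma>) (\<Sum>\<gamma>\<in>?E. (c \<gamma> * ?m \<gamma> x) * (e \<gamma> * (e \<gamma> - 1)))"
        by (intro jet2_sum jet2_cmult jet2_powr_shift finite_exponents)
      have "\<forall>\<^sub>F t::real in nhds 0. - 1 < t" by (rule order_tendstoD(1)[OF filterlim_ident]) simp
      then have "\<forall>\<^sub>F t in nhds 0. (\<Sum>\<gamma>\<in>?E. (c \<gamma> * ?m \<gamma> x) * (1 + t) powr e \<gamma>) = w (y + t *\<^sub>R \<nu>)"
      proof eventually_elim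
        case (elim t)
        have "(y + t *\<^sub>R \<nu>) \<bullet> \<nu> = 1 + t" by (simp add: inner_add_left y\<nu> \<nu>\<nu>)
        then show ?case using elim exp[of "y + t *\<^sub>R \<nu>"]
          by (simp add: tangential_monomial_normal[OF \<nu>] y_def m mult_ac)
      qed
      from jet2_unique(2)[OF pq(1)[OF \<nu>] jet2_cong_ev[OF j this]] show ?thesis by (simp add: mult_ac)
    qed
    moreover have "q b = (\<Sum>\<gamma>\<in>?E. (c \<gamma> * real (\<gamma> b * (\<gamma> b - 1))) * ?m (\<gamma>(b := \<gamma> b - 2)) x)" if b: "b \<in> ?T" for b
    proof -
      have bB: "b \<in> Basis" and b\<nu>: "b \<bullet> \<nu> = 0" using b \<nu> by (auto simp: inner_Basis)
      have "\<forall>\<gamma>. \<exists>p. jet2 (\<lambda>t. ?m \<gamma> (y + t *\<^sub>R b)) p (real (\<gamma> b * (\<gamma> b - 1)) * ?m (\<gamma>(b := \<gamma> b - 2)) y)"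
        using jet2_tangential_monomial[OF b] by blast
      from choice[OF this] obtain P where
        P: "\<And>\<gamma>. jet2 (\<lambda>t. ?m \<gamma> (y + t *\<^sub>R b)) (P \<gamma>) (real (\<gamma> b * (\<gamma> b - 1)) * ?m (\<gamma>(b := \<gamma> b - 2)) y)"
        by blast
      have "w (y + t *\<^sub>R b) = (\<Sum>\<gamma>\<in>?E. c \<gamma> * ?m \<gamma> (y + t *\<^sub>R b))" for t
        using exp[of "y + t *\<^sub>R b"] by (simp add: inner_add_left y\<nu> b\<nu>)
      then have "jet2 (\<lambda>t. w (y + t *\<^sub>R b)) (\<Sum>\<gamma>\<in>?E. c \<gamma> * P \<gamma>)
        (\<Sum>\<gamma>\<in>?E. c \<gamma> * (real (\<gamma> b * (\<gamma> b - 1)) * ?m (\<gamma>(b := \<gamma> b - 2)) y))"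
        by (simp only:) (intro jet2_sum jet2_cmult P finite_exponents)
      from jet2_unique(2)[OF pq(1)[OF bB] this] show ?thesis by (simp add: y_def m mult_ac)
    qed
    moreover have "(\<Sum>b\<in>Basis. q b) = q \<nu> + (\<Sum>b\<in>?T. q b)" using \<nu> by (simp add: sum.remove)
    ultimately show ?thesis using pq(2) by simp
  qed
  have "0 = monomial_coeff \<nu> k \<beta> (\<lambda>x. 0)" by (simp add: monomial_coeff_zero)
  also have "\<dots> = monomial_coeff \<nu> k \<beta> (\<lambda>x. (\<Sum>\<gamma>\<in>?E. (c \<gamma> * (e \<gamma> * (e \<gamma> - 1))) * ?m \<gamma> x)
      + (\<Sum>b\<in>?T. \<Sum>\<gamma>\<in>?E. (c \<gamma> * real (\<gamma> b * (\<gamma> b - 1))) * ?m (\<gamma>(b := \<gamma> b - 2)) x))"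
    by (rule monomial_coeff_cong) (rule lap[OF grid_point_normal[OF \<nu>], symmetric])
  also have "\<dots> = (\<Sum>\<gamma>\<in>?E. (c \<gamma> * (e \<gamma> * (e \<gamma> - 1))) * monomial_coeff \<nu> k \<beta> (?m \<gamma>))
      + (\<Sum>b\<in>?T. \<Sum>\<gamma>\<in>?E. (c \<gamma> * real (\<gamma> b * (\<gamma> b - 1))) * monomial_coeff \<nu> k \<beta> (?m (\<gamma>(b := \<gamma> b - 2))))"
    by (simp only: monomial_coeff_add monomial_coeff_sum[OF finite_exponents]
        monomial_coeff_sum[OF finite_Diff[OF finite_Basis]] monomial_coeff_cmult)
  also have "(\<Sum>\<gamma>\<in>?E. (c \<gamma> * (e \<gamma> * (e \<gamma> - 1))) * monomial_coeff \<nu> k \<beta> (?m \<gamma>)) = c \<beta> * (e \<beta> * (e \<beta> - 1))"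
  proof -
    have "(\<Sum>\<gamma>\<in>?E. (c \<gamma> * (e \<gamma> * (e \<gamma> - 1))) * monomial_coeff \<nu> k \<beta> (?m \<gamma>))
      = (\<Sum>\<gamma>\<in>?E. if \<gamma> = \<beta> then c \<gamma> * (e \<gamma> * (e \<gamma> - 1)) else 0)"
      by (intro sum.cong refl) (simp add: monomial_coeff_monomial[OF \<beta>])
    then show ?thesis using \<beta> by simp
  qed
  also have "(\<Sum>b\<in>?T. \<Sum>\<gamma>\<in>?E. (c \<gamma> * real (\<gamma> b * (\<gamma> b - 1))) * monomial_coeff \<nu> k \<beta> (?m (\<gamma>(b := \<gamma> b - 2))))
    = (\<Sum>b\<in>?T. \<Sum>\<gamma>\<in>?E. c \<gamma> * (if \<gamma>(b := \<gamma> b - 2) = \<beta> then real (\<gamma> b * (\<gamma> b - 1)) else 0))"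
  proof (intro sum.cong refl)
    fix b \<gamma> assume b: "b \<in> ?T" and \<gamma>: "\<gamma> \<in> ?E"
    then have "\<gamma> b - 2 < k" by (auto simp: exponents_def PiE_iff intro: less_imp_diff_less)
    then have "\<gamma>(b := \<gamma> b - 2) \<in> ?E" using b \<gamma> by (auto simp: exponents_def PiE_iff extensional_def)
    then show "(c \<gamma> * real (\<gamma> b * (\<gamma> b - 1))) * monomial_coeff \<nu> k \<beta> (?m (\<gamma>(b := \<gamma> b - 2)))
      = c \<gamma> * (if \<gamma>(b := \<gamma> b - 2) = \<beta> then real (\<gamma> b * (\<gamma> b - 1)) else 0)"
      by (simp add: monomial_coeff_monomial[OF \<beta>])
  qed
  finally show "slice_coeff \<nu> k w \<beta> * ((\<alpha> - real (total_degree \<nu> \<beta>)) * (\<alpha> - real (total_degree \<nu> \<beta>) - 1))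
        + (\<Sum>b\<in>?T. \<Sum>\<gamma>\<in>?E. slice_coeff \<nu> k w \<gamma> * (if \<gamma>(b := \<gamma> b - 2) = \<beta> then real (\<gamma> b * (\<gamma> b - 1)) else 0)) = 0"
    by (simp add: c_def e_def)
qed

text \<open>For a nonzero coefficient of maximal degree the recursion has no contribution of higher degree, so
  \<open>(\<alpha> - |\<beta>|) (\<alpha> - |\<beta>| - 1) = 0\<close>, and \<open>\<alpha> > |\<beta>|\<close>.\<close>

lemma harmonic_coeffs_leading:
  assumes c: "harmonic_coeffs \<nu> k \<alpha> c" and ne: "\<exists>\<beta>\<in>exponents \<nu> k. c \<beta> \<noteq> 0"
  shows "\<exists>\<beta>\<in>exponents \<nu> k. c \<beta> \<noteq> 0 \<and> \<alpha> = real (total_degree \<nu> \<beta>) + 1"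
proof -
  let ?E = "exponents \<nu> k"
  let ?S = "{\<beta>\<in>?E. c \<beta> \<noteq> 0}"
  have S: "finite ?S" "?S \<noteq> {}" using ne by auto
  have "Max (total_degree \<nu> ` ?S) \<in> total_degree \<nu> ` ?S" using S by (intro Max_in) auto
  then obtain \<beta> where \<beta>: "\<beta> \<in> ?E" "c \<beta> \<noteq> 0" and m: "total_degree \<nu> \<beta> = Max (total_degree \<nu> ` ?S)" by force
  have mx: "\<not> total_degree \<nu> \<beta> < total_degree \<nu> \<gamma>" if "\<gamma> \<in> ?S" for \<gamma>
    unfolding m not_less using S that by (intro Max_ge) auto
  have "(\<Sum>b\<in>tangents \<nu>. \<Sum>\<gamma>\<in>?E. c \<gamma> * (if \<gamma>(b := \<gamma> b - 2) = \<beta> then real (\<gamma> b * (\<gamma> b - 1)) else 0)) = 0"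
  proof (intro sum.neutral ballI)
    fix b \<gamma> assume b: "b \<in> tangents \<nu>" and \<gamma>: "\<gamma> \<in> ?E"
    show "c \<gamma> * (if \<gamma>(b := \<gamma> b - 2) = \<beta> then real (\<gamma> b * (\<gamma> b - 1)) else 0) = 0"
    proof (cases "\<gamma>(b := \<gamma> b - 2) = \<beta> \<and> \<gamma> b \<ge> 2")
      case True
      have "total_degree \<nu> \<delta> = \<delta> b + (\<Sum>a\<in>tangents \<nu> - {b}. \<delta> a)" for \<delta>
        unfolding total_degree_def using b by (intro sum.remove) auto
      moreover have "(\<Sum>a\<in>tangents \<nu> - {b}. \<beta> a) = (\<Sum>a\<in>tangents \<nu> - {b}. \<gamma> a)"
        using True by (intro sum.cong) auto
      moreover have "\<beta> b = \<gamma> b - 2" "\<gamma> b \<ge> 2" using True by auto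
      ultimately have "total_degree \<nu> \<beta> < total_degree \<nu> \<gamma>" by simp
      then have "c \<gamma> = 0" using mx[of \<gamma>] \<gamma> by auto
      then show ?thesis by simp
    next
      case False
      then have "\<gamma>(b := \<gamma> b - 2) \<noteq> \<beta> \<or> \<gamma> b = 0 \<or> \<gamma> b = 1" by linarith
      then show ?thesis by auto
    qed
  qed
  moreover have "c \<beta> * ((\<alpha> - real (total_degree \<nu> \<beta>)) * (\<alpha> - real (total_degree \<nu> \<beta>) - 1))
      + (\<Sum>b\<in>tangents \<nu>. \<Sum>\<gamma>\<in>?E. c \<gamma> * (if \<gamma>(b := \<gamma> b - 2) = \<beta> then real (\<gamma> b * (\<gamma> b - 1)) else 0)) = 0"
    using c \<beta>(1) unfolding harmonic_coeffs_def by blast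
  ultimately have "c \<beta> * ((\<alpha> - real (total_degree \<nu> \<beta>)) * (\<alpha> - real (total_degree \<nu> \<beta>) - 1)) = 0"
    by linarith
  moreover have "\<alpha> > real (total_degree \<nu> \<beta>)" using c \<beta> unfolding harmonic_coeffs_def by force
  ultimately have "\<alpha> = real (total_degree \<nu> \<beta>) + 1" using \<beta>(2) by simp
  then show ?thesis using \<beta> by blast
qed

section \<open>The polynomial inequality between levels and their Weyl bound\<close>

text \<open>Levels are counted from \<open>j = 0\<close>, so that \<open>j\<close> stands for \<open>l - 1\<close>.  The multiplicity is the
  number of monomials of degree \<open>j\<close> in \<open>d\<close> variables.\<close>

definition level_mult :: "nat \<Rightarrow> nat \<Rightarrow> nat" where
  "level_mult d j = (j + d - 1) choose j"

definition energy_level :: "nat \<Rightarrow> nat \<Rightarrow> real" where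
  "energy_level d j = real (Suc j) * real (j + d)"

lemma level_mult_eq_pochhammer:
  assumes "d \<ge> 1"
  shows "real (level_mult d j) = pochhammer (real (Suc j)) (d - 1) / fact (d - 1)"
proof -
  have "(j + d - 1) choose j = (j + d - 1) choose (d - 1)"
    using assms binomial_symmetric[of j "j + d - 1"] by simp
  then show ?thesis
    using assms by (simp add: level_mult_def binomial_gbinomial gbinomial_pochhammer' of_nat_diff add_ac)
qed

lemma pochhammer_shift:
  assumes "d \<ge> 1"
  shows "pochhammer (real k) d = real k * pochhammer (real (Suc k)) (d - 1)"
    and "pochhammer (real (Suc k)) d = (real k + real d) * pochhammer (real (Suc k)) (d - 1)"
proof -
  obtain n where n: "d = Suc n" using assms by (cases d) auto
  show "pochhammer (real k) d = real k * pochhammer (real (Suc k)) (d - 1)"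
    by (simp add: n pochhammer_rec add_ac)
  show "pochhammer (real (Suc k)) d = (real k + real d) * pochhammer (real (Suc k)) (d - 1)"
    by (simp add: n pochhammer_rec' add_ac)
qed

lemma sum_level_mult:
  assumes "d \<ge> 1"
  shows "fact d * (\<Sum>j<k. real (level_mult d j)) = pochhammer (real k) d"
proof (induction k)
  case 0
  then show ?case using assms by (simp add: pochhammer_0_left)
next
  case (Suc k)
  have "fact d = real d * fact (d - 1)" using assms by (simp add: fact_reduce)
  then show ?case
    using Suc pochhammer_shift[OF assms, of k] level_mult_eq_pochhammer[OF assms, of k]
    by (simp add: field_simps)
qed

text \<open>Telescoping: the right-hand side is \<open>0\<close> for \<open>k = 0\<close>, and its increments are the summands
  up to the constant factor.\<close>

lemma sum_level_mult_energy:
  assumes "d \<ge> 1"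
  shows "fact (d - 1) * (real d + 1) * (real d + 2)
           * (\<Sum>j<k. real (level_mult d j) * energy_level d j)
         = pochhammer (real k) d * (real k + real d) * ((real d + 1) * real k + 1)"
proof (induction k)
  case 0
  then show ?case using assms by (simp add: pochhammer_0_left)
next
  case (Suc k)
  define p where "p = pochhammer (real (Suc k)) (d - 1)"
  have 1: "fact (d - 1) * real (level_mult d k) = p"
    using level_mult_eq_pochhammer[OF assms, of k] by (simp add: p_def)
  define S where "S = (\<Sum>j<k. real (level_mult d j) * energy_level d j)"
  have "fact (d - 1) * (real d + 1) * (real d + 2) * (S + real (level_mult d k) * energy_level d k)
      = fact (d - 1) * (real d + 1) * (real d + 2) * S
        + (fact (d - 1) * real (level_mult d k)) * ((real d + 1) * (real d + 2) * energy_level d k)"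
    by (simp add: algebra_simps)
  also have "\<dots> = real k * p * (real k + real d) * ((real d + 1) * real k + 1)
        + p * ((real d + 1) * (real d + 2) * ((real k + 1) * (real k + real d)))"
    unfolding 1 Suc[folded S_def] pochhammer_shift(1)[OF assms, of k, folded p_def]
    by (simp add: energy_level_def add_ac)
  also have "\<dots> = ((real k + real d) * p) * (real (Suc k) + real d) * ((real d + 1) * real (Suc k) + 1)"
    by (simp add: algebra_simps)
  finally show ?case
    using pochhammer_shift(2)[OF assms, of k] by (simp add: S_def p_def)
qed

text \<open>The weighted inequality of the arithmetic and the geometric mean for \<open>s\<^bsup>d + 2\<^esup>\<close> and
  \<open>t\<^bsup>d + 2\<^esup>\<close>.  In each case the difference of the two sides is a square times a polynomial with
  nonnegative coefficients.\<close>

lemma weighted_am_gm_power: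
  fixes s t :: real
  assumes "d \<in> {3, 4, 5}" "s \<ge> 0" "t \<ge> 0"
  shows "(real d + 2) * s\<^sup>2 * t ^ d \<le> 2 * s ^ (d + 2) + real d * t ^ (d + 2)"
proof -
  consider "d = 3" | "d = 4" | "d = 5" using assms(1) by auto
  then show ?thesis
  proof cases
    case 1
    have "0 \<le> (s - t)\<^sup>2 * (2* s^3 + 4* s^2* t + 6* s* t^2 + 3* t^3)" using assms by simp
    also have "\<dots> = 2 * s^5 + 3 * t^5 - 5 * s^2 * t^3" by algebra
    finally show ?thesis using 1 by simp
  next
    case 2
    have "0 \<le> 2 * (s^2 - t^2)\<^sup>2 * (s^2 + 2* t^2)" by simp
    also have "\<dots> = 2 * s^6 + 4 * t^6 - 6 * s^2 * t^4" by algebra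
    finally show ?thesis using 2 by simp
  next
    case 3
    have "0 \<le> (s - t)\<^sup>2 * (2* s^5 + 4* s^4* t + 6* s^3* t^2 + 8* s^2* t^3 + 10* s* t^4 + 5* t^5)"
      using assms by simp
    also have "\<dots> = 2 * s^7 + 5 * t^7 - 7 * s^2 * t^5" by algebra
    finally show ?thesis using 3 by simp
  qed
qed

text \<open>Pairing the factors \<open>k + i\<close> and \<open>k + d - 1 - i\<close> writes the left-hand side as a product of \<open>d\<close>
  quadratic polynomials \<open>k\<^sup>2 + (d - 1) k + i (d - 1 - i)\<close>, which are compared with
  \<open>k\<^sup>2 + (d + 1 / (d + 1)) k + d / (d + 1)\<close> one by one.  For \<open>d = 5\<close> the middle factor is too
  large if \<open>k \<le> 2\<close>, and only the products compare.  The case \<open>k = 1\<close> reads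
  \<open>(d!)\<^sup>2 \<le> (d + 2)\<^sup>d\<close>, which is false for \<open>d = 6\<close>.\<close>

lemma pochhammer_square_le:
  assumes "d \<in> {3, 4, 5}" "k \<ge> 1"
  shows "(pochhammer (real k) d)\<^sup>2 \<le> ((real k + real d) * (real k + 1 / (real d + 1))) ^ d"
proof -
  define x where "x = real k"
  have x: "x \<ge> 1" using assms(2) by (simp add: x_def)
  consider "d = 3" | "d = 4" | "d = 5" "k = 1" | "d = 5" "k = 2" | "d = 5" "k \<ge> 3"
  proof -
    have "k = 1 \<or> k = 2 \<or> k \<ge> 3" using assms(2) by linarith
    then show ?thesis using assms(1) that by auto
  qed
  then show ?thesis
  proof cases
    case 1
    define b where "b = (x + 3) * (x + 1/4)"
    have b0: "b \<ge> 0" using x by (simp add: b_def)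
    have b: "x * (x + 2) \<le> b" "(x + 1)^2 \<le> b"
      using x by (simp_all add: b_def power2_eq_square algebra_simps)
    have "(pochhammer x 3)\<^sup>2 = (x * (x + 2)) * (x * (x + 2)) * (x + 1)^2"
      by (simp add: pochhammer_Suc numeral_eq_Suc algebra_simps)
    also have "\<dots> \<le> b * b * b" using b x b0 by (intro mult_mono) auto
    finally show ?thesis by (simp add: 1 b_def x_def power3_eq_cube)
  next
    case 2
    define b where "b = (x + 4) * (x + 1/5)"
    have b0: "b \<ge> 0" using x by (simp add: b_def)
    have b: "x * (x + 3) \<le> b" "(x + 1) * (x + 2) \<le> b"
      using x by (simp_all add: b_def power2_eq_square algebra_simps)
    have "(pochhammer x 4)\<^sup>2 = ((x * (x + 3)) * ((x + 1) * (x + 2)))^2"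
      by (simp add: pochhammer_Suc numeral_eq_Suc algebra_simps)
    also have "\<dots> \<le> (b * b)^2" using b x b0 by (intro power_mono mult_mono) auto
    also have "\<dots> = b ^ 4" by algebra
    finally show ?thesis by (simp add: 2 b_def x_def)
  next
    case 3
    then show ?thesis by (simp add: pochhammer_Suc numeral_eq_Suc)
  next
    case 4
    then show ?thesis by (simp add: pochhammer_Suc numeral_eq_Suc)
  next
    case 5
    have x: "x \<ge> 3" using 5 by (simp add: x_def)
    define b where "b = (x + 5) * (x + 1/6)"
    have b0: "b \<ge> 0" using x by (simp add: b_def)
    have b: "x * (x + 4) \<le> b" "(x + 1) * (x + 3) \<le> b" "(x + 2)^2 \<le> b"
      using x by (simp_all add: b_def power2_eq_square algebra_simps)
    have "(pochhammer x 5)\<^sup>2 = ((x * (x + 4)) * ((x + 1) * (x + 3)))^2 * (x + 2)^2"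
      by (simp add: pochhammer_Suc numeral_eq_Suc algebra_simps)
    also have "\<dots> \<le> (b * b)^2 * b" using b x b0 by (intro mult_mono power_mono) auto
    also have "\<dots> = b ^ 5" by algebra
    finally show ?thesis by (simp add: 5 b_def x_def)
  qed
qed

text \<open>With \<open>z = s\<^sup>2\<close> and \<open>P = t\<^sup>d\<close> the right-hand side, as a function of \<open>z\<close>, is bounded below by its
  tangent line at \<open>z = t\<^sup>2\<close>, whose slope is the number \<open>P / d!\<close> of eigenvalues.  The remaining
  inequality for the constant term is \<open>t\<^sup>2 \<le> B\<close>.\<close>

lemma riesz_sum_le:
  fixes z :: real
  assumes d: "d \<in> {3, 4, 5}" and z: "z \<ge> 0"
  shows "(\<Sum>j<k. real (level_mult d j) * (z - energy_level d j))
         \<le> 2 / ((real d + 2) * fact d) * z powr (1 + real d / 2)"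
proof (cases "k = 0")
  case True
  then show ?thesis using z by simp
next
  case False
  have d1: "d \<ge> 1" using d by auto
  define P where "P = pochhammer (real k) d"
  define B where "B = (real k + real d) * (real k + 1 / (real d + 1))"
  define t where "t = root d P"
  define s where "s = sqrt z"
  have P0: "P \<ge> 0" using False unfolding P_def by (intro less_imp_le pochhammer_pos) auto
  have t0: "t \<ge> 0" using P0 d1 by (simp add: t_def)
  have td: "t ^ d = P" using P0 d1 by (simp add: t_def)
  have s: "s \<ge> 0" "s\<^sup>2 = z" using z by (simp_all add: s_def)
  have B0: "B \<ge> 0" by (simp add: B_def)
  have "(t\<^sup>2) ^ d \<le> B ^ d"
    using pochhammer_square_le[OF d, of k] False td
    by (simp add: P_def B_def power_mult[symmetric] mult.commute)
       (simp add: power_mult)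
  then have tB: "t\<^sup>2 \<le> B" using d1 B0 by (simp add: power_mono_iff)
  have zp: "z powr (1 + real d / 2) = s ^ (d + 2)"
  proof (cases "z = 0")
    case False
    then have "s > 0" using z by (simp add: s_def)
    then have "s ^ (d + 2) = s powr real (d + 2)" by (simp only: powr_realpow)
    also have "\<dots> = z powr ((1/2) * real (d + 2))"
      using z by (simp add: s_def powr_half_sqrt[symmetric] powr_powr)
    finally show ?thesis by (simp add: field_simps)
  qed (simp add: s_def)
  define N where "N = (\<Sum>j<k. real (level_mult d j))"
  define S where "S = (\<Sum>j<k. real (level_mult d j) * energy_level d j)"
  have Bd: "(real d + 1) * B = (real k + real d) * ((real d + 1) * real k + 1)"
  proof -
    have "(real d + 1) * B = (real k + real d) * ((real d + 1) * (real k + 1 / (real d + 1)))"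
      unfolding B_def by (rule mult.left_commute)
    then show ?thesis by (simp add: distrib_left[of "real d + 1"])
  qed
  have F: "fact d = real d * fact (d - 1)" using d1 by (simp add: fact_reduce)
  have N: "fact d * N = P" using sum_level_mult[OF d1, of k] by (simp add: N_def P_def)
  have "fact d * (real d + 1) * (real d + 2) * S = real d * (fact (d - 1) * (real d + 1) * (real d + 2) * S)"
    by (simp add: F)
  also have "\<dots> = real d * (P * (real k + real d) * ((real d + 1) * real k + 1))"
    using sum_level_mult_energy[OF d1, of k] by (simp add: S_def P_def)
  also have "\<dots> = real d * P * ((real d + 1) * B)" unfolding Bd by (simp only: mult.assoc)
  finally have "(real d + 1) * (fact d * (real d + 2) * S) = (real d + 1) * (real d * P * B)"
    by (simp only: mult_ac)
  then have S: "fact d * (real d + 2) * S = real d * P * B"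
    by (subst (asm) mult_left_cancel) simp_all
  have "t ^ (d + 2) = P * t\<^sup>2" by (simp only: power_add td)
  then have "(real d + 2) * s\<^sup>2 * P \<le> 2 * s ^ (d + 2) + real d * (P * t\<^sup>2)"
    using weighted_am_gm_power[OF d s(1) t0] by (simp only: td)
  also have "\<dots> \<le> 2 * s ^ (d + 2) + real d * (P * B)"
    using tB P0 by (intro add_left_mono mult_left_mono) auto
  finally have young: "(real d + 2) * z * P \<le> 2 * s ^ (d + 2) + real d * P * B"
    by (simp only: s(2) mult.assoc)
  define c where "c = (real d + 2) * fact d"
  have c: "c > 0" unfolding c_def by (intro mult_pos_pos) auto
  have "c * (z * N - S) = (real d + 2) * z * (fact d * N) - fact d * (real d + 2) * S"
    unfolding c_def right_diff_distrib by (simp only: mult_ac)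
  also have "\<dots> \<le> 2 * s ^ (d + 2)" unfolding N S using young by linarith
  finally have "(z * N - S) * c \<le> 2 * s ^ (d + 2)" by (simp only: mult.commute)
  then have "z * N - S \<le> 2 * s ^ (d + 2) / c" using c by (simp only: pos_le_divide_eq)
  then have "z * N - S \<le> 2 / c * s ^ (d + 2)" by simp
  moreover have "(\<Sum>j<k. real (level_mult d j) * (z - energy_level d j)) = z * N - S"
    by (simp add: N_def S_def right_diff_distrib sum_subtractf sum_distrib_left mult.commute)
  ultimately show ?thesis by (simp add: zp c_def)
qed

section \<open>Eigenvalues and multiplicities of the hemisphere\<close>

text \<open>A basis of \<open>S\<close> is mapped injectively to linearly independent functions supported in \<open>Y\<close>.\<close>

lemma subspace_spanned_via_injection:
  fixes S :: "('a \<Rightarrow> real) set" and T :: "('a \<Rightarrow> real) \<Rightarrow> ('i \<Rightarrow> real)"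
  assumes S: "fun_vs.subspace S"
    and add: "\<And>f g. T (f + g) = T f + T g" and scale: "\<And>c f. T (fun_scale c f) = fun_scale c (T f)"
    and Y: "finite Y" "\<And>f i. f \<in> S \<Longrightarrow> i \<notin> Y \<Longrightarrow> T f i = 0"
    and inj: "\<And>f. f \<in> S \<Longrightarrow> T f = 0 \<Longrightarrow> f = 0"
  obtains W where "finite W" "card W \<le> card Y" "S \<subseteq> fun_vs.span W"
proof -
  interpret vp: vector_space_pair "fun_scale :: real \<Rightarrow> ('a \<Rightarrow> real) \<Rightarrow> _" "fun_scale :: real \<Rightarrow> ('i \<Rightarrow> real) \<Rightarrow> _"
    by (intro vector_space_pair.intro fun_vs.vector_space_axioms)
  have lin: "Vector_Spaces.linear fun_scale fun_scale T"
    unfolding Vector_Spaces.linear_iff by (intro conjI allI fun_vs.vector_space_axioms add scale)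
  obtain B where B: "B \<subseteq> S" "fun_vs.independent B" "S \<subseteq> fun_vs.span B" "card B = fun_vs.dim S"
    by (rule fun_vs.basis_exists)
  have BS: "fun_vs.span B \<subseteq> S" using B(1) S by (rule fun_vs.span_minimal)
  have injB: "inj_on T (fun_vs.span B)"
    unfolding vp.linear_inj_on_iff_eq_0[OF lin fun_vs.subspace_span] using inj BS by blast
  define e :: "'i \<Rightarrow> 'i \<Rightarrow> real" where "e = (\<lambda>i j. if j = i then 1 else 0)"
  have "T ` B \<subseteq> fun_vs.span (e ` Y)"
  proof safe
    fix f assume f: "f \<in> B"
    have eq: "T f = (\<Sum>i\<in>Y. fun_scale (T f i) (e i))"
    proof
      fix j
      have "(\<Sum>i\<in>Y. fun_scale (T f i) (e i)) j = (\<Sum>i\<in>Y. T f i * e i j)"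
        using Y(1) by (induction Y rule: finite_induct) auto
      also have "\<dots> = (\<Sum>i\<in>Y. if i = j then T f i else 0)" by (intro sum.cong) (auto simp: e_def)
      also have "\<dots> = T f j" using Y f B(1) by auto
      finally show "T f j = (\<Sum>i\<in>Y. fun_scale (T f i) (e i)) j" by simp
    qed
    show "T f \<in> fun_vs.span (e ` Y)"
      by (subst eq) (intro fun_vs.span_sum fun_vs.span_scale fun_vs.span_base imageI)
  qed
  moreover have "fun_vs.independent (T ` B)"
    by (rule vp.linear_independent_injective_image[OF lin B(2) injB])
  ultimately have "finite (T ` B) \<and> card (T ` B) \<le> card (e ` Y)"
    by (intro fun_vs.independent_span_bound) (use Y in auto)
  moreover have "inj_on T B" using injB by (rule inj_on_subset) (auto intro: fun_vs.span_base)
  ultimately have "finite B" "card B \<le> card Y"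
    using card_image_le[OF Y(1), of e] by (auto dest: finite_imageD simp: card_image)
  then show ?thesis using that B(3) by blast
qed

text \<open>The functions on the hemisphere that are given by their expansion, with coefficients that solve the
  recursion.  Unlike the eigenspace, this is visibly a linear subspace, since the coefficients depend
  linearly on \<open>u\<close> for all functions \<open>u\<close>.\<close>

definition spherical_poly_space :: "'a::euclidean_space \<Rightarrow> nat \<Rightarrow> real \<Rightarrow> ('a \<Rightarrow> real) set" where
  "spherical_poly_space \<nu> k \<alpha> = {u. harmonic_coeffs \<nu> k \<alpha> (slice_coeff \<nu> k (cone_ext \<alpha> u)) \<and>
     (\<forall>x. u x = (if x \<in> upper_sphere \<nu> then \<Sum>\<beta>\<in>exponents \<nu> k. slice_coeff \<nu> k (cone_ext \<alpha> u) \<beta>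
        * ((x \<bullet> \<nu>) powr (\<alpha> - real (total_degree \<nu> \<beta>)) * tangential_monomial \<nu> \<beta> x) else 0))}"

lemma slice_coeff_cone_ext_add:
  "slice_coeff \<nu> k (cone_ext \<alpha> (f + g)) \<beta> = slice_coeff \<nu> k (cone_ext \<alpha> f) \<beta> + slice_coeff \<nu> k (cone_ext \<alpha> g) \<beta>"
  by (simp add: slice_coeff_def cone_ext_def distrib_left monomial_coeff_add)

lemma slice_coeff_cone_ext_scale:
  "slice_coeff \<nu> k (cone_ext \<alpha> (fun_scale a f)) \<beta> = a * slice_coeff \<nu> k (cone_ext \<alpha> f) \<beta>"
  unfolding slice_coeff_def monomial_coeff_cmult[symmetric] cone_ext_def by (simp only: mult.left_commute)

lemma slice_coeff_cone_ext_zero: "slice_coeff \<nu> k (cone_ext \<alpha> 0) \<beta> = 0"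
  by (simp add: slice_coeff_def cone_ext_def monomial_coeff_zero)

lemma harmonic_coeffs_add:
  assumes "harmonic_coeffs \<nu> k \<alpha> c" "harmonic_coeffs \<nu> k \<alpha> c'"
  shows "harmonic_coeffs \<nu> k \<alpha> (\<lambda>\<beta>. c \<beta> + c' \<beta>)"
  unfolding harmonic_coeffs_def distrib_right sum.distrib
proof (intro conjI ballI impI)
  fix \<beta> assume "\<beta> \<in> exponents \<nu> k" "\<alpha> \<le> real (total_degree \<nu> \<beta>)"
  then show "c \<beta> + c' \<beta> = 0" using assms unfolding harmonic_coeffs_def by simp
next
  fix \<beta> assume \<beta>: "\<beta> \<in> exponents \<nu> k"
  have "c \<beta> * ((\<alpha> - real (total_degree \<nu> \<beta>)) * (\<alpha> - real (total_degree \<nu> \<beta>) - 1))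
      + (\<Sum>b\<in>tangents \<nu>. \<Sum>\<gamma>\<in>exponents \<nu> k. c \<gamma> * (if \<gamma>(b := \<gamma> b - 2) = \<beta> then real (\<gamma> b * (\<gamma> b - 1)) else 0)) = 0"
    using assms(1) \<beta> unfolding harmonic_coeffs_def by blast
  moreover have "c' \<beta> * ((\<alpha> - real (total_degree \<nu> \<beta>)) * (\<alpha> - real (total_degree \<nu> \<beta>) - 1))
      + (\<Sum>b\<in>tangents \<nu>. \<Sum>\<gamma>\<in>exponents \<nu> k. c' \<gamma> * (if \<gamma>(b := \<gamma> b - 2) = \<beta> then real (\<gamma> b * (\<gamma> b - 1)) else 0)) = 0"
    using assms(2) \<beta> unfolding harmonic_coeffs_def by blast
  ultimately show "c \<beta> * ((\<alpha> - real (total_degree \<nu> \<beta>)) * (\<alpha> - real (total_degree \<nu> \<beta>) - 1)) +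
     c' \<beta> * ((\<alpha> - real (total_degree \<nu> \<beta>)) * (\<alpha> - real (total_degree \<nu> \<beta>) - 1)) +
     ((\<Sum>b\<in>tangents \<nu>. \<Sum>\<gamma>\<in>exponents \<nu> k. c \<gamma> * (if \<gamma>(b := \<gamma> b - 2) = \<beta> then real (\<gamma> b * (\<gamma> b - 1)) else 0)) +
      (\<Sum>b\<in>tangents \<nu>. \<Sum>\<gamma>\<in>exponents \<nu> k. c' \<gamma> * (if \<gamma>(b := \<gamma> b - 2) = \<beta> then real (\<gamma> b * (\<gamma> b - 1)) else 0))) = 0"
    by linarith
qed

lemma harmonic_coeffs_scale:
  assumes "harmonic_coeffs \<nu> k \<alpha> c"
  shows "harmonic_coeffs \<nu> k \<alpha> (\<lambda>\<beta>. a * c \<beta>)"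
  unfolding harmonic_coeffs_def mult.assoc sum_distrib_left[symmetric] distrib_left[symmetric]
  using assms unfolding harmonic_coeffs_def by simp

lemma subspace_spherical_poly_space: "fun_vs.subspace (spherical_poly_space \<nu> k \<alpha>)"
proof (rule fun_vs.subspaceI)
  show "0 \<in> spherical_poly_space \<nu> k \<alpha>"
    by (simp add: spherical_poly_space_def harmonic_coeffs_def slice_coeff_cone_ext_zero)
next
  fix f g assume "f \<in> spherical_poly_space \<nu> k \<alpha>" "g \<in> spherical_poly_space \<nu> k \<alpha>"
  then have f: "harmonic_coeffs \<nu> k \<alpha> (slice_coeff \<nu> k (cone_ext \<alpha> f))"
    "\<And>x. f x = (if x \<in> upper_sphere \<nu> then \<Sum>\<beta>\<in>exponents \<nu> k. slice_coeff \<nu> k (cone_ext \<alpha> f) \<beta>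
        * ((x \<bullet> \<nu>) powr (\<alpha> - real (total_degree \<nu> \<beta>)) * tangential_monomial \<nu> \<beta> x) else 0)"
   and g: "harmonic_coeffs \<nu> k \<alpha> (slice_coeff \<nu> k (cone_ext \<alpha> g))"
    "\<And>x. g x = (if x \<in> upper_sphere \<nu> then \<Sum>\<beta>\<in>exponents \<nu> k. slice_coeff \<nu> k (cone_ext \<alpha> g) \<beta>
        * ((x \<bullet> \<nu>) powr (\<alpha> - real (total_degree \<nu> \<beta>)) * tangential_monomial \<nu> \<beta> x) else 0)"
    unfolding spherical_poly_space_def by blast+
  have "harmonic_coeffs \<nu> k \<alpha> (slice_coeff \<nu> k (cone_ext \<alpha> (f + g)))"
    using harmonic_coeffs_add[OF f(1) g(1)] by (simp only: slice_coeff_cone_ext_add[symmetric])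
  then show "f + g \<in> spherical_poly_space \<nu> k \<alpha>"
    unfolding spherical_poly_space_def mem_Collect_eq slice_coeff_cone_ext_add plus_fun_apply
  proof (intro conjI allI)
    fix x
    show "f x + g x = (if x \<in> upper_sphere \<nu> then \<Sum>\<beta>\<in>exponents \<nu> k.
        (slice_coeff \<nu> k (cone_ext \<alpha> f) \<beta> + slice_coeff \<nu> k (cone_ext \<alpha> g) \<beta>)
        * ((x \<bullet> \<nu>) powr (\<alpha> - real (total_degree \<nu> \<beta>)) * tangential_monomial \<nu> \<beta> x) else 0)"
      by (simp add: f(2)[of x] g(2)[of x] distrib_right sum.distrib)
  qed
next
  fix a f assume "f \<in> spherical_poly_space \<nu> k \<alpha>"
  then have f: "harmonic_coeffs \<nu> k \<alpha> (slice_coeff \<nu> k (cone_ext \<alpha> f))"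
    "\<And>x. f x = (if x \<in> upper_sphere \<nu> then \<Sum>\<beta>\<in>exponents \<nu> k. slice_coeff \<nu> k (cone_ext \<alpha> f) \<beta>
        * ((x \<bullet> \<nu>) powr (\<alpha> - real (total_degree \<nu> \<beta>)) * tangential_monomial \<nu> \<beta> x) else 0)"
    unfolding spherical_poly_space_def by blast+
  have "harmonic_coeffs \<nu> k \<alpha> (slice_coeff \<nu> k (cone_ext \<alpha> (fun_scale a f)))"
    using harmonic_coeffs_scale[OF f(1), of a] by (simp only: slice_coeff_cone_ext_scale[symmetric])
  then show "fun_scale a f \<in> spherical_poly_space \<nu> k \<alpha>"
    unfolding spherical_poly_space_def mem_Collect_eq slice_coeff_cone_ext_scale
  proof (intro conjI allI)
    fix x
    show "a * f x = (if x \<in> upper_sphere \<nu> then \<Sum>\<beta>\<in>exponents \<nu> k.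
        (a * slice_coeff \<nu> k (cone_ext \<alpha> f) \<beta>)
        * ((x \<bullet> \<nu>) powr (\<alpha> - real (total_degree \<nu> \<beta>)) * tangential_monomial \<nu> \<beta> x) else 0)"
      by (simp add: f(2)[of x] mult.assoc sum_distrib_left)
  qed
qed

lemma eigenspace_subset_spherical_poly_space:
  fixes \<nu> :: "'a::euclidean_space"
  assumes \<nu>: "\<nu> \<in> Basis" and \<alpha>: "\<alpha> > 0" "\<alpha> < real k" and \<mu>: "\<mu> = \<alpha> * (\<alpha> + real DIM('a) - 2)"
  shows "dirichlet_eigenspace (upper_sphere \<nu>) \<mu> \<subseteq> spherical_poly_space \<nu> k \<alpha>"
proof
  fix u assume u: "u \<in> dirichlet_eigenspace (upper_sphere \<nu>) \<mu>"
  have k: "k > 0" using \<alpha> by (cases k) auto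
  have w: "half_harmonic \<nu> (cone_ext \<alpha> u)" by (rule cone_ext_half_harmonic[OF \<nu> u \<alpha>(1) \<mu>])
  have gr: "half_growth \<nu> \<alpha> (cone_ext \<alpha> u)" by (rule cone_ext_growth[OF u \<alpha>(1)])
  have hom: "\<forall>r>0. \<forall>x. cone_ext \<alpha> u (r *\<^sub>R x) = r powr \<alpha> * cone_ext \<alpha> u x"
    by (simp add: cone_ext_homogeneous)
  have "u x = (if x \<in> upper_sphere \<nu> then \<Sum>\<beta>\<in>exponents \<nu> k. slice_coeff \<nu> k (cone_ext \<alpha> u) \<beta>
        * ((x \<bullet> \<nu>) powr (\<alpha> - real (total_degree \<nu> \<beta>)) * tangential_monomial \<nu> \<beta> x) else 0)" for x
  proof (cases "x \<in> upper_sphere \<nu>")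
    case True
    then have "0 < x \<bullet> \<nu>" "norm x = 1" by (auto simp: upper_sphere_def)
    then show ?thesis
      using True homogeneous_expansion[OF \<nu> w gr \<alpha>(2) k hom, of x] by (simp add: cone_ext_sphere mult.assoc)
  next
    case False
    then show ?thesis using u by (simp add: dirichlet_eigenspace_def)
  qed
  then show "u \<in> spherical_poly_space \<nu> k \<alpha>"
    unfolding spherical_poly_space_def using harmonic_coeffs_slice_coeff[OF \<nu> w gr \<alpha>(2) k hom] by blast
qed

lemma spherical_poly_space_nonzero:
  assumes "u \<in> spherical_poly_space \<nu> k \<alpha>" "u \<noteq> 0"
  shows "\<exists>\<beta>\<in>exponents \<nu> k. slice_coeff \<nu> k (cone_ext \<alpha> u) \<beta> \<noteq> 0 \<and> \<alpha> = real (total_degree \<nu> \<beta>) + 1"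
proof (rule harmonic_coeffs_leading)
  show "harmonic_coeffs \<nu> k \<alpha> (slice_coeff \<nu> k (cone_ext \<alpha> u))"
    using assms(1) unfolding spherical_poly_space_def by blast
  show "\<exists>\<beta>\<in>exponents \<nu> k. slice_coeff \<nu> k (cone_ext \<alpha> u) \<beta> \<noteq> 0"
  proof (rule ccontr)
    assume "\<not> ?thesis"
    then have z: "slice_coeff \<nu> k (cone_ext \<alpha> u) \<beta> = 0" if "\<beta> \<in> exponents \<nu> k" for \<beta> using that by blast
    have "u x = 0" for x
    proof -
      have "u x = (if x \<in> upper_sphere \<nu> then \<Sum>\<beta>\<in>exponents \<nu> k. slice_coeff \<nu> k (cone_ext \<alpha> u) \<beta>
        * ((x \<bullet> \<nu>) powr (\<alpha> - real (total_degree \<nu> \<beta>)) * tangential_monomial \<nu> \<beta> x) else 0)"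
        using assms(1) unfolding spherical_poly_space_def by blast
      then show ?thesis by (simp add: z cong: sum.cong)
    qed
    then have "u = 0" by (auto simp: fun_eq_iff)
    then show False using assms(2) by simp
  qed
qed

text \<open>Listing the entries of a multi-index embeds the set into the lists of length \<open>DIM('a) - 1\<close> with
  sum \<open>j\<close>, which are counted by stars and bars.\<close>

lemma card_exponents_total_degree:
  fixes \<nu> :: "'a::euclidean_space"
  assumes "\<nu> \<in> Basis"
  shows "card {\<beta> \<in> exponents \<nu> k. total_degree \<nu> \<beta> = j} \<le> level_mult (DIM('a) - 1) j"
proof -
  let ?Y = "{\<beta> \<in> exponents \<nu> k. total_degree \<nu> \<beta> = j}"
  let ?L = "{l::nat list. length l = DIM('a) - 1 \<and> sum_list l = j}"
  obtain bs where bs: "distinct bs" "set bs = tangents \<nu>" using finite_distinct_list[OF finite_Diff[OF finite_Basis], of "{\<nu>}"] by blast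
  have len: "length bs = DIM('a) - 1" using distinct_card[OF bs(1)] assms unfolding bs(2) by (simp add: card_Diff_singleton)
  have "(\<lambda>\<beta>. map \<beta> bs) ` ?Y \<subseteq> ?L"
    by (auto simp: len total_degree_def sum_list_distinct_conv_sum_set[OF bs(1)] bs(2))
  moreover have "inj_on (\<lambda>\<beta>. map \<beta> bs) ?Y"
  proof (rule inj_onI)
    fix \<beta> \<gamma> assume "\<beta> \<in> ?Y" "\<gamma> \<in> ?Y" "map \<beta> bs = map \<gamma> bs"
    then show "\<beta> = \<gamma>" using bs(2) unfolding exponents_def by (auto intro: PiE_ext)
  qed
  moreover have "finite ?L"
  proof (rule finite_subset)
    show "?L \<subseteq> {l. set l \<subseteq> {..j} \<and> length l = DIM('a) - 1}" by (auto dest: member_le_sum_list)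
    show "finite {l. set l \<subseteq> {..j} \<and> length l = DIM('a) - 1}" by (rule finite_lists_length_eq) simp
  qed
  ultimately have "card ?Y \<le> card ?L" by - (rule card_inj_on_le)
  then show ?thesis by (simp only: card_length_sum_list level_mult_def)
qed

text \<open>For \<open>\<mu> > 0\<close> the exponent \<open>\<alpha>\<close> is the positive root of \<open>\<alpha> (\<alpha> + DIM('a) - 2) = \<mu>\<close>, and a
  nonzero element of the space of expansions forces it to be an integer.\<close>

lemma dirichlet_eigenvalue_is_energy_level:
  fixes \<nu> :: "'a::euclidean_space"
  assumes \<nu>: "\<nu> \<in> Basis" and D: "2 \<le> DIM('a)" and \<mu>: "\<mu> \<in> dirichlet_eigenvalues (upper_sphere \<nu>)"
  shows "\<exists>j. \<mu> = energy_level (DIM('a) - 1) j"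
proof -
  obtain u where u: "u \<in> dirichlet_eigenspace (upper_sphere \<nu>) \<mu>" "u \<noteq> (\<lambda>_. 0)"
    using \<mu> unfolding dirichlet_eigenvalues_def mem_Collect_eq by (rule bexE)
  have pos: "\<mu> > 0"
  proof (rule ccontr)
    assume "\<not> 0 < \<mu>"
    then have "u = (\<lambda>_. 0)" by (intro eigenspace_nonpos_trivial[OF \<nu> D u(1)]) simp
    with u(2) show False by contradiction
  qed
  define m where "m = real DIM('a) - 2"
  have m: "m \<ge> 0" using D by (simp add: m_def)
  define r where "r = sqrt (m\<^sup>2 + 4 * \<mu>)"
  define \<alpha> where "\<alpha> = (r - m) / 2"
  have sq: "r\<^sup>2 = m\<^sup>2 + 4 * \<mu>" using pos by (simp add: r_def)
  have "m < r" unfolding r_def using pos by (intro real_less_rsqrt) simp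
  then have \<alpha>: "\<alpha> > 0" by (simp add: \<alpha>_def)
  have two: "2 * \<alpha> = r - m" by (simp add: \<alpha>_def)
  have "4 * (\<alpha> * (\<alpha> + m)) = (2 * \<alpha>) * (2 * \<alpha> + 2 * m)" by (simp add: distrib_left)
  also have "\<dots> = (r - m) * (r + m)" by (simp add: two)
  also have "\<dots> = r\<^sup>2 - m\<^sup>2"
    by (simp add: power2_eq_square left_diff_distrib distrib_left mult.commute[of m r])
  finally have "\<mu> = \<alpha> * (\<alpha> + m)" using sq by simp
  then have \<mu>eq: "\<mu> = \<alpha> * (\<alpha> + real DIM('a) - 2)" by (simp add: m_def)
  obtain k where k: "\<alpha> < real k" using reals_Archimedean2 by blast
  have "u \<in> spherical_poly_space \<nu> k \<alpha>" using eigenspace_subset_spherical_poly_space[OF \<nu> \<alpha> k \<mu>eq] u(1) by blast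
  moreover have "u \<noteq> 0" using u(2) by (auto simp: fun_eq_iff)
  ultimately obtain \<beta> where "\<alpha> = real (total_degree \<nu> \<beta>) + 1" using spherical_poly_space_nonzero by blast
  then have "\<mu> = energy_level (DIM('a) - 1) (total_degree \<nu> \<beta>)"
    unfolding \<mu>eq energy_level_def using D by (simp add: of_nat_diff add_ac)
  then show ?thesis by blast
qed

text \<open>The coefficients of degree \<open>j\<close> determine an element of the space of expansions with exponent
  \<open>\<alpha> = j + 1\<close>: if they vanish, there is no leading coefficient.\<close>

lemma eigenvalue_multiplicity_le:
  fixes \<nu> :: "'a::euclidean_space"
  assumes \<nu>: "\<nu> \<in> Basis" and D: "2 \<le> DIM('a)"
  shows "eigenvalue_multiplicity (upper_sphere \<nu>) (energy_level (DIM('a) - 1) j) \<le> of_nat (level_mult (DIM('a) - 1) j)"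
proof -
  define \<alpha> where "\<alpha> = real j + 1"
  \<comment> \<open>any integer greater than \<open>\<alpha>\<close>\<close>
  define k where "k = j + 2"
  let ?E = "dirichlet_eigenspace (upper_sphere \<nu>) (energy_level (DIM('a) - 1) j)"
  let ?S = "spherical_poly_space \<nu> k \<alpha>"
  have \<alpha>: "\<alpha> > 0" "\<alpha> < real k" by (simp_all add: \<alpha>_def k_def)
  have "energy_level (DIM('a) - 1) j = \<alpha> * (\<alpha> + real DIM('a) - 2)"
    using D by (simp add: energy_level_def \<alpha>_def of_nat_diff add_ac)
  then have ES: "?E \<subseteq> ?S" using eigenspace_subset_spherical_poly_space[OF \<nu> \<alpha>] by blast
  define Y where "Y = {\<beta> \<in> exponents \<nu> k. total_degree \<nu> \<beta> = j}"
  have Y: "finite Y" by (simp add: Y_def)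
  \<comment> \<open>reads off the coefficients of degree \<open>j\<close>\<close>
  define T :: "('a \<Rightarrow> real) \<Rightarrow> ('a \<Rightarrow> nat) \<Rightarrow> real" where
    "T = (\<lambda>u \<beta>. if \<beta> \<in> Y then slice_coeff \<nu> k (cone_ext \<alpha> u) \<beta> else 0)"
  obtain W where W: "finite W" "card W \<le> card Y" "?S \<subseteq> fun_vs.span W"
  proof (rule subspace_spanned_via_injection[OF subspace_spherical_poly_space[of \<nu> k \<alpha>], of T Y])
    show "T (f + g) = T f + T g" for f g by (auto simp: T_def slice_coeff_cone_ext_add fun_eq_iff)
    show "T (fun_scale c f) = fun_scale c (T f)" for c f
      by (auto simp: T_def slice_coeff_cone_ext_scale fun_eq_iff)
    show "f = 0" if f: "f \<in> ?S" and Tf: "T f = 0" for f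
    proof (rule ccontr)
      assume "f \<noteq> 0"
      then obtain \<beta> where \<beta>: "\<beta> \<in> exponents \<nu> k" "slice_coeff \<nu> k (cone_ext \<alpha> f) \<beta> \<noteq> 0" "\<alpha> = real (total_degree \<nu> \<beta>) + 1"
        using spherical_poly_space_nonzero[OF f] by blast
      then have "\<beta> \<in> Y" by (simp add: Y_def \<alpha>_def)
      then have "T f \<beta> \<noteq> 0" using \<beta>(2) by (simp add: T_def)
      then show False using Tf by simp
    qed
  qed (auto simp: T_def Y)
  have EW: "?E \<subseteq> fun_vs.span W" using ES W(3) by blast
  have "fun_vs.dim ?E \<le> card W" using EW W(1) by (rule fun_vs.dim_le_card)
  also have "\<dots> \<le> level_mult (DIM('a) - 1) j"
    using W(2) card_exponents_total_degree[OF \<nu>, of k j] unfolding Y_def by linarith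
  finally have "fun_vs.dim ?E \<le> level_mult (DIM('a) - 1) j" .
  then show ?thesis unfolding eigenvalue_multiplicity_def using EW W(1) by (auto simp: of_nat_mono)
qed

section \<open>Summation over the energy levels\<close>

lemma energy_level_mono: "i < j \<Longrightarrow> energy_level d i < energy_level d j"
  unfolding energy_level_def by (intro mult_strict_mono') auto

text \<open>Exactly the levels \<open>j < k\<close> lie below \<open>z\<close>, so their positive parts can be dropped and the
  estimate for a finite number of levels applies.\<close>

lemma infsum_levels_le:
  fixes m :: "real \<Rightarrow> ennreal"
  assumes d: "d \<in> {3, 4, 5}" and z: "z \<ge> 0"
    and ev: "\<And>\<mu>. \<mu> \<in> A \<Longrightarrow> \<exists>j. \<mu> = energy_level d j"
    and m: "\<And>j. m (energy_level d j) \<le> of_nat (level_mult d j)"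
  shows "(\<Sum>\<^sub>\<infinity>\<mu>\<in>A. m \<mu> * ennreal (max (z - \<mu>) 0))
    \<le> ennreal (2 / ((real d + 2) * fact d) * z powr (1 + real d / 2))"
proof -
  have ex: "z \<le> energy_level d (nat \<lceil>z\<rceil>)"
  proof -
    have "z \<le> real (nat \<lceil>z\<rceil>)" by linarith
    also have "\<dots> \<le> real (Suc (nat \<lceil>z\<rceil>)) * 1" by simp
    also have "\<dots> \<le> energy_level d (nat \<lceil>z\<rceil>)"
      unfolding energy_level_def using d by (intro mult_left_mono) auto
    finally show ?thesis .
  qed
  \<comment> \<open>the number of levels below \<open>z\<close>\<close>
  define k where "k = (LEAST j. z \<le> energy_level d j)"
  have k: "z \<le> energy_level d k" unfolding k_def using ex by (rule LeastI)
  have below: "energy_level d j < z" if "j < k" for j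
    using not_less_Least[of j "\<lambda>j. z \<le> energy_level d j"] that by (auto simp: k_def)
  let ?F = "energy_level d ` {..<k}"
  have inj: "inj_on (energy_level d) {..<k}"
    by (rule inj_onI) (metis energy_level_mono less_irrefl linorder_neqE_nat)
  have "(\<Sum>\<^sub>\<infinity>\<mu>\<in>A. m \<mu> * ennreal (max (z - \<mu>) 0)) = (\<Sum>\<^sub>\<infinity>\<mu>\<in>A \<inter> ?F. m \<mu> * ennreal (max (z - \<mu>) 0))"
  proof (rule infsum_cong_neutral)
    fix \<mu> assume "\<mu> \<in> A - A \<inter> ?F"
    then obtain j where j: "\<mu> = energy_level d j" "\<not> j < k" using ev by blast
    then have "z \<le> \<mu>" using k energy_level_mono[of k j d] by (cases "j = k") auto
    then show "m \<mu> * ennreal (max (z - \<mu>) 0) = 0" by (simp add: max_def)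
  qed auto
  also have "\<dots> = (\<Sum>\<mu>\<in>A \<inter> ?F. m \<mu> * ennreal (max (z - \<mu>) 0))" by (intro infsum_finite) simp
  also have "\<dots> \<le> (\<Sum>\<mu>\<in>?F. m \<mu> * ennreal (max (z - \<mu>) 0))" by (intro sum_mono2) auto
  also have "\<dots> = (\<Sum>j<k. m (energy_level d j) * ennreal (max (z - energy_level d j) 0))"
    using inj by (simp add: sum.reindex)
  also have "\<dots> \<le> (\<Sum>j<k. ennreal (real (level_mult d j) * (z - energy_level d j)))"
  proof (rule sum_mono)
    fix j assume "j \<in> {..<k}"
    then have "energy_level d j < z" using below by simp
    then have "ennreal (real (level_mult d j) * (z - energy_level d j)) = of_nat (level_mult d j) * ennreal (max (z - energy_level d j) 0)"
      by (simp add: ennreal_mult ennreal_of_nat_eq_real_of_nat max_def)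
    then show "m (energy_level d j) * ennreal (max (z - energy_level d j) 0)
      \<le> ennreal (real (level_mult d j) * (z - energy_level d j))"
      using m[of j] by (simp add: mult_right_mono)
  qed
  also have "\<dots> = ennreal (\<Sum>j<k. real (level_mult d j) * (z - energy_level d j))"
    using below by (intro sum_ennreal mult_nonneg_nonneg) (auto simp: less_imp_le)
  also have "\<dots> \<le> ennreal (2 / ((real d + 2) * fact d) * z powr (1 + real d / 2))"
    by (intro ennreal_leI riesz_sum_le[OF d z])
  finally show ?thesis .
qed

section \<open>The semiclassical constant\<close>

text \<open>The factor \<open>(d + 1) / 2\<close> times the volume of the unit ball is the area of the hemisphere.  The two
  Gamma functions in the denominator combine to \<open>d!\<close> by Legendre's duplication formula.\<close>

lemma weyl_constant_hemisphere:
  "L_class 1 d * ((real d + 1) / 2 * unit_ball_vol (real d + 1)) = 2 / ((real d + 2) * fact d)"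
proof -
  define x where "x = (real d + 1) / 2"
  have x: "x > 0" by (simp add: x_def)
  have two_x: "2 * x = real d + 1" by (simp add: x_def)
  have dup: "Gamma x * Gamma (x + 1/2) = exp ((1 - 2*x) * ln 2) * sqrt pi * Gamma (2*x)"
  proof -
    have "complex_of_real (Gamma x * Gamma (x + 1/2)) = Gamma (of_real x) * Gamma (of_real x + 1/2)"
      by (simp add: Gamma_complex_of_real[symmetric])
    also have "\<dots> = exp ((1 - 2 * of_real x) * of_real (ln 2)) * of_real (sqrt pi) * Gamma (2 * of_real x)"
    proof (rule Gamma_legendre_duplication)
      show "complex_of_real x \<notin> \<int>\<^sub>\<le>\<^sub>0" using x by (auto elim!: nonpos_Ints_cases simp: complex_eq_iff)
      show "complex_of_real x + 1/2 \<notin> \<int>\<^sub>\<le>\<^sub>0" using x by (auto elim!: nonpos_Ints_cases simp: complex_eq_iff)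
    qed
    also have "\<dots> = complex_of_real (exp ((1 - 2*x) * ln 2) * sqrt pi * Gamma (2*x))"
      by (simp add: Gamma_complex_of_real[symmetric] exp_of_real[symmetric])
    finally show ?thesis using of_real_eq_iff by blast
  qed
  have G1: "Gamma (2*x) = fact d" using Gamma_fact[of d, where 'a=real] by (simp add: two_x add.commute)
  have G2: "Gamma (1 + 1 + real d / 2) = (x + 1/2) * Gamma (x + 1/2)"
    using Gamma_plus1[of "x + 1/2"] x by (simp add: x_def field_simps nonpos_Ints_def)
       
  have G3: "Gamma (x + 1) = x * Gamma x" using x by (intro Gamma_plus1) (auto elim!: nonpos_Ints_cases)
  have e: "exp ((1 - 2*x) * ln 2) = 1 / 2 ^ d"
    by (simp add: x_def exp_minus powr_def[of 2, symmetric] exp_of_nat_mult field_simps)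
  have pos: "Gamma x > 0" "Gamma (x + 1/2) > 0" using x by (auto intro: Gamma_real_pos)
  have p4: "(4 * pi) powr (- (real d / 2)) = 1 / (2 ^ d * pi powr (real d / 2))"
  proof -
    have "(4::real) powr (real d / 2) = 2 ^ d"
      using powr_powr[of 2 2 "real d / 2"] by (simp add: powr_realpow)
    then show ?thesis by (simp add: powr_minus powr_mult field_simps)
  qed
  have pi1: "pi powr x = pi powr (real d / 2) * sqrt pi"
    by (simp add: x_def add_divide_distrib powr_add powr_half_sqrt)
  have "Gamma (2::real) = 1" using Gamma_fact[of 1, where 'a=real] by simp
  then have L: "L_class 1 d = 1 / (2 ^ d * pi powr (real d / 2) * ((x + 1/2) * Gamma (x + 1/2)))"
    unfolding L_class_def p4 G2 by simp
  have V: "unit_ball_vol (real d + 1) = pi powr (real d / 2) * sqrt pi / (x * Gamma x)"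
    unfolding unit_ball_vol_def x_def[symmetric] G3 pi1 ..
  have "L_class 1 d * (x * unit_ball_vol (real d + 1))
     = sqrt pi / (2 ^ d * ((x + 1/2) * (Gamma (x + 1/2) * Gamma x)))"
    unfolding L V using x by (simp add: divide_simps)
  also have "\<dots> = 1 / ((x + 1/2) * fact d)"
    using dup by (simp add: G1 e mult.commute[of "Gamma x"])
  also have "\<dots> = 2 / ((real d + 2) * fact d)" by (simp add: x_def field_simps)
  finally show ?thesis by (simp add: x_def)
qed

text \<open>The map \<open>x \<mapsto> - x\<close> exchanges the two open half balls, and the equatorial disc is a null set.\<close>

lemma sphere_measure_hemisphere:
  "sphere_measure (hemisphere :: ((real ^ 'n) \<times> real) set)
     = (real CARD('n) + 1) / 2 * unit_ball_vol (real CARD('n) + 1)"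
proof -
  define A where "A = {x::(real ^ 'n) \<times> real. norm x \<le> 1 \<and> 0 < snd x}"
  define A' where "A' = {x::(real ^ 'n) \<times> real. norm x \<le> 1 \<and> snd x < 0}"
  define Z where "Z = {x::(real ^ 'n) \<times> real. norm x \<le> 1 \<and> snd x = 0}"
  have cone: "{x \<in> cone_over (hemisphere :: ((real ^ 'n) \<times> real) set). norm x \<le> 1} = A"
    by (auto simp: cone_over_def hemisphere_def A_def norm_sgn) (simp_all add: sgn_div_norm zero_less_mult_iff)
  have ball: "cball 0 1 = (A \<union> A') \<union> Z" by (auto simp: A_def A'_def Z_def)
  have Z: "negligible Z"
  proof (rule negligible_subset)
    show "negligible {x::(real ^ 'n) \<times> real. x \<bullet> (0, 1) = 0}"
      by (rule negligible_standard_hyperplane) (simp add: Basis_prod_def)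
    show "Z \<subseteq> {x. x \<bullet> (0, 1) = 0}" by (auto simp: Z_def inner_prod_def)
  qed
  have disj: "A \<inter> A' = {}" by (auto simp: A_def A'_def)
  have "A = cball 0 1 \<inter> {x. 0 < snd x}" "A' = cball 0 1 \<inter> {x. snd x < 0}"
    by (auto simp: A_def A'_def)
  moreover have "open {x::(real ^ 'n) \<times> real. 0 < snd x}" "open {x::(real ^ 'n) \<times> real. snd x < 0}"
    by (intro open_Collect_less continuous_intros)+
  ultimately have m: "A \<in> lmeasurable" "A' \<in> lmeasurable"
    by (auto intro!: bounded_set_imp_lmeasurable bounded_Int)
  have "A' = (\<lambda>x. (-1) *\<^sub>R x + 0) ` A"
  proof (intro subset_antisym subsetI)
    fix x assume "x \<in> A'"
    then have "- x \<in> A" by (simp add: A_def A'_def)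
    then show "x \<in> (\<lambda>x. (-1) *\<^sub>R x + 0) ` A" by (intro image_eqI[of _ _ "- x"]) simp_all
  next
    fix x assume "x \<in> (\<lambda>x. (-1) *\<^sub>R x + 0) ` A"
    then obtain y where "y \<in> A" "x = (-1) *\<^sub>R y + 0" by blast
    then show "x \<in> A'" by (simp add: A_def A'_def)
  qed
  then have eq: "measure lebesgue A' = measure lebesgue A"
    by (simp only: measure_lebesgue_affine) simp
  have "measure lebesgue (cball 0 1 :: ((real ^ 'n) \<times> real) set) = measure lebesgue (A \<union> A')"
    unfolding ball using Z m by (intro measure_negligible_symdiff)
      (auto intro: negligible_subset)
  also have "\<dots> = measure lebesgue A + measure lebesgue A'"
    using m disj by (simp add: measure_Un3)
  finally have "2 * measure lebesgue A = unit_ball_vol (real CARD('n) + 1)"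
    using content_cball[of 1 "0 :: (real ^ 'n) \<times> real"] by (simp add: eq add.commute)
  then show ?thesis by (simp add: sphere_measure_def cone field_simps)
qed

theorem theorem4p2p5:
  fixes d :: nat and z :: real
  assumes "d \<in> {3, 4, 5}" and "CARD('n::finite) = d" and "z \<ge> 0"
  shows "riesz_mean_1 (hemisphere :: ((real ^ 'n) \<times> real) set) z
    \<le> ennreal (L_class 1 d * sphere_measure (hemisphere :: ((real ^ 'n) \<times> real) set)
        * z powr (1 + real d / 2))"
proof -
  define \<nu> :: "(real ^ 'n) \<times> real" where "\<nu> = (0, 1)"
  have \<nu>: "\<nu> \<in> Basis" by (simp add: \<nu>_def Basis_prod_def)
  have D: "DIM((real ^ 'n) \<times> real) - 1 = d" "2 \<le> DIM((real ^ 'n) \<times> real)"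
    using assms by auto
  have hemi: "hemisphere = upper_sphere \<nu>"
    by (auto simp: hemisphere_def upper_sphere_def \<nu>_def inner_prod_def)
  have "riesz_mean_1 (upper_sphere \<nu>) z
      \<le> ennreal (2 / ((real d + 2) * fact d) * z powr (1 + real d / 2))"
    unfolding riesz_mean_1_def
  proof (rule infsum_levels_le[OF assms(1,3)])
    show "\<exists>j. \<mu> = energy_level d j" if "\<mu> \<in> dirichlet_eigenvalues (upper_sphere \<nu>)" for \<mu>
      using dirichlet_eigenvalue_is_energy_level[OF \<nu> D(2) that] unfolding D(1) .
    show "eigenvalue_multiplicity (upper_sphere \<nu>) (energy_level d j) \<le> of_nat (level_mult d j)" for j
      using eigenvalue_multiplicity_le[OF \<nu> D(2), of j] unfolding D(1) .
  qed
  also have "2 / ((real d + 2) * fact d) = L_class 1 d * sphere_measure (hemisphere :: ((real ^ 'n) \<times> real) set)"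
    unfolding sphere_measure_hemisphere assms(2) weyl_constant_hemisphere ..
  finally show ?thesis unfolding hemi .
qed

end
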